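(* Consider the semidefinite program of minimizing $\langle C,X\rangle$ subject to $\mathcal{A}(X)=b$, $X\succeq0$, where $C\in\mathbb{S}^n$, and suppose it admits a rank-$r_\star$ solution $X_\star$. Let $r\ge r_\star$, let $U_\star\in\mathbb{R}^{n\times r}$ satisfy $U_\star U_\star^\top=X_\star$, and suppose the Rank-$r$ constraint qualification and the Strict complementarity and dual non-degeneracy assumptions in the context hold, the latter with constants $\lambda_{Z_\star},\gamma_Q>0$. Then: (i) the solution of the semidefinite program is unique; (ii) $\varphi_f(U)=\langle C,UU^\top\rangle$ on $\mathbb{R}^{n\times r}$ has local quadratic growth: for all $U\in\mathbb{R}^{n\times r}$ near $U_\star$ with $\mathcal{A}(UU^\top)=b$, $$\varphi_f(U)-\varphi_f(U_\star)\ge\frac{\alpha_{\varphi_f}}{2}\,\mathrm{dist}(U,U_\star)^2,$$ where $\alpha_{\varphi_f}>0$ depends on $(X_\star,\mathcal{A},\lambda_{Z_\star},\gamma_Q)$ but not on $r$ (so that the rank-$r$ quadratic growth property of $f(X)=\langle C,X\rangle$ given in the context holds); (iii) for all sufficiently large $\lambda$, there are constants $\ell,\widetilde\ell>0$ such that $\varphi(U)=\langle C,UU^\top\rangle+\lambda\|\mathcal{A}(UU^\top)-b\|_2$ satisfies, for all $U$ in a neighborhood of $S=\{U\in\mathbb{R}^{n\times r}:UU^\top=X_\star\}$, $$\varphi(U)-\varphi_\star\le\ell\cdot\mathrm{dist}(0,\partial\varphi(U))\cdot\mathrm{dist}(U,S)\quad\text{and}\quad\mathrm{dist}(U,S)\le\widetilde\ell\cdot\mathrm{dist}(0,\partial\varphi(U)),$$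 where $\varphi_\star=\langle C,X_\star\rangle$.
   Context: $\mathbb{S}^n$ is the space of symmetric $n\times n$ matrices with Frobenius inner product. $\mathcal{A}:\mathbb{S}^n\to\mathbb{R}^k$, $[\mathcal{A}(X)]_i=\langle A_i,X\rangle$ with $A_i\in\mathbb{S}^n$; $b\in\mathbb{R}^k$. Let $X_\star=Q_1\Sigma_xQ_1^\top$ be the eigenvalue decomposition with $Q_1\in\mathbb{R}^{n\times r_\star}$ having orthonormal columns and $\Sigma_x\in\mathbb{R}^{r_\star\times r_\star}$ diagonal and positive definite. $\mathrm{dist}(U,S)=\min_{U'\in S}\|U-U'\|_F$ and $\mathrm{dist}(U,U_\star)=\min_{\Omega\in\mathbb{R}^{r\times r},\,\Omega^\top\Omega=I_r}\|U-U_\star\Omega\|_F=\mathrm{dist}(U,S)$ (Procrustes distance). Sub-differential: with $h(X)=\langle C,X\rangle+\lambda\|\mathcal{A}(X)-b\|_2$, $\partial\varphi(U)=\{2GU:G\in\partial h(UU^\top)\}$, with $\mathrm{dist}(0,\cdot)$ taken in Frobenius norm. Rank-$r$ constraint qualification. $\mathcal{M}_r=\{U\in\mathbb{R}^{n\times r}:\mathcal{A}(UU^\top)=b\}$ is a smooth manifold, and there is $\gamma>0$ such that $\sigma_{\min}(M_U)\ge\gamma$ for all $U$ in a neighborhood of $S$, where $M_U=[\mathrm{vec}(A_1U)\ \cdots\ \mathrm{vec}(A_kU)]\in\mathbb{R}^{nr\times k}$ and $\sigma_{\min}$ is the $k$-th largest singular value. Strict complementarity and dual non-degeneracy. There is a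 dual optimal pair $(y_\star,Z_\star)$, i.e. $y_\star\in\mathbb{R}^k$, $Z_\star\succeq0$, $C+\sum_{i=1}^k(y_\star)_iA_i-Z_\star=0$, $\langle Z_\star,X_\star\rangle=0$, such that the $(r_\star+1)$-th smallest singular value of $Z_\star$ is at least $\lambda_{Z_\star}>0$; and there is $\gamma_Q>0$ with $\sum_{i=1}^k\langle Q_1^\top A_iQ_1,W\rangle^2\ge\gamma_Q\|W\|_F^2$ for all $W\in\mathbb{S}^{r_\star}$. Rank-$r$ quadratic growth property of $f$: there exist $\alpha_f>0$ and $\varepsilon>0$ such that $f(X)\ge f(X_\star)+\frac{\alpha_f}{2}\|X-X_\star\|_F^2$ for all $X\succeq0$ with $\mathcal{A}(X)=b$, $\mathrm{rank}(X)\le r$, $\|X-X_\star\|_F\le\varepsilon$. *)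

theory Defs
  imports
    "Jordan_Normal_Form.Char_Poly"
    "Jordan_Normal_Form.DL_Rank"
begin

text \<open>
  Matrices are carrier-based, because the number \<open>r\<close> of columns of the factor \<open>U\<close> is quantified
  inside the main statement. All indices start at 0.
\<close>

section \<open>Symmetric matrices and the Frobenius geometry\<close>

definition sym_mats :: "nat \<Rightarrow> real mat set" where
  "sym_mats n = {X \<in> carrier_mat n n. transpose_mat X = X}"

definition psd :: "nat \<Rightarrow> real mat \<Rightarrow> bool" where
  "psd n X \<longleftrightarrow> X \<in> sym_mats n \<and> (\<forall>v \<in> carrier_vec n. 0 \<le> v \<bullet> (X *\<^sub>v v))"

definition pos_def :: "nat \<Rightarrow> real mat \<Rightarrow> bool" where
  "pos_def n X \<longleftrightarrow> X \<in> sym_mats n \<and> (\<forall>v \<in> carrier_vec n. v \<noteq> 0\<^sub>v n \<longrightarrow> 0 < v \<bullet> (X *\<^sub>v v))"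

definition frob_inner :: "real mat \<Rightarrow> real mat \<Rightarrow> real" where
  "frob_inner X Y = (\<Sum>i<dim_row X. \<Sum>j<dim_col X. X $$ (i, j) * Y $$ (i, j))"

definition frob_norm :: "real mat \<Rightarrow> real" where
  "frob_norm X = sqrt (frob_inner X X)"

definition norm2 :: "real vec \<Rightarrow> real" where
  "norm2 v = sqrt (v \<bullet> v)"

definition frob_ball :: "nat \<Rightarrow> nat \<Rightarrow> real mat \<Rightarrow> real \<Rightarrow> real mat set" where
  "frob_ball n r P e = {U \<in> carrier_mat n r. frob_norm (U - P) < e}"

definition frob_dist :: "real mat \<Rightarrow> real mat set \<Rightarrow> real" where
  "frob_dist U T = (INF V \<in> T. frob_norm (U - V))"

definition procrustes_dist :: "nat \<Rightarrow> real mat \<Rightarrow> real mat \<Rightarrow> real" where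
  "procrustes_dist r U V =
     (INF Om \<in> {Om \<in> carrier_mat r r. transpose_mat Om * Om = 1\<^sub>m r}. frob_norm (U - V * Om))"

text \<open>
  For an \<open>m\<close> by \<open>k\<close> matrix: the \<open>k\<close> square roots of the eigenvalues of the Gram matrix
  \<open>M\<^sup>T M\<close>, with multiplicity, in ascending order. If \<open>k > m\<close>, this pads the usual list of
  \<open>min m k\<close> singular values with zeros.
\<close>
definition singular_values :: "real mat \<Rightarrow> real list" where
  "singular_values M =
     map sqrt (sorted_list_of_multiset (proots (char_poly (transpose_mat M * M))))"

definition kth_smallest_sv :: "nat \<Rightarrow> real mat \<Rightarrow> real" where
  "kth_smallest_sv j M = singular_values M ! (j - 1)"

definition kth_largest_sv :: "nat \<Rightarrow> real mat \<Rightarrow> real" where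
  "kth_largest_sv j M = rev (singular_values M) ! (j - 1)"

section \<open>The semidefinite program\<close>

definition meas_op :: "nat \<Rightarrow> (nat \<Rightarrow> real mat) \<Rightarrow> real mat \<Rightarrow> real vec" where
  "meas_op k A X = vec k (\<lambda>i. frob_inner (A i) X)"

definition meas_adj :: "nat \<Rightarrow> nat \<Rightarrow> (nat \<Rightarrow> real mat) \<Rightarrow> real vec \<Rightarrow> real mat" where
  "meas_adj n k A y = mat n n (\<lambda>(p, q). \<Sum>i<k. y $ i * A i $$ (p, q))"

definition sdp_feasible :: "nat \<Rightarrow> nat \<Rightarrow> (nat \<Rightarrow> real mat) \<Rightarrow> real vec \<Rightarrow> real mat \<Rightarrow> bool" where
  "sdp_feasible n k A b X \<longleftrightarrow> psd n X \<and> meas_op k A X = b"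

definition sdp_solution ::
  "nat \<Rightarrow> nat \<Rightarrow> real mat \<Rightarrow> (nat \<Rightarrow> real mat) \<Rightarrow> real vec \<Rightarrow> real mat \<Rightarrow> bool" where
  "sdp_solution n k C A b X \<longleftrightarrow>
     sdp_feasible n k A b X \<and> (\<forall>Y. sdp_feasible n k A b Y \<longrightarrow> frob_inner C X \<le> frob_inner C Y)"

definition factor_set :: "nat \<Rightarrow> nat \<Rightarrow> real mat \<Rightarrow> real mat set" where
  "factor_set n r X = {U \<in> carrier_mat n r. U * transpose_mat U = X}"

section \<open>Smooth submanifolds of the space of \<open>n\<close> by \<open>r\<close> matrices\<close>

definition unit_mat :: "nat \<Rightarrow> nat \<Rightarrow> nat \<Rightarrow> nat \<Rightarrow> real mat" where
  "unit_mat n r i j = mat n r (\<lambda>(p, q). if p = i \<and> q = j then 1 else 0)"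

definition has_partial ::
  "nat \<Rightarrow> nat \<Rightarrow> nat \<Rightarrow> nat \<Rightarrow> (real mat \<Rightarrow> real) \<Rightarrow> real \<Rightarrow> real mat \<Rightarrow> bool" where
  "has_partial n r i j f d U \<longleftrightarrow>
     ((\<lambda>t. f (U + t \<cdot>\<^sub>m unit_mat n r i j)) has_real_derivative d) (at 0)"

definition frob_continuous_on :: "real mat set \<Rightarrow> (real mat \<Rightarrow> real) \<Rightarrow> bool" where
  "frob_continuous_on V f \<longleftrightarrow>
     (\<forall>U\<in>V. \<forall>e>0. \<exists>d>0. \<forall>W\<in>V. frob_norm (W - U) < d \<longrightarrow> \<bar>f W - f U\<bar> < e)"

text \<open>\<open>C\<^sup>m\<close> functions on an open set \<open>V\<close>: all partial derivatives of order at most \<open>m\<close> exist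
  and are continuous.\<close>
primrec Ck_on ::
  "nat \<Rightarrow> nat \<Rightarrow> nat \<Rightarrow> real mat set \<Rightarrow> (real mat \<Rightarrow> real) \<Rightarrow> bool" where
  "Ck_on n r 0 V f \<longleftrightarrow> frob_continuous_on V f"
| "Ck_on n r (Suc m) V f \<longleftrightarrow> frob_continuous_on V f \<and>
     (\<forall>i<n. \<forall>j<r. \<exists>g. (\<forall>U\<in>V. has_partial n r i j f (g U) U) \<and> Ck_on n r m V g)"

definition smooth_on :: "nat \<Rightarrow> nat \<Rightarrow> real mat set \<Rightarrow> (real mat \<Rightarrow> real) \<Rightarrow> bool" where
  "smooth_on n r V f \<longleftrightarrow> (\<forall>m. Ck_on n r m V f)"

text \<open>
  Embedded submanifold of codimension \<open>m\<close>: near each of its points \<open>P\<close>, the set is the zero set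
  of \<open>m\<close> smooth functions \<open>h 0, \<dots>, h (m - 1)\<close> whose Jacobian \<open>J\<close> at \<open>P\<close> has full rank \<open>m\<close>.
  For \<open>m = 0\<close> this says that the set is open. Entry \<open>(i, j)\<close> of a matrix has position
  \<open>j * n + i\<close> in its columnwise vectorization.
\<close>
definition smooth_submanifold :: "nat \<Rightarrow> nat \<Rightarrow> real mat set \<Rightarrow> bool" where
  "smooth_submanifold n r M \<longleftrightarrow> M \<subseteq> carrier_mat n r \<and>
     (\<exists>m. \<forall>P\<in>M. \<exists>e>0. \<exists>h :: nat \<Rightarrow> real mat \<Rightarrow> real. \<exists>J \<in> carrier_mat m (n * r).
        (\<forall>l<m. smooth_on n r (frob_ball n r P e) (h l)) \<and>
        M \<inter> frob_ball n r P e = {U \<in> frob_ball n r P e. \<forall>l<m. h l U = 0} \<and>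
        (\<forall>l<m. \<forall>i<n. \<forall>j<r. has_partial n r i j (h l) (J $$ (l, j * n + i)) P) \<and>
        vec_space.rank m J = m)"

section \<open>The assumptions\<close>

definition vectorize :: "real mat \<Rightarrow> real vec" where
  "vectorize M = vec (dim_row M * dim_col M) (\<lambda>p. M $$ (p mod dim_row M, p div dim_row M))"

definition constraint_jac ::
  "nat \<Rightarrow> nat \<Rightarrow> nat \<Rightarrow> (nat \<Rightarrow> real mat) \<Rightarrow> real mat \<Rightarrow> real mat" where
  "constraint_jac n r k A U = mat_of_cols (n * r) (map (\<lambda>i. vectorize (A i * U)) [0..<k])"

text \<open>
  Rank-\<open>r\<close> constraint qualification. Since \<open>factor_set n r X\<close> is compact, its neighborhoods are
  exactly the supersets of its tubes of positive radius. The singular value bound is void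
  if there are no constraints at all (\<open>k = 0\<close>).
\<close>
definition constraint_qualification ::
  "nat \<Rightarrow> nat \<Rightarrow> nat \<Rightarrow> (nat \<Rightarrow> real mat) \<Rightarrow> real vec \<Rightarrow> real mat \<Rightarrow> bool" where
  "constraint_qualification n r k A b X \<longleftrightarrow>
     smooth_submanifold n r {U \<in> carrier_mat n r. meas_op k A (U * transpose_mat U) = b} \<and>
     (\<exists>\<gamma>>0. \<exists>\<epsilon>>0. \<forall>U \<in> carrier_mat n r. frob_dist U (factor_set n r X) < \<epsilon> \<longrightarrow>
        (0 < k \<longrightarrow> \<gamma> \<le> kth_largest_sv k (constraint_jac n r k A U)))"

definition eigen_decomp :: "nat \<Rightarrow> nat \<Rightarrow> real mat \<Rightarrow> real mat \<Rightarrow> real mat \<Rightarrow> bool" where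
  "eigen_decomp n s X Q D \<longleftrightarrow>
     Q \<in> carrier_mat n s \<and> transpose_mat Q * Q = 1\<^sub>m s \<and>
     diagonal_mat D \<and> pos_def s D \<and> X = Q * D * transpose_mat Q"

definition dual_optimal ::
  "nat \<Rightarrow> nat \<Rightarrow> real mat \<Rightarrow> (nat \<Rightarrow> real mat) \<Rightarrow> real mat \<Rightarrow> real vec \<Rightarrow> real mat \<Rightarrow> bool" where
  "dual_optimal n k C A X y Z \<longleftrightarrow>
     y \<in> carrier_vec k \<and> psd n Z \<and> C + meas_adj n k A y - Z = 0\<^sub>m n n \<and> frob_inner Z X = 0"

text \<open>
  Strict complementarity. If \<open>s = n\<close>, the matrix \<open>Z\<close> has no \<open>(s + 1)\<close>-th smallest singular value
  and the bound is void.
\<close>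
definition strict_complementarity ::
  "nat \<Rightarrow> nat \<Rightarrow> nat \<Rightarrow> real mat \<Rightarrow> (nat \<Rightarrow> real mat) \<Rightarrow> real mat \<Rightarrow> real \<Rightarrow> bool" where
  "strict_complementarity n k s C A X lamZ \<longleftrightarrow>
     (\<exists>y Z. dual_optimal n k C A X y Z \<and> (s < n \<longrightarrow> lamZ \<le> kth_smallest_sv (s + 1) Z))"

definition dual_nondegenerate ::
  "nat \<Rightarrow> nat \<Rightarrow> (nat \<Rightarrow> real mat) \<Rightarrow> real mat \<Rightarrow> real \<Rightarrow> bool" where
  "dual_nondegenerate k s A Q gamQ \<longleftrightarrow>
     (\<forall>W \<in> sym_mats s.
        gamQ * (frob_norm W)\<^sup>2 \<le> (\<Sum>i<k. (frob_inner (transpose_mat Q * A i * Q) W)\<^sup>2))"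

section \<open>Penalty function and quadratic growth\<close>

definition penalty ::
  "nat \<Rightarrow> real mat \<Rightarrow> (nat \<Rightarrow> real mat) \<Rightarrow> real vec \<Rightarrow> real \<Rightarrow> real mat \<Rightarrow> real" where
  "penalty k C A b lam X = frob_inner C X + lam * norm2 (meas_op k A X - b)"

definition convex_subdiff :: "nat \<Rightarrow> (real mat \<Rightarrow> real) \<Rightarrow> real mat \<Rightarrow> real mat set" where
  "convex_subdiff n h X = {G \<in> sym_mats n. \<forall>Y \<in> sym_mats n. h X + frob_inner G (Y - X) \<le> h Y}"

definition factored_penalty ::
  "nat \<Rightarrow> real mat \<Rightarrow> (nat \<Rightarrow> real mat) \<Rightarrow> real vec \<Rightarrow> real \<Rightarrow> real mat \<Rightarrow> real" where
  "factored_penalty k C A b lam U = penalty k C A b lam (U * transpose_mat U)"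

definition factored_subdiff ::
  "nat \<Rightarrow> nat \<Rightarrow> real mat \<Rightarrow> (nat \<Rightarrow> real mat) \<Rightarrow> real vec \<Rightarrow> real \<Rightarrow> real mat \<Rightarrow> real mat set" where
  "factored_subdiff n k C A b lam U =
     {2 \<cdot>\<^sub>m (G * U) | G. G \<in> convex_subdiff n (penalty k C A b lam) (U * transpose_mat U)}"

definition rank_quadratic_growth ::
  "nat \<Rightarrow> nat \<Rightarrow> nat \<Rightarrow> (nat \<Rightarrow> real mat) \<Rightarrow> real vec \<Rightarrow> (real mat \<Rightarrow> real) \<Rightarrow> real mat \<Rightarrow> bool" where
  "rank_quadratic_growth n k r A b f Xs \<longleftrightarrow>
     (\<exists>\<alpha>>0. \<exists>\<epsilon>>0. \<forall>X. psd n X \<and> meas_op k A X = b \<and> vec_space.rank n X \<le> r \<and>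
        frob_norm (X - Xs) \<le> \<epsilon> \<longrightarrow> f X \<ge> f Xs + \<alpha> / 2 * (frob_norm (X - Xs))\<^sup>2)"

end

theory Submission
  imports Defs "HOL-Analysis.L2_Norm" "HOL-Computational_Algebra.Fundamental_Theorem_Algebra"
begin

text \<open>
  Write \<open>Q\<close> for the eigenvector matrix \<open>Q1\<close>, \<open>D\<close> for \<open>Sx\<close>, \<open>E = U - Q Q\<^sup>T U\<close> for the part of \<open>U\<close>
  outside the range of \<open>Xs\<close>, and \<open>V = Q\<^sup>T U\<close> for the part inside. All three claims rest on the
  size of \<open>E\<close>.

  The dual certificate turns the objective gap of a feasible \<open>X = U U\<^sup>T\<close> into \<open>\<langle>Z, X\<rangle>\<close>
  (\<open>objective_gap\<close>). Since \<open>Z Q = 0\<close>, an eigenbasis of \<open>Z\<close> can be chosen to start with the columns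
  of \<open>Q\<close>; the singular value bound then controls all the other eigenvalues, so that
  \<open>\<langle>Z, X\<rangle> \<ge> lamZ \<parallel>E\<parallel>\<^sup>2\<close> (\<open>kth_smallest_sv_gap\<close>). Dual non-degeneracy, applied to
  \<open>V V\<^sup>T - D\<close>, shows that the error inside the range is controlled by the one outside: feasibility makes
  \<open>Q (V V\<^sup>T - D) Q\<^sup>T\<close> and \<open>- (U U\<^sup>T - Q V V\<^sup>T Q\<^sup>T)\<close> have the same measurements, and the latter
  matrix is of order \<open>\<parallel>E\<parallel>\<close> (\<open>range_error\<close>). So \<open>X - Xs\<close> is bounded by a multiple of \<open>E\<close>, which
  gives uniqueness and quadratic growth in \<open>X\<close>.

  For growth in \<open>U\<close>, the Gram matrix error \<open>V V\<^sup>T - D\<close> has to be turned into a distance up to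
  rotation. Polar decomposition does this: with \<open>T\<close> the square root of \<open>V V\<^sup>T\<close>, both \<open>V\<close> and \<open>Q\<^sup>T Us\<close> are
  a square root of their Gram matrix times a matrix with orthonormal rows, some rotation matches
  these rows, and what remains is the difference of \<open>T\<close> and the square root of \<open>D\<close>, which is Lipschitz in the Gram matrix as long as
  \<open>D\<close> stays away from \<open>0\<close> (\<open>procrustes_perturbation\<close>). The growth constant obtained in this way
  is free of \<open>r\<close>.

  For the penalty, let \<open>G\<close> be a subgradient at \<open>X = U U\<^sup>T\<close>. The constraint qualification forces
  \<open>G = C + \<Sum>v\<^sub>i A\<^sub>i\<close>. At an infeasible \<open>U\<close>, \<open>\<parallel>v\<parallel>\<close> is at least the penalty parameter, so
  \<open>\<parallel>G U\<parallel>\<close> is bounded below and the bounds are trivial near the solution set. At a feasible \<open>U\<close> and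
  a nearby factor \<open>W\<close> of \<open>Xs\<close>, the gap equals
  \<open>2 \<langle>G U, U - W\<rangle> - \<langle>G (U - W), U - W\<rangle>\<close>. If \<open>\<parallel>G U\<parallel>\<close> is small, then the
  constraint qualification makes \<open>v\<close> close to the dual solution and \<open>G\<close> close to \<open>Z \<ge> 0\<close>, so the
  quadratic term is at most a small multiple of the squared distance and quadratic growth absorbs
  it (\<open>gradient_error_bound\<close>).
\<close>

section \<open>The Frobenius geometry of real matrices\<close>

declare minus_carrier_mat [simp]

lemma frob_inner_carrier:
  assumes "X \<in> carrier_mat n m"
  shows "frob_inner X Y = (\<Sum>i<n. \<Sum>j<m. X $$ (i, j) * Y $$ (i, j))"
  using assms by (auto simp: frob_inner_def)

lemma frob_inner_commute:
  assumes "X \<in> carrier_mat n m" "Y \<in> carrier_mat n m"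
  shows "frob_inner X Y = frob_inner Y X"
  by (simp add: frob_inner_carrier[OF assms(1)] frob_inner_carrier[OF assms(2)] mult.commute)

lemma frob_inner_add_left:
  assumes "X \<in> carrier_mat n m" "Y \<in> carrier_mat n m"
  shows "frob_inner (X + Y) W = frob_inner X W + frob_inner Y W"
  using assms by (simp add: frob_inner_def sum.distrib distrib_right)

lemma frob_inner_diff_left:
  assumes "X \<in> carrier_mat n m" "Y \<in> carrier_mat n m"
  shows "frob_inner (X - Y) W = frob_inner X W - frob_inner Y W"
  using assms by (simp add: frob_inner_def sum_subtractf left_diff_distrib)

lemma frob_inner_add_right:
  assumes "W \<in> carrier_mat n m" "X \<in> carrier_mat n m" "Y \<in> carrier_mat n m"
  shows "frob_inner W (X + Y) = frob_inner W X + frob_inner W Y"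
  using assms by (simp add: frob_inner_def sum.distrib distrib_left)

lemma frob_inner_diff_right:
  assumes "W \<in> carrier_mat n m" "X \<in> carrier_mat n m" "Y \<in> carrier_mat n m"
  shows "frob_inner W (X - Y) = frob_inner W X - frob_inner W Y"
  using assms by (simp add: frob_inner_def sum_subtractf right_diff_distrib)

lemma frob_inner_self_nonneg: "0 \<le> frob_inner X X"
  by (auto simp: frob_inner_def intro!: sum_nonneg)

lemma frob_norm_nonneg: "0 \<le> frob_norm X"
  by (simp add: frob_norm_def frob_inner_self_nonneg)

lemma frob_norm_sq: "(frob_norm X)\<^sup>2 = frob_inner X X"
  by (simp add: frob_norm_def frob_inner_self_nonneg)

lemma frob_norm_sq_sum:
  assumes "X \<in> carrier_mat n m"
  shows "(frob_norm X)\<^sup>2 = (\<Sum>i<n. \<Sum>j<m. (X $$ (i, j))\<^sup>2)"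
  unfolding frob_norm_sq frob_inner_carrier[OF assms] by (simp add: power2_eq_square)

lemma frob_norm_L2_set:
  assumes "X \<in> carrier_mat n m"
  shows "frob_norm X = L2_set (\<lambda>p. X $$ p) ({..<n} \<times> {..<m})"
  by (simp add: frob_norm_def frob_inner_carrier[OF assms] L2_set_def sum.cartesian_product power2_eq_square
      split_def)

lemma frob_norm_triangle:
  assumes "X \<in> carrier_mat n m" "Y \<in> carrier_mat n m"
  shows "frob_norm (X + Y) \<le> frob_norm X + frob_norm Y"
proof -
  have "L2_set (\<lambda>p. (X + Y) $$ p) ({..<n} \<times> {..<m})
      = L2_set (\<lambda>p. X $$ p + Y $$ p) ({..<n} \<times> {..<m})"
    using assms by (intro L2_set_cong) auto
  also have "\<dots> \<le> L2_set (\<lambda>p. X $$ p) ({..<n} \<times> {..<m}) + L2_set (\<lambda>p. Y $$ p) ({..<n} \<times> {..<m})"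
    by (rule L2_set_triangle_ineq)
  finally show ?thesis
    using assms by (simp add: frob_norm_L2_set[where n=n and m=m])
qed

lemma frob_norm_smult: "frob_norm (c \<cdot>\<^sub>m X) = \<bar>c\<bar> * frob_norm X"
proof -
  have "frob_inner (c \<cdot>\<^sub>m X) (c \<cdot>\<^sub>m X) = c\<^sup>2 * frob_inner X X"
    by (simp add: frob_inner_def sum_distrib_left power2_eq_square algebra_simps)
  then show ?thesis by (simp add: frob_norm_def real_sqrt_mult)
qed

lemma frob_norm_minus_commute:
  assumes "X \<in> carrier_mat n m" "Y \<in> carrier_mat n m"
  shows "frob_norm (X - Y) = frob_norm (Y - X)"
proof -
  have "X - Y = (-1) \<cdot>\<^sub>m (Y - X)" using assms by (intro eq_matI) auto
  then show ?thesis by (simp add: frob_norm_smult)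
qed

lemma frob_norm_diff_triangle:
  assumes "X \<in> carrier_mat n m" "Y \<in> carrier_mat n m"
  shows "frob_norm (X - Y) \<le> frob_norm X + frob_norm Y"
proof -
  have "X - Y = X + (-1) \<cdot>\<^sub>m Y" using assms by (intro eq_matI) auto
  then have "frob_norm (X - Y) \<le> frob_norm X + frob_norm ((-1) \<cdot>\<^sub>m Y)"
    using assms by (simp add: frob_norm_triangle)
  then show ?thesis by (simp add: frob_norm_smult)
qed

lemma frob_norm_le_add_diff:
  assumes "X \<in> carrier_mat n m" "Y \<in> carrier_mat n m"
  shows "frob_norm X \<le> frob_norm Y + frob_norm (X - Y)"
proof -
  have "Y + (X - Y) = X" using assms by (intro eq_matI) auto
  then show ?thesis using frob_norm_triangle[of Y n m "X - Y"] assms by simp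
qed

lemma frob_Cauchy_Schwarz:
  assumes "X \<in> carrier_mat n m" "Y \<in> carrier_mat n m"
  shows "\<bar>frob_inner X Y\<bar> \<le> frob_norm X * frob_norm Y"
proof -
  have "\<bar>frob_inner X Y\<bar> = \<bar>\<Sum>p\<in>{..<n} \<times> {..<m}. X $$ p * Y $$ p\<bar>"
    by (simp add: frob_inner_carrier[OF assms(1)] sum.cartesian_product split_def)
  also have "\<dots> \<le> (\<Sum>p\<in>{..<n} \<times> {..<m}. \<bar>X $$ p\<bar> * \<bar>Y $$ p\<bar>)"
    by (rule order_trans[OF sum_abs]) (simp add: abs_mult)
  also have "\<dots> \<le> L2_set (\<lambda>p. X $$ p) ({..<n} \<times> {..<m}) * L2_set (\<lambda>p. Y $$ p) ({..<n} \<times> {..<m})"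
    by (rule L2_set_mult_ineq)
  finally show ?thesis
    using assms by (simp add: frob_norm_L2_set[where n=n and m=m])
qed

lemma frob_norm_eq_0D:
  assumes "X \<in> carrier_mat n m" "frob_norm X = 0"
  shows "X = 0\<^sub>m n m"
proof -
  have "\<forall>p\<in>{..<n} \<times> {..<m}. X $$ p = 0"
    using assms by (simp add: frob_norm_L2_set L2_set_eq_0_iff)
  then show ?thesis using assms(1) by (intro eq_matI) auto
qed

text \<open>
  Unlike the carrier-based associativity law, whose inner dimensions do not occur in the equation, this
  form has premises that rewriting can settle.
\<close>
lemma mult_assoc_dim:
  assumes "dim_col A = dim_row B" "dim_col B = dim_row C"
  shows "A * B * C = A * (B * (C :: 'a :: semiring_0 mat))"
  using assms by (intro assoc_mult_mat[of _ "dim_row A" "dim_row B" _ "dim_row C" _ "dim_col C"]) auto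

lemma transpose_mult_dim:
  assumes "dim_col A = dim_row B"
  shows "transpose_mat (A * B) = transpose_mat B * transpose_mat (A :: 'a :: comm_semiring_0 mat)"
  using assms by (intro transpose_mult[of _ "dim_row A" "dim_row B" _ "dim_col B"]) auto

lemma dim_mat_diag [simp]: "dim_row (mat_diag n f) = n" "dim_col (mat_diag n f) = n"
  by (simp_all add: mat_diag_def)

lemma transpose_mat_diag [simp]: "transpose_mat (mat_diag n f) = mat_diag n f"
  by (auto simp: mat_diag_def)

text \<open>
  Cancellation inside right-associated products, where \<open>P * Q\<close> is not a subterm.
\<close>
lemma left_inverse_cancel:
  fixes P :: "'a :: semiring_1 mat"
  assumes "P * Q = 1\<^sub>m m" "dim_col P = dim_row Q" "dim_col Q = m" "dim_row Y = m"
  shows "P * (Q * Y) = Y"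
proof -
  have "P * Q * Y = P * (Q * Y)" using assms(2-4) by (intro mult_assoc_dim) auto
  moreover have "P * Q * Y = Y"
    unfolding assms(1) using assms(4) by (intro left_mult_one_mat[of _ m "dim_col Y"]) auto
  ultimately show ?thesis by simp
qed

lemma sum_mult_Cauchy_Schwarz:
  fixes f g :: "'a \<Rightarrow> real"
  shows "(\<Sum>i\<in>I. f i * g i)\<^sup>2 \<le> (\<Sum>i\<in>I. (f i)\<^sup>2) * (\<Sum>i\<in>I. (g i)\<^sup>2)"
proof -
  have "\<bar>\<Sum>i\<in>I. f i * g i\<bar> \<le> (\<Sum>i\<in>I. \<bar>f i\<bar> * \<bar>g i\<bar>)"
    by (rule order_trans[OF sum_abs]) (simp add: abs_mult)
  also have "\<dots> \<le> L2_set f I * L2_set g I" by (rule L2_set_mult_ineq)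
  finally have "\<bar>\<Sum>i\<in>I. f i * g i\<bar>\<^sup>2 \<le> (L2_set f I * L2_set g I)\<^sup>2"
    by (intro power_mono) auto
  then show ?thesis by (simp add: L2_set_def power_mult_distrib sum_nonneg)
qed

lemma mat_mult_entry:
  assumes "A \<in> carrier_mat n m" "B \<in> carrier_mat m r" "i < n" "j < r"
  shows "(A * B) $$ (i, j) = (\<Sum>l<m. A $$ (i, l) * B $$ (l, j))"
  using assms by (auto simp: scalar_prod_def atLeast0LessThan)

lemma frob_inner_transpose:
  assumes "X \<in> carrier_mat n m" "Y \<in> carrier_mat n m"
  shows "frob_inner (transpose_mat X) (transpose_mat Y) = frob_inner X Y"
proof -
  have "frob_inner (transpose_mat X) (transpose_mat Y) = (\<Sum>j<m. \<Sum>i<n. X $$ (i, j) * Y $$ (i, j))"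
    using assms by (auto simp: frob_inner_def intro!: sum.cong)
  also have "\<dots> = (\<Sum>i<n. \<Sum>j<m. X $$ (i, j) * Y $$ (i, j))" by (rule sum.swap)
  finally show ?thesis using assms by (simp add: frob_inner_carrier)
qed

lemma frob_norm_transpose:
  assumes "X \<in> carrier_mat n m"
  shows "frob_norm (transpose_mat X) = frob_norm X"
  using assms by (simp add: frob_norm_def frob_inner_transpose)

lemma frob_inner_mult_left:
  assumes "A \<in> carrier_mat n m" "B \<in> carrier_mat m r" "C \<in> carrier_mat n r"
  shows "frob_inner (A * B) C = frob_inner B (transpose_mat A * C)"
proof -
  have "frob_inner (A * B) C = (\<Sum>i<n. \<Sum>j<r. \<Sum>l<m. A $$ (i, l) * B $$ (l, j) * C $$ (i, j))"
    using assms
    by (subst frob_inner_carrier[where n=n and m=r])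
       (auto simp: mat_mult_entry[OF assms(1,2)] sum_distrib_right simp del: index_mult_mat
          intro!: sum.cong)
  also have "\<dots> = (\<Sum>i<n. \<Sum>l<m. \<Sum>j<r. A $$ (i, l) * B $$ (l, j) * C $$ (i, j))"
    by (intro sum.cong refl sum.swap)
  also have "\<dots> = (\<Sum>l<m. \<Sum>i<n. \<Sum>j<r. A $$ (i, l) * B $$ (l, j) * C $$ (i, j))"
    by (rule sum.swap)
  also have "\<dots> = (\<Sum>l<m. \<Sum>j<r. \<Sum>i<n. A $$ (i, l) * B $$ (l, j) * C $$ (i, j))"
    by (intro sum.cong refl sum.swap)
  also have "\<dots> = frob_inner B (transpose_mat A * C)"
    using assms
    by (subst frob_inner_carrier[OF assms(2)])
       (auto simp: mat_mult_entry[of _ m n _ r] sum_distrib_left simp del: index_mult_mat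
          intro!: sum.cong)
  finally show ?thesis .
qed

lemma frob_inner_mult_right:
  assumes "A \<in> carrier_mat n m" "B \<in> carrier_mat m r" "C \<in> carrier_mat n r"
  shows "frob_inner (A * B) C = frob_inner A (C * transpose_mat B)"
proof -
  have "frob_inner (A * B) C = frob_inner (transpose_mat B * transpose_mat A) (transpose_mat C)"
    using assms frob_inner_transpose[of "A * B" n r C] by (simp add: transpose_mult[of A n m B r])
  also have "\<dots> = frob_inner (transpose_mat A) (B * transpose_mat C)"
    using assms frob_inner_mult_left[of "transpose_mat B" r m "transpose_mat A" n "transpose_mat C"]
    by simp
  also have "\<dots> = frob_inner A (C * transpose_mat B)"
    using assms frob_inner_transpose[of A n m "C * transpose_mat B"]
    by (simp add: transpose_mult[of C n r "transpose_mat B" m])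
  finally show ?thesis .
qed

lemma frob_norm_mult:
  assumes "A \<in> carrier_mat n m" "B \<in> carrier_mat m r"
  shows "frob_norm (A * B) \<le> frob_norm A * frob_norm B"
proof -
  have "frob_inner (A * B) (A * B) = (\<Sum>i<n. \<Sum>j<r. (\<Sum>l<m. A $$ (i, l) * B $$ (l, j))\<^sup>2)"
    using assms
    by (subst frob_inner_carrier[where n=n and m=r])
       (auto simp: mat_mult_entry[OF assms] power2_eq_square simp del: index_mult_mat
          intro!: sum.cong)
  also have "\<dots> \<le> (\<Sum>i<n. \<Sum>j<r. (\<Sum>l<m. (A $$ (i, l))\<^sup>2) * (\<Sum>l<m. (B $$ (l, j))\<^sup>2))"
    by (intro sum_mono sum_mult_Cauchy_Schwarz)
  also have "\<dots> = (\<Sum>i<n. \<Sum>l<m. (A $$ (i, l))\<^sup>2) * (\<Sum>j<r. \<Sum>l<m. (B $$ (l, j))\<^sup>2)"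
    by (simp add: sum_product)
  also have "(\<Sum>j<r. \<Sum>l<m. (B $$ (l, j))\<^sup>2) = (\<Sum>l<m. \<Sum>j<r. (B $$ (l, j))\<^sup>2)"
    by (rule sum.swap)
  finally have "(frob_norm (A * B))\<^sup>2 \<le> (frob_norm A * frob_norm B)\<^sup>2"
    unfolding power_mult_distrib frob_norm_sq frob_inner_carrier[OF assms(1)]
      frob_inner_carrier[OF assms(2)] by (simp add: power2_eq_square)
  then show ?thesis
    by (rule power2_le_imp_le) (simp add: frob_norm_nonneg)
qed

lemma frob_norm_orthonormal_mult:
  assumes "P \<in> carrier_mat n m" "transpose_mat P * P = 1\<^sub>m m" "B \<in> carrier_mat m r"
  shows "frob_norm (P * B) = frob_norm B"
proof -
  have "frob_inner (P * B) (P * B) = frob_inner B (transpose_mat P * (P * B))"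
    using assms by (intro frob_inner_mult_left) auto
  also have "transpose_mat P * (P * B) = B"
    using assms by (subst assoc_mult_mat[symmetric, of _ m n _ m _ r]) auto
  finally show ?thesis by (simp add: frob_norm_def)
qed

section \<open>Orthonormal extension\<close>

lemma scalar_prod_self_nonneg: "0 \<le> v \<bullet> (v :: real vec)"
  by (auto simp: scalar_prod_def intro!: sum_nonneg)

lemma scalar_prod_self_eq_0D:
  fixes v :: "real vec"
  assumes "v \<in> carrier_vec n" "v \<bullet> v = 0"
  shows "v = 0\<^sub>v n"
proof -
  have "\<forall>i<n. v $ i = 0" using assms by (auto simp: scalar_prod_def sum_nonneg_eq_0_iff)
  then show ?thesis using assms(1) by (intro eq_vecI) auto
qed

text \<open>
  Padding \<open>B\<close> with zero rows gives a singular square matrix.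
\<close>
lemma wide_mat_kernel:
  fixes B :: "real mat"
  assumes B: "B \<in> carrier_mat m n" and mn: "m < n"
  shows "\<exists>v\<in>carrier_vec n. v \<bullet> v = 1 \<and> B *\<^sub>v v = 0\<^sub>v m"
proof -
  \<comment> \<open>The last unit vector lies in the kernel of the transpose, because the last row is zero.\<close>
  define B' where "B' = mat n n (\<lambda>(i, j). if i < m then B $$ (i, j) else 0)"
  have B': "B' \<in> carrier_mat n n" by (simp add: B'_def)
  have "transpose_mat B' *\<^sub>v unit_vec n (n - 1) = 0\<^sub>v n"
    using mn by (intro eq_vecI) (auto simp: B'_def scalar_prod_def unit_vec_def intro!: sum.neutral)
  then have "det (transpose_mat B') = 0"
    using mn B' by (subst det_0_iff_vec_prod_zero_field[of _ n])
      (auto intro!: exI[of _ "unit_vec n (n - 1)"])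
  then have "det B' = 0" using det_transpose[OF B'] by simp
  then obtain v where v: "v \<in> carrier_vec n" "v \<noteq> 0\<^sub>v n" "B' *\<^sub>v v = 0\<^sub>v n"
    using det_0_iff_vec_prod_zero_field[OF B'] by auto
  have Bv: "B *\<^sub>v v = 0\<^sub>v m"
  proof (rule eq_vecI)
    fix i assume i: "i < dim_vec (0\<^sub>v m :: real vec)"
    then have "(B *\<^sub>v v) $ i = (B' *\<^sub>v v) $ i"
      using B v(1) mn by (auto simp: B'_def scalar_prod_def intro!: sum.cong)
    then show "(B *\<^sub>v v) $ i = (0\<^sub>v m :: real vec) $ i" using v i mn by simp
  qed (use B in simp)
  have "v \<bullet> v \<noteq> 0" using scalar_prod_self_eq_0D v by blast
  then have pos: "v \<bullet> v > 0" using scalar_prod_self_nonneg[of v] by simp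
  define u where "u = (1 / sqrt (v \<bullet> v)) \<cdot>\<^sub>v v"
  have "u \<bullet> u = 1"
    using v(1) pos by (simp add: u_def)
  moreover have "B *\<^sub>v u = 0\<^sub>v m"
    using B v(1) Bv by (auto simp: u_def mult_mat_vec[of _ m n] intro!: eq_vecI)
  moreover have "u \<in> carrier_vec n" using v(1) by (simp add: u_def)
  ultimately show ?thesis by blast
qed

lemma orthonormal_cols_iff:
  fixes P :: "real mat"
  assumes "P \<in> carrier_mat n m"
  shows "transpose_mat P * P = 1\<^sub>m m \<longleftrightarrow> (\<forall>i<m. \<forall>j<m. col P i \<bullet> col P j = (if i = j then 1 else 0))"
proof
  assume *: "transpose_mat P * P = 1\<^sub>m m"
  show "\<forall>i<m. \<forall>j<m. col P i \<bullet> col P j = (if i = j then 1 else 0)"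
  proof (intro allI impI)
    fix i j assume "i < m" "j < m"
    then have "col P i \<bullet> col P j = (transpose_mat P * P) $$ (i, j)" using assms by simp
    then show "col P i \<bullet> col P j = (if i = j then 1 else 0)" using \<open>i < m\<close> \<open>j < m\<close> by (simp add: *)
  qed
next
  assume "\<forall>i<m. \<forall>j<m. col P i \<bullet> col P j = (if i = j then 1 else 0)"
  then show "transpose_mat P * P = 1\<^sub>m m" using assms by (intro eq_matI) auto
qed

lemma orthonormal_cols_le:
  fixes P :: "real mat"
  assumes P: "P \<in> carrier_mat n m" "transpose_mat P * P = 1\<^sub>m m"
  shows "m \<le> n"
proof (rule ccontr)
  assume "\<not> m \<le> n"
  then obtain v where v: "v \<in> carrier_vec m" "v \<bullet> v = 1" "P *\<^sub>v v = 0\<^sub>v n"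
    using wide_mat_kernel[OF P(1)] by auto
  have "v = (transpose_mat P * P) *\<^sub>v v" using v P by simp
  also have "\<dots> = transpose_mat P *\<^sub>v (P *\<^sub>v v)"
    using v(1) P(1) by (intro assoc_mult_mat_vec) auto
  also have "\<dots> = 0\<^sub>v m" using P(1) v(3) by (intro eq_vecI) (auto simp: scalar_prod_def)
  finally show False using v(2) by simp
qed

text \<open>
  One column is added at a time. With \<open>R\<close> trivial this completes an orthonormal system to a basis;
  with \<open>R\<close> the property of being an eigenvector it is the spectral theorem.
\<close>
lemma orthonormal_extension:
  fixes P :: "real mat"
  assumes step: "\<And>m P. m < n \<Longrightarrow> P \<in> carrier_mat n m \<Longrightarrow> transpose_mat P * P = 1\<^sub>m m \<Longrightarrow>
      \<forall>j<m. R (col P j) \<Longrightarrow> \<exists>v\<in>carrier_vec n. v \<bullet> v = 1 \<and> transpose_mat P *\<^sub>v v = 0\<^sub>v m \<and> R v"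
    and P: "P \<in> carrier_mat n m" "transpose_mat P * P = 1\<^sub>m m" "\<forall>j<m. R (col P j)"
  shows "\<exists>Q\<in>carrier_mat n n. transpose_mat Q * Q = 1\<^sub>m n \<and> (\<forall>j<m. col Q j = col P j) \<and>
    (\<forall>j<n. R (col Q j))"
  using P
proof (induction "n - m" arbitrary: m P)
  case 0
  then have "m = n" using orthonormal_cols_le[OF 0(2,3)] by simp
  then show ?case using 0 by blast
next
  case (Suc l)
  then have mn: "m < n" by simp
  obtain v where v: "v \<in> carrier_vec n" "v \<bullet> v = 1" "transpose_mat P *\<^sub>v v = 0\<^sub>v m" "R v"
    using step[OF mn Suc.prems] by blast
  define P' where "P' = mat n (Suc m) (\<lambda>(i, j). if j < m then P $$ (i, j) else v $ i)"
  have P': "P' \<in> carrier_mat n (Suc m)" by (simp add: P'_def)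
  have colP': "col P' j = (if j < m then col P j else v)" if "j < Suc m" for j
    using that v(1) Suc.prems(1) by (intro eq_vecI) (auto simp: P'_def)
  have vP: "col P j \<bullet> v = 0" if "j < m" for j
  proof -
    have "col P j \<bullet> v = (transpose_mat P *\<^sub>v v) $ j" using that Suc.prems(1) by simp
    then show ?thesis using that v(3) by simp
  qed
  have Pv: "v \<bullet> col P j = 0" if "j < m" for j
    using vP[OF that] v(1) Suc.prems(1) that comm_scalar_prod[of v n "col P j"] by auto
  have orth: "transpose_mat P' * P' = 1\<^sub>m (Suc m)"
    unfolding orthonormal_cols_iff[OF P']
    using Suc.prems(2) v(2) vP Pv
    by (auto simp: colP' orthonormal_cols_iff[OF Suc.prems(1)])
  have R: "\<forall>j<Suc m. R (col P' j)" using Suc.prems(3) v(4) by (simp add: colP')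
  have l: "l = n - Suc m" using Suc.hyps(2) by simp
  from Suc.hyps(1)[OF l P' orth R] obtain Q where Q: "Q \<in> carrier_mat n n" "transpose_mat Q * Q = 1\<^sub>m n"
      "\<forall>j<Suc m. col Q j = col P' j" "\<forall>j<n. R (col Q j)"
    by blast
  then have "\<forall>j<m. col Q j = col P j" by (simp add: colP')
  then show ?case using Q by blast
qed

lemma orthonormal_completion:
  fixes P :: "real mat"
  assumes P: "P \<in> carrier_mat n m" "transpose_mat P * P = 1\<^sub>m m"
  shows "\<exists>Q\<in>carrier_mat n n. transpose_mat Q * Q = 1\<^sub>m n \<and> (\<forall>j<m. col Q j = col P j)"
proof -
  have "\<exists>v\<in>carrier_vec n. v \<bullet> v = 1 \<and> transpose_mat P *\<^sub>v v = 0\<^sub>v m \<and> True"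
    if "m < n" "P \<in> carrier_mat n m" for m and P :: "real mat"
    using wide_mat_kernel[of "transpose_mat P" m n] that by auto
  from orthonormal_extension[of n "\<lambda>_. True", OF this P] show ?thesis by auto
qed

text \<open>
  A complex eigenvector exists by the fundamental theorem of algebra. Symmetry of \<open>A\<close>, tested on its
  real part \<open>x\<close> and imaginary part \<open>y\<close>, makes the eigenvalue real, so that \<open>x\<close> and \<open>y\<close> are
  themselves eigenvectors or zero.
\<close>
lemma symmetric_real_eigenvector:
  fixes A :: "real mat"
  assumes A: "A \<in> carrier_mat n n" "transpose_mat A = A" and n: "0 < n"
  shows "\<exists>c. \<exists>v\<in>carrier_vec n. v \<noteq> 0\<^sub>v n \<and> A *\<^sub>v v = c \<cdot>\<^sub>v v"
proof -
  define B where "B = map_mat complex_of_real A"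
  have B: "B \<in> carrier_mat n n" using A by (simp add: B_def)
  have "degree (char_poly B) > 0" using degree_monic_char_poly[OF B] n by simp
  then have "\<not> constant (poly (char_poly B))" by (simp add: constant_degree)
  then obtain z where "poly (char_poly B) z = 0" using fundamental_theorem_of_algebra by blast
  then obtain w where w: "w \<in> carrier_vec n" "w \<noteq> 0\<^sub>v n" "B *\<^sub>v w = z \<cdot>\<^sub>v w"
    using B unfolding eigenvalue_root_char_poly[OF B, symmetric] eigenvalue_def eigenvector_def by auto
  define x where "x = vec n (\<lambda>i. Re (w $ i))"
  define y where "y = vec n (\<lambda>i. Im (w $ i))"
  have xc: "x \<in> carrier_vec n" and yc: "y \<in> carrier_vec n" by (auto simp: x_def y_def)
  have Bw: "(\<Sum>j<n. complex_of_real (A $$ (i, j)) * w $ j) = z * w $ i" if "i < n" for i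
  proof -
    have "(B *\<^sub>v w) $ i = (\<Sum>j<n. complex_of_real (A $$ (i, j)) * w $ j)"
      using that A w(1) by (auto simp: B_def scalar_prod_def atLeast0LessThan intro!: sum.cong)
    then show ?thesis using w that by simp
  qed
  have Ax: "A *\<^sub>v x = Re z \<cdot>\<^sub>v x - Im z \<cdot>\<^sub>v y"
  proof (rule eq_vecI)
    fix i assume i: "i < dim_vec (Re z \<cdot>\<^sub>v x - Im z \<cdot>\<^sub>v y)"
    then have i: "i < n" by (simp add: x_def y_def)
    have "(A *\<^sub>v x) $ i = Re (\<Sum>j<n. complex_of_real (A $$ (i, j)) * w $ j)"
      using i A by (auto simp: x_def scalar_prod_def atLeast0LessThan intro!: sum.cong)
    then show "(A *\<^sub>v x) $ i = (Re z \<cdot>\<^sub>v x - Im z \<cdot>\<^sub>v y) $ i"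
      using i by (simp add: Bw x_def y_def)
  qed (use A in \<open>auto simp: y_def\<close>)
  have Ay: "A *\<^sub>v y = Im z \<cdot>\<^sub>v x + Re z \<cdot>\<^sub>v y"
  proof (rule eq_vecI)
    fix i assume i: "i < dim_vec (Im z \<cdot>\<^sub>v x + Re z \<cdot>\<^sub>v y)"
    then have i: "i < n" by (simp add: x_def y_def)
    have "(A *\<^sub>v y) $ i = Im (\<Sum>j<n. complex_of_real (A $$ (i, j)) * w $ j)"
      using i A by (auto simp: y_def scalar_prod_def atLeast0LessThan intro!: sum.cong)
    then show "(A *\<^sub>v y) $ i = (Im z \<cdot>\<^sub>v x + Re z \<cdot>\<^sub>v y) $ i"
      using i by (simp add: Bw x_def y_def)
  qed (use A in \<open>auto simp: y_def\<close>)
  have "(A *\<^sub>v y) \<bullet> x = y \<bullet> (A *\<^sub>v x)"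
    using transpose_vec_mult_scalar[OF A(1) xc yc] A(2) by simp
  then have "Im z * (x \<bullet> x) + Re z * (y \<bullet> x) = Re z * (y \<bullet> x) - Im z * (y \<bullet> y)"
    using xc yc unfolding Ax Ay
    by (simp add: add_scalar_prod_distrib[of _ n] scalar_prod_minus_distrib[of _ n])
  then have imz: "Im z * (x \<bullet> x + y \<bullet> y) = 0" by (simp add: algebra_simps)
  have ne: "x \<noteq> 0\<^sub>v n \<or> y \<noteq> 0\<^sub>v n"
  proof (rule ccontr)
    assume "\<not> ?thesis"
    then have "\<forall>i<n. x $ i = 0 \<and> y $ i = 0" by simp
    then have "w = 0\<^sub>v n" using w(1)
      by (intro eq_vecI) (auto simp: x_def y_def complex_eq_iff)
    then show False using w(2) by simp
  qed
  have "x \<bullet> x + y \<bullet> y \<noteq> 0" 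
    using scalar_prod_self_nonneg[of x] scalar_prod_self_nonneg[of y]
      scalar_prod_self_eq_0D[OF xc] scalar_prod_self_eq_0D[OF yc] ne by argo
  then have "Im z = 0" using imz by simp
  then have "A *\<^sub>v x = Re z \<cdot>\<^sub>v x" "A *\<^sub>v y = Re z \<cdot>\<^sub>v y"
    using xc yc by (auto simp: Ax Ay intro!: eq_vecI)
  then show ?thesis using ne xc yc by blast
qed

section \<open>The spectral theorem and singular values\<close>

lemma orthogonal_transpose:
  fixes Q :: "real mat"
  assumes "Q \<in> carrier_mat n n" "transpose_mat Q * Q = 1\<^sub>m n"
  shows "Q * transpose_mat Q = 1\<^sub>m n"
  using mat_mult_left_right_inverse[of "transpose_mat Q" n Q] assms by simp

text \<open>
  The compression of \<open>A\<close> to the orthogonal complement of the given eigenvectors is again symmetric, and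
  its eigenvectors are eigenvectors of \<open>A\<close>. Prescribing the first eigenvectors matters below: an
  eigenbasis of the dual slack matrix has to start with a basis of the range of the primal solution.
\<close>
lemma eigenbasis_extension:
  fixes A P :: "real mat"
  assumes A: "A \<in> carrier_mat n n" "transpose_mat A = A"
    and P: "P \<in> carrier_mat n m" "transpose_mat P * P = 1\<^sub>m m"
      "\<forall>j<m. \<exists>c. A *\<^sub>v col P j = c \<cdot>\<^sub>v col P j"
  shows "\<exists>Q\<in>carrier_mat n n. transpose_mat Q * Q = 1\<^sub>m n \<and> (\<forall>j<m. col Q j = col P j) \<and>
    (\<forall>j<n. \<exists>c. A *\<^sub>v col Q j = c \<cdot>\<^sub>v col Q j)"
proof (rule orthonormal_extension[where R = "\<lambda>v. \<exists>c. A *\<^sub>v v = c \<cdot>\<^sub>v v", OF _ P])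
  fix m and P :: "real mat"
  assume mn: "m < n" and P: "P \<in> carrier_mat n m" "transpose_mat P * P = 1\<^sub>m m"
    and ev: "\<forall>j<m. \<exists>c. A *\<^sub>v col P j = c \<cdot>\<^sub>v col P j"
  obtain Q where Q: "Q \<in> carrier_mat n n" "transpose_mat Q * Q = 1\<^sub>m n"
    and QP: "\<forall>j<m. col Q j = col P j" using orthonormal_completion[OF P] by blast
  define P2 where "P2 = mat n (n - m) (\<lambda>(i, j). Q $$ (i, m + j))"
  have P2: "P2 \<in> carrier_mat n (n - m)" by (simp add: P2_def)
  have colP2: "col P2 j = col Q (m + j)" if "j < n - m" for j
    using that Q(1) by (intro eq_vecI) (auto simp: P2_def)
  have Qij: "col Q i \<bullet> col Q j = (if i = j then 1 else 0)" if "i < n" "j < n" for i j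
    using Q(2) that unfolding orthonormal_cols_iff[OF Q(1)] by blast
  have P2orth: "transpose_mat P2 * P2 = 1\<^sub>m (n - m)"
    unfolding orthonormal_cols_iff[OF P2] by (auto simp: colP2 Qij)
  define B where "B = transpose_mat P2 * (A * P2)"
  have B: "B \<in> carrier_mat (n - m) (n - m)" using P2 A by (simp add: B_def)
  have "transpose_mat B = transpose_mat (A * P2) * P2"
    using P2 A by (simp add: B_def transpose_mult[of _ "n - m" n _ "n - m"])
  also have "\<dots> = transpose_mat P2 * A * P2"
    using P2 A by (simp add: transpose_mult[of _ n n _ "n - m"])
  also have "\<dots> = B" using P2 A by (simp add: B_def assoc_mult_mat[of _ "n - m" n _ n _ "n - m"])
  finally obtain c w where w: "w \<in> carrier_vec (n - m)" "w \<noteq> 0\<^sub>v (n - m)" "B *\<^sub>v w = c \<cdot>\<^sub>v w"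
    using symmetric_real_eigenvector[OF B] mn by auto
  have ww: "w \<bullet> w > 0"
    using scalar_prod_self_eq_0D[OF w(1)] scalar_prod_self_nonneg[of w] w(2) by (cases "w \<bullet> w = 0") auto
  define u where "u = (1 / sqrt (w \<bullet> w)) \<cdot>\<^sub>v w"
  have u: "u \<in> carrier_vec (n - m)" "u \<bullet> u = 1" "B *\<^sub>v u = c \<cdot>\<^sub>v u"
  proof -
    show "u \<in> carrier_vec (n - m)" using w(1) by (simp add: u_def)
    show "u \<bullet> u = 1" using w(1) ww by (simp add: u_def)
    have "B *\<^sub>v u = (1 / sqrt (w \<bullet> w)) \<cdot>\<^sub>v (c \<cdot>\<^sub>v w)"
      using mult_mat_vec[OF B w(1)] by (simp add: u_def w(3))
    then show "B *\<^sub>v u = c \<cdot>\<^sub>v u" by (simp add: u_def smult_smult_assoc mult.commute)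
  qed
  define v where "v = P2 *\<^sub>v u"
  have v: "v \<in> carrier_vec n" using P2 u(1) by (simp add: v_def)
  have P2v: "transpose_mat P2 *\<^sub>v v = u"
    using P2 u(1) P2orth by (simp add: v_def assoc_mult_mat_vec[symmetric, of _ "n - m" n _ "n - m"])
  have vv: "v \<bullet> v = 1"
  proof -
    have "v \<bullet> v = (transpose_mat P2 *\<^sub>v v) \<bullet> u"
      using transpose_vec_mult_scalar[OF P2 u(1) v] v by (simp add: v_def)
    then show ?thesis by (simp add: P2v u)
  qed
  have Qv: "col Q j \<bullet> v = (if j < m then 0 else u $ (j - m))" if j: "j < n" for j
  proof (cases "j < m")
    case True
    have "col Q j \<bullet> v = (transpose_mat P2 *\<^sub>v col Q j) \<bullet> u"
      using transpose_vec_mult_scalar[OF P2 u(1), of "col Q j"] Q(1) j by (simp add: v_def)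
    also have "transpose_mat P2 *\<^sub>v col Q j = 0\<^sub>v (n - m)"
      using P2 True j by (intro eq_vecI) (auto simp: colP2 Qij)
    finally show ?thesis using True u(1) by simp
  next
    case False
    then have "col Q j \<bullet> v = (transpose_mat P2 *\<^sub>v v) $ (j - m)"
      using P2 j colP2[of "j - m"] by simp
    then show ?thesis using False by (simp add: P2v)
  qed
  have AQ: "(A *\<^sub>v v) \<bullet> x = v \<bullet> (A *\<^sub>v x)" if "x \<in> carrier_vec n" for x
    using transpose_vec_mult_scalar[OF A(1) that v] A(2) by simp
  have QAv: "col Q j \<bullet> (A *\<^sub>v v) = c * (col Q j \<bullet> v)" if j: "j < n" for j
  proof (cases "j < m")
    case True
    then obtain e where e: "A *\<^sub>v col Q j = e \<cdot>\<^sub>v col Q j" using ev QP by auto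
    have "col Q j \<bullet> (A *\<^sub>v v) = v \<bullet> (A *\<^sub>v col Q j)"
      using AQ[of "col Q j"] Q(1) j A(1) v comm_scalar_prod[of "A *\<^sub>v v" n "col Q j"] by auto
    also have "\<dots> = e * (v \<bullet> col Q j)" using e Q(1) v j by simp
    also have "v \<bullet> col Q j = 0"
      using Qv[OF j] True comm_scalar_prod[of v n "col Q j"] Q(1) v j by auto
    finally show ?thesis using Qv[OF j] True by simp
  next
    case False
    have "col Q j \<bullet> (A *\<^sub>v v) = (transpose_mat P2 *\<^sub>v (A *\<^sub>v (P2 *\<^sub>v u))) $ (j - m)"
      using P2 j False colP2[of "j - m"] by (simp add: v_def)
    also have "transpose_mat P2 *\<^sub>v (A *\<^sub>v (P2 *\<^sub>v u)) = B *\<^sub>v u"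
      using P2 A u(1)
      by (simp add: B_def assoc_mult_mat_vec[of _ "n - m" n _ "n - m"] assoc_mult_mat_vec[of _ n n _ "n - m"])
    finally show ?thesis using u Qv[OF j] False j by simp
  qed
  have "transpose_mat Q *\<^sub>v (A *\<^sub>v v) = c \<cdot>\<^sub>v (transpose_mat Q *\<^sub>v v)"
    using Q(1) QAv by (intro eq_vecI) auto
  then have "Q *\<^sub>v (transpose_mat Q *\<^sub>v (A *\<^sub>v v)) = c \<cdot>\<^sub>v (Q *\<^sub>v (transpose_mat Q *\<^sub>v v))"
    using Q(1) v by (simp add: mult_mat_vec[of _ n n])
  moreover have "Q *\<^sub>v (transpose_mat Q *\<^sub>v x) = x" if "x \<in> carrier_vec n" for x
    using assoc_mult_mat_vec[of Q n n "transpose_mat Q" n x] Q(1) that orthogonal_transpose[OF Q] by simp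
  ultimately have "A *\<^sub>v v = c \<cdot>\<^sub>v v" using v A(1) by simp
  moreover have "transpose_mat P *\<^sub>v v = 0\<^sub>v m"
  proof (rule eq_vecI)
    fix j assume "j < dim_vec (0\<^sub>v m :: real vec)"
    then have j: "j < m" by simp
    then have "(transpose_mat P *\<^sub>v v) $ j = col Q j \<bullet> v" using P QP by simp
    then show "(transpose_mat P *\<^sub>v v) $ j = (0\<^sub>v m :: real vec) $ j" using Qv[of j] j mn by simp
  qed (use P in simp)
  ultimately show "\<exists>v\<in>carrier_vec n. v \<bullet> v = 1 \<and> transpose_mat P *\<^sub>v v = 0\<^sub>v m \<and>
      (\<exists>c. A *\<^sub>v v = c \<cdot>\<^sub>v v)"
    by (intro bexI[OF _ v] conjI exI[of _ c] vv)
qed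

lemma eigenbasis_diagonalizes:
  fixes A Q :: "real mat"
  assumes A: "A \<in> carrier_mat n n" and Q: "Q \<in> carrier_mat n n" "transpose_mat Q * Q = 1\<^sub>m n"
    and ev: "\<forall>j<n. A *\<^sub>v col Q j = d j \<cdot>\<^sub>v col Q j"
  shows "A = Q * mat_diag n d * transpose_mat Q"
proof -
  have "A * Q = Q * mat_diag n d"
  proof (rule eq_matI)
    fix i j assume "i < dim_row (Q * mat_diag n d)" "j < dim_col (Q * mat_diag n d)"
    then have ij: "i < n" "j < n" using Q by (auto simp: mat_diag_def)
    have "(A * Q) $$ (i, j) = (A *\<^sub>v col Q j) $ i" using A Q ij by simp
    then show "(A * Q) $$ (i, j) = (Q * mat_diag n d) $$ (i, j)"
      using ev ij Q by (simp add: mat_diag_mult_right[OF Q(1)])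
  qed (use A Q in \<open>auto simp: mat_diag_def\<close>)
  then have "A * Q * transpose_mat Q = Q * mat_diag n d * transpose_mat Q" by simp
  then show ?thesis
    using A Q by (simp add: assoc_mult_mat[of _ n n _ n _ n] orthogonal_transpose)
qed

lemma spectral_theorem_real_symmetric:
  fixes A :: "real mat"
  assumes A: "A \<in> carrier_mat n n" "transpose_mat A = A"
  obtains Q d where "Q \<in> carrier_mat n n" "transpose_mat Q * Q = 1\<^sub>m n"
    "A = Q * mat_diag n d * transpose_mat Q" "\<forall>j<n. A *\<^sub>v col Q j = d j \<cdot>\<^sub>v col Q j"
proof -
  have "0\<^sub>m n 0 \<in> carrier_mat n 0" "transpose_mat (0\<^sub>m n 0) * 0\<^sub>m n 0 = (1\<^sub>m 0 :: real mat)"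
    by auto
  from eigenbasis_extension[OF A this] obtain Q where Q: "Q \<in> carrier_mat n n"
    "transpose_mat Q * Q = 1\<^sub>m n" "\<forall>j<n. \<exists>c. A *\<^sub>v col Q j = c \<cdot>\<^sub>v col Q j" by auto
  then obtain d where d: "\<forall>j<n. A *\<^sub>v col Q j = d j \<cdot>\<^sub>v col Q j" by metis
  show thesis using that[OF Q(1,2) eigenbasis_diagonalizes[OF A(1) Q(1,2) d] d] .
qed

text \<open>
  A similarity transformation makes the characteristic polynomial split into real linear factors, so the
  sorted list of roots has full length \<open>n\<close> and its entries can be addressed by position.
\<close>
lemma singular_values_of_gram:
  assumes Q: "Q \<in> carrier_mat n n" "transpose_mat Q * Q = 1\<^sub>m n"
    and M: "transpose_mat M * M = Q * mat_diag n d * transpose_mat Q"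
  shows "singular_values M = map sqrt (sort (map d [0..<n]))"
proof -
  have D: "mat_diag n d \<in> carrier_mat n n" by (simp add: mat_diag_def)
  have "similar_mat (transpose_mat M * M) (mat_diag n d)"
    using Q D M orthogonal_transpose[OF Q] by (intro similar_matI[of _ _ Q "transpose_mat Q" n]) auto
  then have "char_poly (transpose_mat M * M) = char_poly (mat_diag n d)" by (rule char_poly_similar)
  also have "\<dots> = (\<Prod>a\<leftarrow>diag_mat (mat_diag n d). [:- a, 1:])"
    by (rule char_poly_upper_triangular[OF D]) (auto simp: mat_diag_def)
  also have "diag_mat (mat_diag n d) = map d [0..<n]"
    by (auto simp: diag_mat_def mat_diag_def intro!: nth_equalityI)
  finally have "proots (char_poly (transpose_mat M * M))
      = sum_list (map proots (map (\<lambda>a. [:- a, 1:]) (map d [0..<n])))"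
    by (subst proots_prod_list[symmetric]) (auto simp: o_def)
  also have "\<dots> = sum_list (map (\<lambda>a. {#a#}) (map d [0..<n]))" by (simp add: o_def)
  also have "\<dots> = mset (map d [0..<n])" by (induction n) (auto)
  finally show ?thesis
    unfolding singular_values_def by (simp add: sorted_list_of_multiset_mset del: mset_map)
qed

text \<open>
  There are at least \<open>s + 1\<close> entries not above \<open>xs ! j\<close>: the first \<open>s\<close> ones and \<open>xs ! j\<close> itself.
\<close>
lemma sort_nth_le:
  fixes xs :: "real list"
  assumes j: "j < length xs" "s \<le> j" and small: "\<forall>i<s. xs ! i \<le> xs ! j"
  shows "sort xs ! s \<le> xs ! j"
proof (rule ccontr)
  assume *: "\<not> sort xs ! s \<le> xs ! j"
  let ?P = "\<lambda>x. x \<le> xs ! j"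
  have "length (filter ?P (sort xs)) = card {i. i < length xs \<and> ?P (sort xs ! i)}"
    by (simp add: length_filter_conv_card)
  also have "{i. i < length xs \<and> ?P (sort xs ! i)} \<subseteq> {..<s}"
  proof
    fix i assume i: "i \<in> {i. i < length xs \<and> ?P (sort xs ! i)}"
    show "i \<in> {..<s}"
    proof (rule ccontr)
      assume "i \<notin> {..<s}"
      then have "sort xs ! s \<le> sort xs ! i" using i by (intro sorted_nth_mono) auto
      then show False using i * by simp
    qed
  qed
  then have "card {i. i < length xs \<and> ?P (sort xs ! i)} \<le> s"
    using card_mono[of "{..<s}"] by simp
  finally have 1: "length (filter ?P (sort xs)) \<le> s" .
  have "length (filter ?P (sort xs)) = length (filter ?P xs)"
    by (metis mset_filter mset_sort size_mset)
  also have "\<dots> = card {i. i < length xs \<and> ?P (xs ! i)}"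
    by (simp add: length_filter_conv_card)
  finally have 2: "card {i. i < length xs \<and> ?P (xs ! i)} \<le> s" using 1 by simp
  have "insert j {..<s} \<subseteq> {i. i < length xs \<and> ?P (xs ! i)}"
  proof
    fix i assume "i \<in> insert j {..<s}"
    then consider "i = j" | "i < s" by blast
    then show "i \<in> {i. i < length xs \<and> ?P (xs ! i)}"
      by cases (use j small in simp_all)
  qed
  then have "card (insert j {..<s}) \<le> card {i. i < length xs \<and> ?P (xs ! i)}"
    by (intro card_mono) auto
  then show False using 2 j by simp
qed

text \<open>
  The quadratic form of \<open>A\<close> on the columns of \<open>U\<close>, summed up and expressed in coordinates of the
  eigenbasis.
\<close>
lemma quadratic_form_eigenbasis:
  assumes Q: "Q \<in> carrier_mat n n" and A: "A = Q * mat_diag n d * transpose_mat Q"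
    and U: "U \<in> carrier_mat n r"
  shows "frob_inner (A * U) U = (\<Sum>j<n. d j * (\<Sum>l<r. ((transpose_mat Q * U) $$ (j, l))\<^sup>2))"
proof -
  let ?F = "transpose_mat Q * U"
  have D: "mat_diag n d \<in> carrier_mat n n" by (simp add: mat_diag_def)
  have F: "?F \<in> carrier_mat n r" using Q U by simp
  have "A * U = (Q * mat_diag n d) * ?F"
    unfolding A by (rule assoc_mult_mat[of _ n n]) (use Q U in auto)
  also have "\<dots> = Q * (mat_diag n d * ?F)"
    by (rule assoc_mult_mat[OF Q D F])
  finally have "A * U = Q * (mat_diag n d * ?F)" .
  then have "frob_inner (A * U) U = frob_inner (mat_diag n d * ?F) ?F"
    using frob_inner_mult_left[OF Q _ U, of "mat_diag n d * ?F"] mult_carrier_mat[OF D F] by simp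
  also have "\<dots> = (\<Sum>j<n. d j * (\<Sum>l<r. (?F $$ (j, l))\<^sup>2))"
    using F D
    by (subst frob_inner_carrier[where n=n and m=r])
      (auto simp: mat_diag_mult_left[OF F] power2_eq_square sum_distrib_left mult.assoc simp del: index_mult_mat)
  finally show ?thesis .
qed

section \<open>Positive semidefinite matrices\<close>

lemma sym_matsD:
  assumes "X \<in> sym_mats n"
  shows "X \<in> carrier_mat n n" "transpose_mat X = X"
  using assms by (auto simp: sym_mats_def)

lemma psdD:
  assumes "psd n X"
  shows "X \<in> carrier_mat n n" "transpose_mat X = X"
  using assms by (auto simp: psd_def sym_mats_def)

lemma psd_gram:
  assumes "B \<in> carrier_mat n m"
  shows "psd n (B * transpose_mat B)"
  unfolding psd_def sym_mats_def
proof (intro conjI ballI CollectI)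
  show "transpose_mat (B * transpose_mat B) = B * transpose_mat B"
    using assms by (simp add: transpose_mult[of B n m _ n])
  fix v :: "real vec" assume v: "v \<in> carrier_vec n"
  have "v \<bullet> ((B * transpose_mat B) *\<^sub>v v) = v \<bullet> (B *\<^sub>v (transpose_mat B *\<^sub>v v))"
    using assms v by (simp add: assoc_mult_mat_vec[of _ n m _ n])
  also have "\<dots> = (transpose_mat B *\<^sub>v v) \<bullet> (transpose_mat B *\<^sub>v v)"
    using transpose_vec_mult_scalar[of B n m "transpose_mat B *\<^sub>v v" v] assms v by simp
  finally show "0 \<le> v \<bullet> ((B * transpose_mat B) *\<^sub>v v)" using scalar_prod_self_nonneg by simp
qed (use assms in auto)

lemma psd_eigenvalue_nonneg:
  assumes "psd n X" "v \<in> carrier_vec n" "v \<bullet> v = 1" "X *\<^sub>v v = c \<cdot>\<^sub>v v"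
  shows "0 \<le> c"
proof -
  have "0 \<le> v \<bullet> (X *\<^sub>v v)" using assms by (auto simp: psd_def)
  then show ?thesis using assms by simp
qed

lemma conjugated_diag_mult:
  fixes Q :: "real mat"
  assumes Q: "Q \<in> carrier_mat n n" "transpose_mat Q * Q = 1\<^sub>m n"
  shows "Q * mat_diag n f * transpose_mat Q * (Q * mat_diag n g * transpose_mat Q)
    = Q * mat_diag n (\<lambda>j. f j * g j) * transpose_mat Q"
proof -
  have "mat_diag n f * (mat_diag n g * transpose_mat Q) = mat_diag n (\<lambda>j. f j * g j) * transpose_mat Q"
    using assoc_mult_mat[of "mat_diag n f" n n "mat_diag n g" n "transpose_mat Q" n] Q by simp
  then show ?thesis
    using Q(1) by (simp add: mult_assoc_dim left_inverse_cancel[OF Q(2)] del: mat_diag_diag assoc_mult_mat)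
qed

lemma mult_diag_gram:
  fixes Q :: "real mat"
  assumes Q: "Q \<in> carrier_mat n n"
  shows "Q * mat_diag n f * transpose_mat (Q * mat_diag n f)
    = Q * mat_diag n (\<lambda>j. f j * f j) * transpose_mat Q"
proof -
  have "mat_diag n f * (mat_diag n f * transpose_mat Q) = mat_diag n (\<lambda>j. f j * f j) * transpose_mat Q"
    using assoc_mult_mat[of "mat_diag n f" n n "mat_diag n f" n "transpose_mat Q" n] Q by simp
  then show ?thesis
    using Q(1) by (simp add: mult_assoc_dim transpose_mult_dim del: mat_diag_diag assoc_mult_mat)
qed

text \<open>
  Take square roots of the eigenvalues. That the result is positive semidefinite is seen by taking square
  roots once more, which exhibits it as a Gram matrix.
\<close>
lemma psd_sqrt:
  assumes "psd n X"
  obtains T where "psd n T" "T * T = X"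
proof -
  obtain Q d where Q: "Q \<in> carrier_mat n n" "transpose_mat Q * Q = 1\<^sub>m n"
    and X: "X = Q * mat_diag n d * transpose_mat Q"
    and ev: "\<forall>j<n. X *\<^sub>v col Q j = d j \<cdot>\<^sub>v col Q j"
    by (rule spectral_theorem_real_symmetric[OF psdD[OF assms]])
  have d: "0 \<le> d j" if "j < n" for j
  proof (rule psd_eigenvalue_nonneg[OF assms])
    show "col Q j \<bullet> col Q j = 1" using orthonormal_cols_iff[OF Q(1)] Q(2) that by simp
  qed (use ev that Q in auto)
  define T where "T = Q * mat_diag n (\<lambda>j. sqrt (d j)) * transpose_mat Q"
  have "T = Q * mat_diag n (\<lambda>j. sqrt (sqrt (d j))) * transpose_mat (Q * mat_diag n (\<lambda>j. sqrt (sqrt (d j))))"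
    using d unfolding T_def by (subst mult_diag_gram[OF Q(1)]) (auto intro!: arg_cong2[where f = times] simp: mat_diag_def)
  moreover have "Q * mat_diag n (\<lambda>j. sqrt (sqrt (d j))) \<in> carrier_mat n n" using Q by simp
  ultimately have "psd n T" using psd_gram by metis
  moreover have "T * T = X"
    using d unfolding T_def conjugated_diag_mult[OF Q] X
    by (auto intro!: arg_cong2[where f = times] simp: mat_diag_def)
  ultimately show thesis using that by blast
qed

lemma psd_factor:
  assumes "psd n X"
  obtains B where "B \<in> carrier_mat n n" "X = B * transpose_mat B"
  using psd_sqrt[OF assms] psdD by metis

lemma psd_factor_quadratic_form:
  assumes "B \<in> carrier_mat n n" "N \<in> carrier_mat n r"
  shows "frob_inner (B * transpose_mat B * N) N = (frob_norm (transpose_mat B * N))\<^sup>2"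
proof -
  have "B * transpose_mat B * N = B * (transpose_mat B * N)"
    by (rule assoc_mult_mat[of _ n n _ n]) (use assms in auto)
  then show ?thesis
    using assms by (simp add: frob_norm_sq frob_inner_mult_left[of B n n _ r])
qed

lemma psd_quadratic_form_nonneg:
  assumes "psd n T" "N \<in> carrier_mat n r"
  shows "0 \<le> frob_inner (T * N) N"
  using psd_factor[OF assms(1)] psd_factor_quadratic_form[OF _ assms(2)] by (metis zero_le_power2)

text \<open>
  With \<open>T = B B\<^sup>T\<close>, the quadratic form is \<open>\<parallel>B\<^sup>T N\<parallel>\<^sup>2\<close>.
\<close>
lemma psd_quadratic_form_eq_0D:
  assumes "psd n T" "N \<in> carrier_mat n r" "frob_inner (T * N) N = 0"
  shows "T * N = 0\<^sub>m n r"
proof -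
  obtain B where B: "B \<in> carrier_mat n n" "T = B * transpose_mat B" by (rule psd_factor[OF assms(1)])
  have "transpose_mat B * N = 0\<^sub>m n r"
    using psd_factor_quadratic_form[OF B(1) assms(2)] assms(2,3) B
    by (intro frob_norm_eq_0D) auto
  moreover have "T * N = B * (transpose_mat B * N)"
    unfolding B(2) by (rule assoc_mult_mat[of _ n n _ n]) (use assms B in auto)
  ultimately show ?thesis using B(1) by simp
qed

lemma frob_inner_gram:
  assumes "Z \<in> carrier_mat n n" "U \<in> carrier_mat n r"
  shows "frob_inner Z (U * transpose_mat U) = frob_inner (Z * U) U"
  using frob_inner_mult_right[of Z n n U r U] assms by simp

section \<open>Bounds from singular values\<close>

text \<open>
  Vectors are treated as one-column matrices, so that the estimates for matrices apply to them.
\<close>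
lemma frob_norm_mat_of_cols_single:
  assumes "g \<in> carrier_vec k"
  shows "frob_norm (mat_of_cols k [g]) = norm2 g"
  using assms by (simp add: frob_norm_def norm2_def frob_inner_def scalar_prod_def atLeast0LessThan
      mat_of_cols_index)

lemma mult_mat_of_cols_single:
  assumes "M \<in> carrier_mat m k" "g \<in> carrier_vec k"
  shows "M * mat_of_cols k [g] = mat_of_cols m [M *\<^sub>v g]"
  using assms by (intro eq_matI) (auto simp: mat_of_cols_index)

lemma quadratic_form_ge:
  assumes Q: "Q \<in> carrier_mat n n" "transpose_mat Q * Q = 1\<^sub>m n"
    and A: "A = Q * mat_diag n d * transpose_mat Q"
    and U: "U \<in> carrier_mat n r" and d: "\<forall>j<n. c \<le> d j"
  shows "c * (frob_norm U)\<^sup>2 \<le> frob_inner (A * U) U"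
proof -
  have "frob_norm U = frob_norm (transpose_mat Q * U)"
    using frob_norm_orthonormal_mult[of "transpose_mat Q" n n U r] Q orthogonal_transpose[OF Q] U by simp
  then have "c * (frob_norm U)\<^sup>2 = (\<Sum>j<n. c * (\<Sum>l<r. ((transpose_mat Q * U) $$ (j, l))\<^sup>2))"
    using frob_norm_sq_sum[of "transpose_mat Q * U" n r] Q(1) U by (simp add: sum_distrib_left)
  also have "\<dots> \<le> frob_inner (A * U) U"
    unfolding quadratic_form_eigenbasis[OF Q(1) A U]
    using d by (intro sum_mono mult_right_mono) (auto intro!: sum_nonneg)
  finally show ?thesis .
qed

text \<open>
  For a matrix with \<open>k\<close> columns the \<open>k\<close>-th largest singular value is the smallest one.
\<close>
lemma kth_largest_sv_lower_bound:
  assumes M: "M \<in> carrier_mat m k" and k: "0 < k"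
    and sv: "\<gamma> \<le> kth_largest_sv k M" "0 \<le> \<gamma>" and G: "G \<in> carrier_mat k r"
  shows "\<gamma> * frob_norm G \<le> frob_norm (M * G)"
proof -
  have MM: "transpose_mat M * M \<in> carrier_mat k k" "transpose_mat (transpose_mat M * M) = transpose_mat M * M"
    using M by (auto simp: transpose_mult_dim)
  obtain Q d where Q: "Q \<in> carrier_mat k k" "transpose_mat Q * Q = 1\<^sub>m k"
    and D: "transpose_mat M * M = Q * mat_diag k d * transpose_mat Q"
    by (rule spectral_theorem_real_symmetric[OF MM])
  have sq: "frob_inner (transpose_mat M * M * N) N = (frob_norm (M * N))\<^sup>2"
    if "N \<in> carrier_mat k l" for N l
  proof -
    have "(frob_norm (M * N))\<^sup>2 = frob_inner N (transpose_mat M * (M * N))"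
      unfolding frob_norm_sq by (rule frob_inner_mult_left[OF M that]) (use M that in simp)
    also have "\<dots> = frob_inner N (transpose_mat M * M * N)"
      using M that by (simp add: mult_assoc_dim del: assoc_mult_mat)
    also have "\<dots> = frob_inner (transpose_mat M * M * N) N"
      by (rule frob_inner_commute[of _ k l]) (use M that in auto)
    finally show ?thesis by simp
  qed
  have "\<gamma>\<^sup>2 \<le> d j" if j: "j < k" for j
  proof -
    have "\<gamma> \<le> sqrt (sort (map d [0..<k]) ! 0)"
      using sv(1) k by (simp add: kth_largest_sv_def singular_values_of_gram[OF Q D] rev_nth)
    also have "\<dots> \<le> sqrt (map d [0..<k] ! j)"
      using j by (intro real_sqrt_le_mono sort_nth_le) auto
    finally have "\<gamma> \<le> sqrt (d j)" using j by simp
    then have "0 \<le> d j" using sv(2) using order_trans[OF sv(2)] real_sqrt_ge_0_iff by blast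
    then show ?thesis using power_mono[OF \<open>\<gamma> \<le> sqrt (d j)\<close> sv(2), of 2] by simp
  qed
  then have "\<gamma>\<^sup>2 * (frob_norm G)\<^sup>2 \<le> (frob_norm (M * G))\<^sup>2"
    using quadratic_form_ge[OF Q D G, of "\<gamma>\<^sup>2"] unfolding sq[OF G] by blast
  then have "(\<gamma> * frob_norm G)\<^sup>2 \<le> (frob_norm (M * G))\<^sup>2" by (simp only: power_mult_distrib)
  then show ?thesis by (rule power2_le_imp_le) (rule frob_norm_nonneg)
qed

text \<open>
  The columns of \<open>P\<close> already account for the eigenvalue \<open>0\<close> with multiplicity \<open>s\<close>. So in an eigenbasis
  that starts with them, each of the remaining eigenvalues is at least the \<open>(s + 1)\<close>-th smallest singular
  value, and projecting \<open>P\<close> away removes exactly the first \<open>s\<close> coordinates.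
\<close>
lemma kth_smallest_sv_gap:
  assumes Z: "psd n Z" and P: "P \<in> carrier_mat n s" "transpose_mat P * P = 1\<^sub>m s"
    and ZP: "Z * P = 0\<^sub>m n s" and sv: "s < n \<longrightarrow> lam \<le> kth_smallest_sv (s + 1) Z"
    and U: "U \<in> carrier_mat n r"
  shows "lam * (frob_norm (U - P * (transpose_mat P * U)))\<^sup>2 \<le> frob_inner (Z * U) U"
proof -
  note Zc = psdD[OF Z]
  have ZPj: "Z *\<^sub>v col P j = 0 \<cdot>\<^sub>v col P j" if "j < s" for j
  proof -
    have "Z *\<^sub>v col P j = col (0\<^sub>m n s) j"
      using col_mult2[OF Zc(1) P(1) that] by (simp add: ZP)
    then show ?thesis using P that by (auto intro!: eq_vecI)
  qed
  then have "\<forall>j<s. \<exists>c. Z *\<^sub>v col P j = c \<cdot>\<^sub>v col P j" by blast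
  from eigenbasis_extension[OF Zc P this] obtain Q where Q: "Q \<in> carrier_mat n n"
    "transpose_mat Q * Q = 1\<^sub>m n" and QP: "\<forall>j<s. col Q j = col P j"
    and evex: "\<forall>j<n. \<exists>c. Z *\<^sub>v col Q j = c \<cdot>\<^sub>v col Q j"
    by (elim bexE conjE) (rule that)
  obtain d where ev: "\<forall>j<n. Z *\<^sub>v col Q j = d j \<cdot>\<^sub>v col Q j"
    using evex by metis
  have Qij: "col Q i \<bullet> col Q j = (if i = j then 1 else 0)" if "i < n" "j < n" for i j
    using Q(2) that unfolding orthonormal_cols_iff[OF Q(1)] by blast
  note D = eigenbasis_diagonalizes[OF Zc(1) Q ev]
  have sn: "s \<le> n" by (rule orthonormal_cols_le[OF P])
  have d0: "0 \<le> d j" if "j < n" for j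
    using psd_eigenvalue_nonneg[OF Z, of "col Q j" "d j"] ev that Q(1) Qij by auto
  have ds: "d j = 0" if "j < s" for j
  proof -
    have "d j \<cdot>\<^sub>v col Q j = 0 \<cdot>\<^sub>v col Q j" 
      using ev[rule_format, of j] ZPj[OF that] QP[rule_format, OF that] that sn by simp
    then have "col Q j \<bullet> (d j \<cdot>\<^sub>v col Q j) = col Q j \<bullet> (0 \<cdot>\<^sub>v col Q j)" by simp
    then show ?thesis using Qij[of j j] that sn Q(1) by simp
  qed
  have ZZ: "transpose_mat Z * Z = Q * mat_diag n (\<lambda>j. d j * d j) * transpose_mat Q"
    unfolding Zc(2) using arg_cong2[OF D D, of "(*)"] conjugated_diag_mult[OF Q] by (rule trans)
  have dl: "lam \<le> d j" if j: "s \<le> j" "j < n" for j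
  proof -
    have "lam \<le> sqrt (sort (map (\<lambda>j. d j * d j) [0..<n]) ! s)"
      using sv j by (simp add: kth_smallest_sv_def singular_values_of_gram[OF Q ZZ])
    also have "\<dots> \<le> sqrt (map (\<lambda>j. d j * d j) [0..<n] ! j)"
      using j ds by (intro real_sqrt_le_mono sort_nth_le) auto
    also have "\<dots> = d j" using j d0 by simp
    finally show ?thesis .
  qed
  let ?E = "U - P * (transpose_mat P * U)" and ?F = "transpose_mat Q * U"
  have entry: "(transpose_mat Q * ?E) $$ (j, l) = (if j < s then 0 else ?F $$ (j, l))"
    if jl: "j < n" "l < r" for j l
  proof -
    have "transpose_mat Q * ?E = ?F - (transpose_mat Q * P) * (transpose_mat P * U)"
      using Q(1) P(1) U by (simp add: mult_minus_distrib_mat[of _ n n _ r] mult_assoc_dim del: assoc_mult_mat)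
    then have "(transpose_mat Q * ?E) $$ (j, l)
        = ?F $$ (j, l) - (\<Sum>i<s. (transpose_mat Q * P) $$ (j, i) * (transpose_mat P * U) $$ (i, l))"
      using jl Q(1) P(1) U mat_mult_entry[of "transpose_mat Q * P" n s "transpose_mat P * U" r j l] by simp
    also have "(\<Sum>i<s. (transpose_mat Q * P) $$ (j, i) * (transpose_mat P * U) $$ (i, l))
        = (\<Sum>i<s. if i = j then ?F $$ (j, l) else 0)"
    proof (rule sum.cong)
      fix i assume i: "i \<in> {..<s}"
      then have "(transpose_mat Q * P) $$ (j, i) = (if i = j then 1 else 0)"
        using jl Q(1) P(1) QP Qij[of j i] sn by auto
      moreover have "(transpose_mat P * U) $$ (i, l) = ?F $$ (i, l)"
        using i jl Q(1) P(1) QP U sn by simp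
      ultimately show "(transpose_mat Q * P) $$ (j, i) * (transpose_mat P * U) $$ (i, l)
          = (if i = j then ?F $$ (j, l) else 0)" by simp
    qed simp
    finally show ?thesis using jl by simp
  qed
  have "frob_norm ?E = frob_norm (transpose_mat Q * ?E)"
    using frob_norm_orthonormal_mult[of "transpose_mat Q" n n ?E r] Q(1) orthogonal_transpose[OF Q] P U by simp
  then have "lam * (frob_norm ?E)\<^sup>2 = lam * (\<Sum>j<n. \<Sum>l<r. ((transpose_mat Q * ?E) $$ (j, l))\<^sup>2)"
    using frob_norm_sq_sum[of "transpose_mat Q * ?E" n r] Q(1) P U by simp
  also have "\<dots> = (\<Sum>j<n. lam * (\<Sum>l<r. (if j < s then 0 else ?F $$ (j, l))\<^sup>2))"
    unfolding sum_distrib_left by (intro sum.cong refl) (simp add: entry del: index_mult_mat)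
  also have "\<dots> \<le> (\<Sum>j<n. d j * (\<Sum>l<r. (?F $$ (j, l))\<^sup>2))"
  proof (rule sum_mono)
    fix j assume "j \<in> {..<n}"
    then show "lam * (\<Sum>l<r. (if j < s then 0 else ?F $$ (j, l))\<^sup>2) \<le> d j * (\<Sum>l<r. (?F $$ (j, l))\<^sup>2)"
      using ds dl by (cases "j < s") (auto intro!: mult_right_mono sum_nonneg simp del: index_mult_mat)
  qed
  also have "\<dots> = frob_inner (Z * U) U" using quadratic_form_eigenbasis[OF Q(1) D U] by simp
  finally show ?thesis .
qed

section \<open>Procrustes perturbation\<close>

text \<open>
  Complete the transposes to orthogonal matrices \<open>N1\<close> and \<open>N2\<close>. Then \<open>O1 N1 = O2 N2\<close>, since both are the
  identity followed by zero columns, and \<open>N1 N2\<^sup>T\<close> is the rotation.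
\<close>
lemma orthonormal_rows_rotation:
  fixes O1 O2 :: "real mat"
  assumes O1: "O1 \<in> carrier_mat s r" "O1 * transpose_mat O1 = 1\<^sub>m s"
    and O2: "O2 \<in> carrier_mat s r" "O2 * transpose_mat O2 = 1\<^sub>m s"
  obtains Om where "Om \<in> carrier_mat r r" "transpose_mat Om * Om = 1\<^sub>m r" "O1 * Om = O2"
proof -
  have ex: "\<exists>N\<in>carrier_mat r r. transpose_mat N * N = 1\<^sub>m r \<and>
      (\<forall>i<s. \<forall>j<r. (W * N) $$ (i, j) = (if i = j then 1 else 0))"
    if W: "W \<in> carrier_mat s r" "W * transpose_mat W = 1\<^sub>m s" for W :: "real mat"
  proof -
    have WT: "transpose_mat W \<in> carrier_mat r s" "transpose_mat (transpose_mat W) * transpose_mat W = 1\<^sub>m s"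
      using W by auto
    have sr: "s \<le> r" by (rule orthonormal_cols_le[OF WT])
    obtain N where N: "N \<in> carrier_mat r r" "transpose_mat N * N = 1\<^sub>m r"
      and cN: "\<forall>j<s. col N j = col (transpose_mat W) j"
      using orthonormal_completion[OF WT] by (elim bexE conjE) (rule that)
    have "(W * N) $$ (i, j) = (if i = j then 1 else 0)" if ij: "i < s" "j < r" for i j
    proof -
      have "(W * N) $$ (i, j) = col N i \<bullet> col N j" using cN W N ij by simp
      also have "\<dots> = (if i = j then 1 else 0)"
        using N(2) ij sr unfolding orthonormal_cols_iff[OF N(1)] by simp
      finally show ?thesis .
    qed
    then show ?thesis using N by blast
  qed
  obtain N1 where N1: "N1 \<in> carrier_mat r r" "transpose_mat N1 * N1 = 1\<^sub>m r"
    and e1: "\<forall>i<s. \<forall>j<r. (O1 * N1) $$ (i, j) = (if i = j then 1 else 0)"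
    using ex[OF O1] by (elim bexE conjE) (rule that)
  obtain N2 where N2: "N2 \<in> carrier_mat r r" "transpose_mat N2 * N2 = 1\<^sub>m r"
    and e2: "\<forall>i<s. \<forall>j<r. (O2 * N2) $$ (i, j) = (if i = j then 1 else 0)"
    using ex[OF O2] by (elim bexE conjE) (rule that)
  have N2': "N2 * transpose_mat N2 = 1\<^sub>m r" by (rule orthogonal_transpose[OF N2])
  have eq: "O1 * N1 = O2 * N2"
  proof (rule eq_matI)
    fix i j assume "i < dim_row (O2 * N2)" "j < dim_col (O2 * N2)"
    then have "i < s" "j < r" using O2 N2 by auto
    then show "(O1 * N1) $$ (i, j) = (O2 * N2) $$ (i, j)" using e1 e2 by presburger
  qed (use O1 O2 N1 N2 in auto)
  define Om where "Om = N1 * transpose_mat N2"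
  have Om: "Om \<in> carrier_mat r r" using N1 N2 by (simp add: Om_def)
  moreover have "transpose_mat Om * Om = 1\<^sub>m r"
  proof -
    have "transpose_mat Om * Om = N2 * (transpose_mat N1 * (N1 * transpose_mat N2))"
      using N1(1) N2(1) by (simp add: Om_def transpose_mult_dim mult_assoc_dim del: assoc_mult_mat)
    also have "transpose_mat N1 * (N1 * transpose_mat N2) = transpose_mat N2"
      by (rule left_inverse_cancel[OF N1(2)]) (use N1(1) N2(1) in auto)
    finally show ?thesis using N2' by simp
  qed
  moreover have "O1 * Om = O2"
  proof -
    have "O1 * Om = (O1 * N1) * transpose_mat N2"
      using O1(1) N1(1) N2(1) by (simp add: Om_def mult_assoc_dim del: assoc_mult_mat)
    also have "\<dots> = O2 * (N2 * transpose_mat N2)"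
      unfolding eq using O2(1) N2(1) by (simp add: mult_assoc_dim del: assoc_mult_mat)
    finally show ?thesis using O2(1) unfolding N2' by simp
  qed
  ultimately show thesis by (rule that)
qed

lemma invertible_mat_obtain_inverse:
  fixes T :: "real mat"
  assumes "T \<in> carrier_mat n n" "det T \<noteq> 0"
  obtains Ti where "Ti \<in> carrier_mat n n" "Ti * T = 1\<^sub>m n" "T * Ti = 1\<^sub>m n"
  using det_non_zero_imp_unit[OF assms, of "()"] by (auto simp: Units_def ring_mat_simps)

lemma mat_diag_cong:
  assumes "\<And>i. i < n \<Longrightarrow> f i = g i"
  shows "mat_diag n f = mat_diag n g"
  using assms by (auto simp: mat_diag_def)

text \<open>
  Let \<open>R\<close> be the square root of the diagonal matrix and \<open>N = T - R\<close>. Then \<open>T\<^sup>2 - R\<^sup>2 = T N + N R\<close>.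
  In the inner product with \<open>N\<close> the first term is nonnegative and the second is at least
  \<open>sqrt m \<parallel>N\<parallel>\<^sup>2\<close>, so Cauchy-Schwarz gives the bound.
\<close>
lemma psd_sqrt_perturbation:
  assumes T: "psd s T" and m: "0 < m" and d: "\<forall>i<s. m \<le> d i"
  shows "sqrt m * frob_norm (T - mat_diag s (\<lambda>i. sqrt (d i))) \<le> frob_norm (T * T - mat_diag s d)"
proof -
  let ?R = "mat_diag s (\<lambda>i. sqrt (d i))"
  define N where "N = T - ?R"
  note Tc = psdD(1)[OF T]
  have R: "?R \<in> carrier_mat s s" by simp
  have N: "N \<in> carrier_mat s s" using Tc by (simp add: N_def minus_carrier_mat)
  have RR: "?R * ?R = mat_diag s d"
  proof -
    have "sqrt (d i) * sqrt (d i) = d i" if "i < s" for i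
      using d[rule_format, OF that] m by simp
    then show ?thesis unfolding mat_diag_diag by (intro mat_diag_cong)
  qed
  have split: "T * T - mat_diag s d = T * N + N * ?R"
  proof -
    have "T * N = T * T - T * ?R" unfolding N_def by (rule mult_minus_distrib_mat[OF Tc Tc R])
    moreover have "N * ?R = T * ?R - ?R * ?R" unfolding N_def by (rule minus_mult_distrib_mat[OF Tc R R])
    moreover have "T * ?R \<in> carrier_mat s s" "T * T \<in> carrier_mat s s" using Tc by auto
    ultimately show ?thesis unfolding RR using Tc by (intro eq_matI) (auto simp del: index_mult_mat(1))
  qed
  have "sqrt m * (frob_norm N)\<^sup>2 = (\<Sum>i<s. \<Sum>j<s. sqrt m * (N $$ (i, j))\<^sup>2)"
    by (simp add: frob_norm_sq_sum[OF N] sum_distrib_left)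
  also have "\<dots> \<le> (\<Sum>i<s. \<Sum>j<s. sqrt (d j) * (N $$ (i, j))\<^sup>2)"
    using d by (intro sum_mono mult_right_mono) auto
  also have "\<dots> = frob_inner (N * ?R) N"
    using N by (subst frob_inner_carrier[where n=s and m=s])
      (auto simp: mat_diag_mult_right[OF N] power2_eq_square mult_ac)
  also have "\<dots> \<le> frob_inner (T * N) N + frob_inner (N * ?R) N"
    using psd_quadratic_form_nonneg[OF T N] by simp
  also have "\<dots> = frob_inner (T * T - mat_diag s d) N"
    unfolding split by (rule frob_inner_add_left[symmetric]) (use Tc N in auto)
  also have "\<dots> \<le> frob_norm (T * T - mat_diag s d) * frob_norm N"
    using frob_Cauchy_Schwarz[of "T * T - mat_diag s d" s s N] Tc N by (simp add: minus_carrier_mat)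
  finally have *: "(sqrt m * frob_norm N) * frob_norm N \<le> frob_norm (T * T - mat_diag s d) * frob_norm N"
    by (simp add: power2_eq_square mult.assoc)
  show ?thesis
  proof (cases "frob_norm N = 0")
    case True
    then show ?thesis using frob_norm_nonneg by (simp add: N_def)
  next
    case False
    then have "frob_norm N > 0" using frob_norm_nonneg[of N] by simp
    then show ?thesis using * unfolding N_def by (rule mult_right_le_imp_le[rotated])
  qed
qed

text \<open>
  Both factors are a square root of their Gram matrix times a matrix with orthonormal rows. A rotation
  matches these rows, and the distance that remains is the distance of the square roots.
\<close>
lemma procrustes_perturbation:
  fixes V W :: "real mat"
  assumes V: "V \<in> carrier_mat s r" and W: "W \<in> carrier_mat s r" "W * transpose_mat W = mat_diag s d"
    and m: "0 < m" "\<forall>i<s. m \<le> d i"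
    and close: "frob_norm (V * transpose_mat V - mat_diag s d) \<le> m / 2"
  obtains Om where "Om \<in> carrier_mat r r" "transpose_mat Om * Om = 1\<^sub>m r"
    "sqrt m * frob_norm (V - W * Om) \<le> frob_norm (V * transpose_mat V - mat_diag s d)"
proof -
  let ?D = "mat_diag s d" and ?G = "V * transpose_mat V"
  have D: "?D \<in> carrier_mat s s" and G: "?G \<in> carrier_mat s s" using V by auto
  obtain T where T: "psd s T" and TT: "T * T = ?G" by (rule psd_sqrt[OF psd_gram[OF V]])
  note Tc = psdD[OF T]
  \<comment> \<open>The smallness of the perturbation keeps the Gram matrix of V definite.\<close>
  have "det T \<noteq> 0"
  proof
    assume "det T = 0"
    then obtain v where v: "v \<in> carrier_vec s" "v \<noteq> 0\<^sub>v s" "T *\<^sub>v v = 0\<^sub>v s"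
      using det_0_iff_vec_prod_zero_field[OF Tc(1)] by blast
    define N where "N = mat_of_cols s [v]"
    have N: "N \<in> carrier_mat s 1" by (simp add: N_def mat_of_cols_def)
    have "T * N = 0\<^sub>m s 1"
      unfolding N_def mult_mat_of_cols_single[OF Tc(1) v(1)] v(3)
      by (intro eq_matI) (auto simp: mat_of_cols_index)
    then have "?G * N = 0\<^sub>m s 1"
      unfolding TT[symmetric] using Tc(1) N by (simp add: mult_assoc_dim del: assoc_mult_mat)
    then have GN: "frob_inner (?G * N) N = 0" by (simp add: frob_inner_def)
    have "m * (frob_norm N)\<^sup>2 \<le> frob_inner (?D * N) N"
      by (rule quadratic_form_ge[where Q = "1\<^sub>m s" and n = s and d = d]) (use D N m in auto)
    also have "\<dots> = frob_inner (?D * N) N - frob_inner (?G * N) N" by (simp add: GN)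
    also have "\<dots> = frob_inner ((?D - ?G) * N) N"
      unfolding minus_mult_distrib_mat[OF D G N]
      by (rule frob_inner_diff_left[symmetric, OF mult_carrier_mat[OF D N] mult_carrier_mat[OF G N]])
    also have "\<dots> \<le> frob_norm ((?D - ?G) * N) * frob_norm N"
      using frob_Cauchy_Schwarz[OF mult_carrier_mat[OF minus_carrier_mat[OF G] N] N, of ?D]
      by (simp only: abs_le_iff)
    also have "\<dots> \<le> (frob_norm (?D - ?G) * frob_norm N) * frob_norm N"
      using D G N by (intro mult_right_mono frob_norm_mult[of _ s s _ 1] frob_norm_nonneg) auto
    also have "\<dots> \<le> (m / 2 * frob_norm N) * frob_norm N"
      using close frob_norm_minus_commute[OF D G] by (intro mult_right_mono frob_norm_nonneg) simp
    finally have "m * (frob_norm N)\<^sup>2 \<le> m / 2 * (frob_norm N)\<^sup>2"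
      by (simp add: power2_eq_square)
    then have "frob_norm N = 0" using m(1) by (simp add: mult_le_cancel_right)
    then have "norm2 v = 0" using frob_norm_mat_of_cols_single[OF v(1)] by (simp add: N_def)
    then have "v \<bullet> v = 0" by (simp add: norm2_def)
    then show False using scalar_prod_self_eq_0D v by blast
  qed
  then obtain Ti where Ti: "Ti \<in> carrier_mat s s" "Ti * T = 1\<^sub>m s" "T * Ti = 1\<^sub>m s"
    by (rule invertible_mat_obtain_inverse[OF Tc(1)])
  \<comment> \<open>Polar decomposition of V: the rows of O2 are orthonormal and T * O2 = V.\<close>
  define O2 where "O2 = Ti * V"
  have O2: "O2 \<in> carrier_mat s r" using Ti V by (simp add: O2_def)
  have V2: "T * O2 = V"
    unfolding O2_def by (rule left_inverse_cancel[OF Ti(3)]) (use Tc Ti V in auto)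
  have O2O: "O2 * transpose_mat O2 = 1\<^sub>m s"
  proof -
    have tr: "T * transpose_mat Ti = 1\<^sub>m s"
    proof -
      have "T * transpose_mat Ti = transpose_mat (Ti * T)"
        using Tc Ti(1) by (simp add: transpose_mult_dim)
      then show ?thesis unfolding Ti(2) by simp
    qed
    have "O2 * transpose_mat O2 = Ti * (?G * transpose_mat Ti)"
      using Ti(1) V by (simp add: O2_def transpose_mult_dim mult_assoc_dim del: assoc_mult_mat)
    also have "?G * transpose_mat Ti = T * (T * transpose_mat Ti)"
      unfolding TT[symmetric] using Tc(1) Ti(1) by (simp add: mult_assoc_dim del: assoc_mult_mat)
    also have "T * (T * transpose_mat Ti) = T" unfolding tr using Tc(1) by simp
    finally show ?thesis using Ti(2) by simp
  qed
  let ?R = "mat_diag s (\<lambda>i. sqrt (d i))" and ?S = "mat_diag s (\<lambda>i. 1 / sqrt (d i))"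
  have dpos: "0 < d i" if "i < s" for i using m that less_le_trans by blast
  have RS: "?R * ?S = 1\<^sub>m s"
    unfolding mat_diag_diag mat_diag_one[symmetric]
    using dpos by (intro mat_diag_cong) (metis divide_self_if mult.right_neutral order_less_irrefl real_sqrt_gt_0_iff times_divide_eq_right)
  \<comment> \<open>Polar decomposition of W, with the explicit square root of the diagonal Gram matrix.\<close>
  define O1 where "O1 = ?S * W"
  have O1: "O1 \<in> carrier_mat s r" unfolding O1_def by (rule mult_carrier_mat[OF _ W(1)]) simp
  have W1: "?R * O1 = W"
    unfolding O1_def by (rule left_inverse_cancel[OF RS]) (use W in auto)
  have O1O: "O1 * transpose_mat O1 = 1\<^sub>m s"
  proof -
    have "O1 * transpose_mat O1 = ?S * (W * transpose_mat W * ?S)"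
      using W(1) by (simp add: O1_def transpose_mult_dim mult_assoc_dim del: assoc_mult_mat)
    also have "\<dots> = mat_diag s (\<lambda>i. 1 / sqrt (d i) * (d i * (1 / sqrt (d i))))"
      unfolding W(2) mat_diag_diag ..
    also have "\<dots> = 1\<^sub>m s"
    proof -
      have "1 / sqrt (d i) * (d i * (1 / sqrt (d i))) = 1" if "i < s" for i
        using dpos[OF that] by (simp add: field_simps)
      then show ?thesis unfolding mat_diag_one[symmetric] by (intro mat_diag_cong)
    qed
    finally show ?thesis .
  qed
  obtain Om where Om: "Om \<in> carrier_mat r r" "transpose_mat Om * Om = 1\<^sub>m r" "O1 * Om = O2"
    by (rule orthonormal_rows_rotation[OF O1 O1O O2 O2O])
  have "W * Om = ?R * (O1 * Om)"
    unfolding W1[symmetric] using O1 Om(1) by (simp add: mult_assoc_dim del: assoc_mult_mat)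
  then have "V - W * Om = T * O2 - ?R * O2" unfolding Om(3) V2 by simp
  also have "\<dots> = (T - ?R) * O2"
    by (rule minus_mult_distrib_mat[symmetric]) (use Tc O2 in auto)
  finally have VW: "V - W * Om = (T - ?R) * O2" .
  have TR: "T - ?R \<in> carrier_mat s s" by simp
  have "frob_norm ((T - ?R) * O2) = frob_norm (transpose_mat O2 * transpose_mat (T - ?R))"
    using frob_norm_transpose[OF mult_carrier_mat[OF TR O2]] transpose_mult[OF TR O2] by simp
  also have "\<dots> = frob_norm (transpose_mat (T - ?R))"
    by (rule frob_norm_orthonormal_mult[of _ r s _ s]) (use O2 O2O Tc in \<open>auto simp: minus_carrier_mat\<close>)
  also have "\<dots> = frob_norm (T - ?R)"
    by (rule frob_norm_transpose[of _ s s]) (use Tc in auto)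
  finally have "sqrt m * frob_norm (V - W * Om) \<le> frob_norm (?G - ?D)"
    using psd_sqrt_perturbation[OF T m] unfolding VW TT by simp
  then show thesis using that Om(1,2) by blast
qed

section \<open>The measurement operator and its adjoint\<close>

lemma norm2_sq: "(norm2 v)\<^sup>2 = v \<bullet> v"
  by (simp add: norm2_def scalar_prod_self_nonneg)

lemma norm2_nonneg: "0 \<le> norm2 v"
  by (simp add: norm2_def scalar_prod_self_nonneg)

lemma norm2_Cauchy_Schwarz:
  assumes "v \<in> carrier_vec n" "w \<in> carrier_vec n"
  shows "\<bar>v \<bullet> w\<bar> \<le> norm2 v * norm2 w"
proof -
  have "(v \<bullet> w)\<^sup>2 \<le> (v \<bullet> v) * (w \<bullet> w)"
    using sum_mult_Cauchy_Schwarz[of "\<lambda>i. v $ i" "\<lambda>i. w $ i" "{0..<n}"] assms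
    by (simp add: scalar_prod_def power2_eq_square)
  then have "\<bar>v \<bullet> w\<bar>\<^sup>2 \<le> (norm2 v * norm2 w)\<^sup>2"
    by (simp add: power_mult_distrib norm2_sq)
  then show ?thesis by (rule power2_le_imp_le) (simp add: norm2_nonneg)
qed

lemma norm2_triangle:
  assumes "v \<in> carrier_vec n" "w \<in> carrier_vec n"
  shows "norm2 (v + w) \<le> norm2 v + norm2 w"
proof -
  have "(norm2 (v + w))\<^sup>2 = v \<bullet> v + 2 * (v \<bullet> w) + w \<bullet> w"
    using assms comm_scalar_prod[OF assms]
    by (simp add: norm2_sq add_scalar_prod_distrib[of _ n] scalar_prod_add_distrib[of _ n])
  also have "\<dots> \<le> (norm2 v + norm2 w)\<^sup>2"
    using norm2_Cauchy_Schwarz[OF assms] by (simp add: norm2_sq power2_sum)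
  finally show ?thesis by (rule power2_le_imp_le) (simp add: norm2_nonneg)
qed

text \<open>
  The Frobenius norm of the measurement operator. It bounds the operator norms of \<open>meas_op\<close> and
  \<open>meas_adj\<close> (see \<open>meas_op_norm_le\<close> and \<open>meas_adj_norm_le\<close>).
\<close>
definition meas_bound :: "nat \<Rightarrow> (nat \<Rightarrow> real mat) \<Rightarrow> real" where
  "meas_bound k A = sqrt (\<Sum>i<k. (frob_norm (A i))\<^sup>2)"

lemma meas_bound_nonneg: "0 \<le> meas_bound k A"
  by (simp add: meas_bound_def sum_nonneg)

lemma meas_op_carrier [simp]: "meas_op k A X \<in> carrier_vec k"
  by (simp add: meas_op_def)

lemma meas_adj_carrier [simp]: "meas_adj n k A y \<in> carrier_mat n n"
  by (simp add: meas_adj_def)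

lemma dim_meas [simp]:
  "dim_vec (meas_op k A X) = k" "dim_row (meas_adj n k A y) = n" "dim_col (meas_adj n k A y) = n"
  by (simp_all add: meas_op_def meas_adj_def)

lemma sum_frob_inner_sq_le:
  assumes "\<And>i. i < k \<Longrightarrow> A i \<in> carrier_mat n n" "X \<in> carrier_mat n n"
  shows "(\<Sum>i<k. (frob_inner (A i) X)\<^sup>2) \<le> (meas_bound k A * frob_norm X)\<^sup>2"
proof -
  have "(\<Sum>i<k. (frob_inner (A i) X)\<^sup>2) \<le> (\<Sum>i<k. (frob_norm (A i))\<^sup>2 * (frob_norm X)\<^sup>2)"
  proof (rule sum_mono)
    fix i assume "i \<in> {..<k}"
    then have "\<bar>frob_inner (A i) X\<bar>\<^sup>2 \<le> (frob_norm (A i) * frob_norm X)\<^sup>2"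
      using assms by (intro power_mono frob_Cauchy_Schwarz[of _ n n]) auto
    then show "(frob_inner (A i) X)\<^sup>2 \<le> (frob_norm (A i))\<^sup>2 * (frob_norm X)\<^sup>2"
      by (simp add: power_mult_distrib)
  qed
  then show ?thesis
    by (simp add: meas_bound_def power_mult_distrib sum_nonneg sum_distrib_right)
qed

lemma meas_op_norm_le:
  assumes "\<And>i. i < k \<Longrightarrow> A i \<in> carrier_mat n n" "X \<in> carrier_mat n n"
  shows "norm2 (meas_op k A X) \<le> meas_bound k A * frob_norm X"
proof (rule power2_le_imp_le)
  show "(norm2 (meas_op k A X))\<^sup>2 \<le> (meas_bound k A * frob_norm X)\<^sup>2"
    using sum_frob_inner_sq_le[of k A n X, OF assms] unfolding norm2_sq
    by (simp add: meas_op_def scalar_prod_def power2_eq_square atLeast0LessThan)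
qed (simp add: meas_bound_nonneg frob_norm_nonneg)

lemma meas_op_diff:
  assumes "\<And>i. i < k \<Longrightarrow> A i \<in> carrier_mat n n" "X \<in> carrier_mat n n" "Y \<in> carrier_mat n n"
  shows "meas_op k A (X - Y) = meas_op k A X - meas_op k A Y"
  using assms by (intro eq_vecI) (auto simp: meas_op_def frob_inner_diff_right[of _ n n])

lemma frob_inner_meas_adj:
  assumes "\<And>i. i < k \<Longrightarrow> A i \<in> carrier_mat n n" "X \<in> carrier_mat n n"
  shows "frob_inner (meas_adj n k A y) X = y \<bullet> meas_op k A X"
proof -
  have "frob_inner (meas_adj n k A y) X
      = (\<Sum>p<n. \<Sum>q<n. \<Sum>i<k. y $ i * A i $$ (p, q) * X $$ (p, q))"
    by (simp add: frob_inner_carrier[of _ n n] meas_adj_def sum_distrib_right)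
  also have "\<dots> = (\<Sum>p<n. \<Sum>i<k. \<Sum>q<n. y $ i * A i $$ (p, q) * X $$ (p, q))"
    by (intro sum.cong refl sum.swap)
  also have "\<dots> = (\<Sum>i<k. \<Sum>p<n. \<Sum>q<n. y $ i * A i $$ (p, q) * X $$ (p, q))"
    by (rule sum.swap)
  also have "\<dots> = (\<Sum>i<k. y $ i * frob_inner (A i) X)"
    using assms by (intro sum.cong refl)
      (simp add: frob_inner_carrier[of _ n n] sum_distrib_left mult.assoc)
  finally show ?thesis
    by (simp add: meas_op_def scalar_prod_def atLeast0LessThan)
qed

lemma meas_adj_norm_le:
  assumes A: "\<And>i. i < k \<Longrightarrow> A i \<in> carrier_mat n n" and y: "y \<in> carrier_vec k"
  shows "frob_norm (meas_adj n k A y) \<le> meas_bound k A * norm2 y"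
proof -
  let ?H = "meas_adj n k A y"
  have "frob_norm ?H * frob_norm ?H = y \<bullet> meas_op k A ?H"
    using frob_inner_meas_adj[of k A n ?H y, OF A] by (simp add: frob_norm_sq[symmetric] power2_eq_square)
  also have "\<dots> \<le> norm2 y * norm2 (meas_op k A ?H)"
    using norm2_Cauchy_Schwarz[OF y meas_op_carrier[of k A ?H]] by simp
  also have "\<dots> \<le> norm2 y * (meas_bound k A * frob_norm ?H)"
    by (intro mult_left_mono meas_op_norm_le[of _ _ n] A norm2_nonneg) auto
  finally have *: "frob_norm ?H * frob_norm ?H \<le> (meas_bound k A * norm2 y) * frob_norm ?H"
    by (simp add: mult_ac)
  show ?thesis
  proof (cases "frob_norm ?H = 0")
    case True
    then show ?thesis by (simp add: meas_bound_nonneg norm2_nonneg)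
  next
    case False
    then have "0 < frob_norm ?H" using frob_norm_nonneg[of ?H] by simp
    then show ?thesis using * by (rule mult_right_le_imp_le[rotated])
  qed
qed

lemma frob_norm_factor:
  assumes "U \<in> carrier_mat n r"
  shows "(frob_norm U)\<^sup>2 = frob_inner (1\<^sub>m n) (U * transpose_mat U)"
  using frob_inner_gram[of "1\<^sub>m n" n U r] assms by (simp add: frob_norm_sq)

lemma gram_diff:
  fixes U P :: "real mat"
  assumes "U \<in> carrier_mat n r" "P \<in> carrier_mat n r"
  shows "U * transpose_mat U - P * transpose_mat P
    = U * transpose_mat (U - P) + (U - P) * transpose_mat P"
proof -
  have tr: "transpose_mat (U - P) = transpose_mat U - transpose_mat P"
    using assms by (intro eq_matI) auto
  have "U * (transpose_mat U - transpose_mat P) = U * transpose_mat U - U * transpose_mat P"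
    by (rule mult_minus_distrib_mat[of _ n r _ n]) (use assms in auto)
  moreover have "(U - P) * transpose_mat P = U * transpose_mat P - P * transpose_mat P"
    by (rule minus_mult_distrib_mat[of _ n r _ _ n]) (use assms in auto)
  ultimately show ?thesis
    unfolding tr using assms by (intro eq_matI) auto
qed

lemma frob_norm_gram_diff_le:
  assumes U: "U \<in> carrier_mat n r" "P \<in> carrier_mat n r" and R: "frob_norm U \<le> R" "frob_norm P \<le> R"
  shows "frob_norm (U * transpose_mat U - P * transpose_mat P) \<le> 2 * R * frob_norm (U - P)"
proof -
  have E: "U - P \<in> carrier_mat n r" using U by simp
  have "frob_norm (U * transpose_mat U - P * transpose_mat P)
      \<le> frob_norm (U * transpose_mat (U - P)) + frob_norm ((U - P) * transpose_mat P)"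
    unfolding gram_diff[OF U] by (rule frob_norm_triangle[of _ n n]) (use U in auto)
  also have "\<dots> \<le> frob_norm U * frob_norm (U - P) + frob_norm (U - P) * frob_norm P"
    using frob_norm_mult[of U n r "transpose_mat (U - P)" n] frob_norm_mult[of "U - P" n r "transpose_mat P" n]
      U E frob_norm_transpose[OF E] frob_norm_transpose[OF U(2)] by simp
  also have "\<dots> \<le> R * frob_norm (U - P) + frob_norm (U - P) * R"
    using R by (intro add_mono mult_right_mono mult_left_mono frob_norm_nonneg)
  finally show ?thesis by simp
qed

section \<open>Growth from a dual certificate\<close>

text \<open>
  The constant of quadratic growth in the factor. Here \<open>sqrt (frob_inner (1\<^sub>m n) X)\<close> is the norm of every
  factor of \<open>X\<close>, so the first summand \<open>1\<close> and the quotient bound the distance to the factors by a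
  multiple of the component outside the range of \<open>X\<close>, for all feasible points near the factors.
\<close>
definition growth_const ::
  "nat \<Rightarrow> nat \<Rightarrow> (nat \<Rightarrow> real mat) \<Rightarrow> real mat \<Rightarrow> real \<Rightarrow> real \<Rightarrow> real \<Rightarrow> real" where
  "growth_const n k A X gam lam m =
     2 * lam / (1 + 2 * (sqrt (frob_inner (1\<^sub>m n) X) + 1) * meas_bound k A / (sqrt gam * sqrt m))\<^sup>2"

lemma growth_const_pos:
  assumes X: "psd n X" and pos: "0 < gam" "0 < lam" "0 < m"
  shows "0 < growth_const n k A X gam lam m"
proof -
  obtain B where B: "B \<in> carrier_mat n n" "X = B * transpose_mat B" by (rule psd_factor[OF X])
  have "0 \<le> frob_inner (1\<^sub>m n) X"
    using frob_norm_factor[OF B(1)] unfolding B(2)[symmetric] by (metis zero_le_power2)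
  then have "0 \<le> 2 * (sqrt (frob_inner (1\<^sub>m n) X) + 1) * meas_bound k A / (sqrt gam * sqrt m)"
    using pos meas_bound_nonneg[of k A] by (intro divide_nonneg_nonneg mult_nonneg_nonneg) auto
  then have "0 < 1 + 2 * (sqrt (frob_inner (1\<^sub>m n) X) + 1) * meas_bound k A / (sqrt gam * sqrt m)"
    by linarith
  then show ?thesis
    unfolding growth_const_def using pos(2) by (intro divide_pos_pos zero_less_power) auto
qed

text \<open>
  A primal solution with its eigenvectors \<open>Q\<close> and eigenvalues \<open>d\<close>, and a dual certificate \<open>(y, Z)\<close> for it.
  The number of columns of the factors is not part of the data, so the constants obtained here do not
  depend on it.
\<close>
locale sdp_certificate =
  fixes n k s :: nat and A :: "nat \<Rightarrow> real mat" and C Xs Q Z :: "real mat" and b y :: "real vec"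
    and d :: "nat \<Rightarrow> real" and gam lam :: real
  assumes A_sym: "\<And>i. i < k \<Longrightarrow> A i \<in> sym_mats n"
    and C_sym: "C \<in> sym_mats n"
    and Q: "Q \<in> carrier_mat n s" "transpose_mat Q * Q = 1\<^sub>m s"
    and Xs_psd: "psd n Xs"
    and Xs_eq: "Xs = Q * mat_diag s d * transpose_mat Q"
    and d_pos: "\<And>i. i < s \<Longrightarrow> 0 < d i"
    and Xs_feasible: "meas_op k A Xs = b"
    and y: "y \<in> carrier_vec k"
    and Z: "psd n Z"
    and stationary: "C + meas_adj n k A y - Z = 0\<^sub>m n n"
    and complementary: "frob_inner Z Xs = 0"
    and gap: "s < n \<longrightarrow> lam \<le> kth_smallest_sv (s + 1) Z"
    and nondegenerate: "dual_nondegenerate k s A Q gam"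
    and gam_pos: "0 < gam" and lam_pos: "0 < lam"
begin

text \<open>
  The component outside the range of \<open>Xs\<close>.
\<close>
definition perp :: "real mat \<Rightarrow> real mat" where
  "perp U = U - Q * (transpose_mat Q * U)"

lemma A_carrier: "i < k \<Longrightarrow> A i \<in> carrier_mat n n"
  using A_sym sym_matsD by blast

lemmas C_carrier = sym_matsD(1)[OF C_sym]
lemmas Z_carrier = psdD(1)[OF Z]
lemmas Xs_carrier = psdD(1)[OF Xs_psd]

lemma Z_eq: "Z = C + meas_adj n k A y"
proof (rule eq_matI)
  fix i j assume ij: "i < dim_row (C + meas_adj n k A y)" "j < dim_col (C + meas_adj n k A y)"
  then have "i < n" "j < n" by (auto simp: meas_adj_def)
  then have "(C + meas_adj n k A y - Z) $$ (i, j) = 0" unfolding stationary by simp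
  then show "Z $$ (i, j) = (C + meas_adj n k A y) $$ (i, j)" using \<open>i < n\<close> \<open>j < n\<close> Z_carrier by simp
qed (use Z_carrier in \<open>auto simp: meas_adj_def\<close>)

text \<open>
  The multipliers contribute the same amount at all feasible points, so only the slack matrix is left in
  differences of the objective.
\<close>
lemma objective_gap:
  assumes X: "X \<in> carrier_mat n n" "meas_op k A X = b"
  shows "frob_inner C X - frob_inner C Xs = frob_inner Z X"
proof -
  have "frob_inner Z W = frob_inner C W + y \<bullet> meas_op k A W" if "W \<in> carrier_mat n n" for W
    unfolding Z_eq using frob_inner_add_left[OF C_carrier meas_adj_carrier] frob_inner_meas_adj[of k A n W y, OF A_carrier that]
    by simp
  from this[OF X(1)] this[OF Xs_carrier] show ?thesis
    using X(2) Xs_feasible complementary by simp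
qed

text \<open>
  Complementarity of two positive semidefinite matrices means that their product vanishes, and \<open>Q\<close> spans
  the range of \<open>Xs\<close> because all eigenvalues in \<open>d\<close> are positive.
\<close>
lemma Z_mult_Q: "Z * Q = 0\<^sub>m n s"
proof -
  obtain B where B: "B \<in> carrier_mat n n" "Xs = B * transpose_mat B" by (rule psd_factor[OF Xs_psd])
  have "frob_inner (Z * B) B = 0"
    using complementary frob_inner_gram[OF Z_carrier B(1)] B(2) by simp
  then have ZB: "Z * B = 0\<^sub>m n n" by (rule psd_quadratic_form_eq_0D[OF Z B(1)])
  have "Z * (B * transpose_mat B) = Z * B * transpose_mat B"
    by (rule assoc_mult_mat[symmetric, OF Z_carrier B(1)]) (use B in simp)
  then have ZX: "Z * Xs = 0\<^sub>m n n" unfolding B(2) ZB using B(1) by simp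
  have "Xs * Q = Q * mat_diag s d"
  proof -
    have "Xs * Q = Q * mat_diag s d * (transpose_mat Q * Q)"
      unfolding Xs_eq by (rule assoc_mult_mat[of _ n s _ n _ s]) (use Q(1) in auto)
    then show ?thesis unfolding Q(2) using Q(1) by simp
  qed
  moreover have "Z * (Xs * Q) = Z * Xs * Q"
    by (rule assoc_mult_mat[symmetric, OF Z_carrier Xs_carrier Q(1)])
  ultimately have "Z * (Q * mat_diag s d) = 0\<^sub>m n s" unfolding ZX using Q(1) by simp
  moreover have "Z * (Q * mat_diag s d) = Z * Q * mat_diag s d"
    by (rule assoc_mult_mat[symmetric, OF Z_carrier Q(1) mat_diag_dim])
  ultimately have 0: "Z * Q * mat_diag s d = 0\<^sub>m n s" by simp
  have ZQ: "Z * Q \<in> carrier_mat n s" using Z_carrier Q(1) by simp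
  show ?thesis
  proof (rule eq_matI)
    fix i j assume ij: "i < dim_row (0\<^sub>m n s :: real mat)" "j < dim_col (0\<^sub>m n s :: real mat)"
    then have ij: "i < n" "j < s" by auto
    have "(Z * Q * mat_diag s d) $$ (i, j) = (Z * Q) $$ (i, j) * d j"
      unfolding mat_diag_mult_right[OF ZQ] using ij by simp
    then show "(Z * Q) $$ (i, j) = (0\<^sub>m n s :: real mat) $$ (i, j)"
      unfolding 0 using ij d_pos[of j] by simp
  qed (use ZQ in auto)
qed

lemma perp_carrier [simp]: "U \<in> carrier_mat n r \<Longrightarrow> perp U \<in> carrier_mat n r"
  using Q(1) by (auto simp: perp_def)

lemma Pythagoras:
  assumes U: "U \<in> carrier_mat n r"
  shows "(frob_norm U)\<^sup>2 = (frob_norm (transpose_mat Q * U))\<^sup>2 + (frob_norm (perp U))\<^sup>2"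
proof -
  let ?F = "transpose_mat Q * U"
  have F: "?F \<in> carrier_mat s r" and QF: "Q * ?F \<in> carrier_mat n r" using Q U by auto
  have "frob_inner (Q * ?F) U = frob_inner ?F ?F" by (rule frob_inner_mult_left[OF Q(1) F U])
  moreover have "frob_inner (Q * ?F) (Q * ?F) = frob_inner ?F ?F"
    using frob_norm_orthonormal_mult[OF Q F] by (metis frob_norm_sq)
  moreover have "frob_inner U (Q * ?F) = frob_inner (Q * ?F) U" by (rule frob_inner_commute[OF U QF])
  moreover have "frob_inner (perp U) (perp U) = frob_inner U U - frob_inner U (Q * ?F)
      - (frob_inner (Q * ?F) U - frob_inner (Q * ?F) (Q * ?F))"
    unfolding perp_def frob_inner_diff_left[OF U QF] frob_inner_diff_right[OF U U QF]
      frob_inner_diff_right[OF QF U QF] by simp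
  ultimately show ?thesis unfolding frob_norm_sq by simp
qed

lemma projection_norm_le:
  assumes "U \<in> carrier_mat n r"
  shows "frob_norm (transpose_mat Q * U) \<le> frob_norm U" "frob_norm (perp U) \<le> frob_norm U"
  using Pythagoras[OF assms] by (auto intro!: power2_le_imp_le[OF _ frob_norm_nonneg])

lemma perp_diff:
  assumes "U \<in> carrier_mat n r" "W \<in> carrier_mat n r"
  shows "perp (U - W) = perp U - perp W"
proof -
  have "transpose_mat Q * (U - W) = transpose_mat Q * U - transpose_mat Q * W"
    by (rule mult_minus_distrib_mat[of _ s n _ r]) (use assms Q in auto)
  moreover have "Q * (transpose_mat Q * U - transpose_mat Q * W)
      = Q * (transpose_mat Q * U) - Q * (transpose_mat Q * W)"
    by (rule mult_minus_distrib_mat[of _ n s _ r]) (use assms Q in auto)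
  ultimately show ?thesis
    unfolding perp_def using assms Q by (intro eq_matI) (auto simp del: index_mult_mat(1))
qed

lemma dual_slack_growth:
  assumes U: "U \<in> carrier_mat n r"
  shows "lam * (frob_norm (perp U))\<^sup>2 \<le> frob_inner Z (U * transpose_mat U)"
  unfolding perp_def frob_inner_gram[OF Z_carrier U]
  by (rule kth_smallest_sv_gap[OF Z Q Z_mult_Q gap U])

text \<open>
  By strict complementarity a factor on which the slack vanishes has no component outside the range.
\<close>
lemma perp_factor:
  assumes "V \<in> carrier_mat n r" "V * transpose_mat V = Xs"
  shows "perp V = 0\<^sub>m n r"
proof (rule frob_norm_eq_0D)
  have "lam * (frob_norm (perp V))\<^sup>2 \<le> 0"
    using dual_slack_growth[OF assms(1)] assms(2) complementary by simp
  then show "frob_norm (perp V) = 0" using lam_pos by (simp add: mult_le_0_iff)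
qed (use assms in simp)

lemma factor_eq:
  assumes "V \<in> carrier_mat n r" "V * transpose_mat V = Xs"
  shows "Q * (transpose_mat Q * V) = V"
proof (rule eq_matI)
  fix i j assume "i < dim_row V" "j < dim_col V"
  then have ij: "i < n" "j < r" using assms(1) by auto
  have "(perp V) $$ (i, j) = 0" unfolding perp_factor[OF assms] using ij by simp
  then show "(Q * (transpose_mat Q * V)) $$ (i, j) = V $$ (i, j)"
    unfolding perp_def using ij assms(1) Q(1) by (simp del: index_mult_mat(1))
qed (use assms Q in auto)

lemma perp_le_dist:
  assumes "U \<in> carrier_mat n r" "V \<in> carrier_mat n r" "V * transpose_mat V = Xs"
  shows "frob_norm (perp U) \<le> frob_norm (U - V)"
proof -
  have "perp (U - V) = perp U"
    unfolding perp_diff[OF assms(1,2)] perp_factor[OF assms(2,3)]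
    using perp_carrier[OF assms(1)] by (intro eq_matI) auto
  then show ?thesis using projection_norm_le(2)[of "U - V" r] assms by simp
qed

text \<open>
  Let \<open>V = Q\<^sup>T U\<close> and \<open>P = Q V\<close>. Then \<open>U U\<^sup>T - Xs = H + G\<close> with \<open>H = Q (V V\<^sup>T - D) Q\<^sup>T\<close> and
  \<open>G = U U\<^sup>T - P P\<^sup>T\<close>, where \<open>\<parallel>G\<parallel> \<le> 2 R \<parallel>perp U\<parallel>\<close>. By feasibility \<open>H\<close> and \<open>- G\<close> have the same
  measurements, and non-degeneracy recovers the size of \<open>H\<close> from its measurements.
\<close>
lemma range_error:
  assumes U: "U \<in> carrier_mat n r" "meas_op k A (U * transpose_mat U) = b" and R: "frob_norm U \<le> R"
  shows "sqrt gam * frob_norm (transpose_mat Q * U * transpose_mat (transpose_mat Q * U) - mat_diag s d)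
      \<le> meas_bound k A * (2 * R * frob_norm (perp U))"
    and "frob_norm (U * transpose_mat U - Xs)
      \<le> frob_norm (transpose_mat Q * U * transpose_mat (transpose_mat Q * U) - mat_diag s d)
        + 2 * R * frob_norm (perp U)"
proof -
  define V where "V = transpose_mat Q * U"
  define P where "P = Q * V"
  define W where "W = V * transpose_mat V - mat_diag s d"
  define H where "H = Q * W * transpose_mat Q"
  define G where "G = U * transpose_mat U - P * transpose_mat P"
  have V: "V \<in> carrier_mat s r" using Q U by (simp add: V_def)
  have P: "P \<in> carrier_mat n r" using Q V by (simp add: P_def)
  have W: "W \<in> carrier_mat s s" using V by (simp add: W_def)
  have H: "H \<in> carrier_mat n n" using Q W by (simp add: H_def)
  have G: "G \<in> carrier_mat n n" using P by (simp add: G_def)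
  have PR: "frob_norm P \<le> R"
    using projection_norm_le(1)[OF U(1)] frob_norm_orthonormal_mult[OF Q V] R by (simp add: P_def V_def)
  have UP: "U - P = perp U" by (simp add: perp_def P_def V_def)
  have Gle: "frob_norm G \<le> 2 * R * frob_norm (perp U)"
    using frob_norm_gram_diff_le[OF U(1) P R PR] unfolding UP G_def .
  have PP: "P * transpose_mat P = Q * (V * transpose_mat V) * transpose_mat Q"
    using Q(1) V by (simp add: P_def transpose_mult_dim mult_assoc_dim del: assoc_mult_mat)
  have "Q * W = Q * (V * transpose_mat V) - Q * mat_diag s d"
    unfolding W_def by (rule mult_minus_distrib_mat[of _ n s _ s]) (use Q V in auto)
  then have H': "H = P * transpose_mat P - Xs"
    unfolding H_def PP Xs_eq
    by (simp only:) (rule minus_mult_distrib_mat[of _ n s _ _ n], use Q V in auto)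
  have split: "U * transpose_mat U - Xs = H + G"
    unfolding H' G_def using U P Xs_carrier by (intro eq_matI) (auto simp del: index_mult_mat(1))
  have Hn: "frob_norm H = frob_norm W"
  proof -
    have WQ: "W * transpose_mat Q \<in> carrier_mat s n" using W Q by simp
    have "H = Q * (W * transpose_mat Q)"
      unfolding H_def by (rule assoc_mult_mat[of _ n s _ s _ n]) (use Q W in auto)
    then have "frob_norm H = frob_norm (W * transpose_mat Q)"
      using frob_norm_orthonormal_mult[OF Q WQ] by simp
    also have "\<dots> = frob_norm (transpose_mat (W * transpose_mat Q))"
      using frob_norm_transpose[OF WQ] by simp
    also have "transpose_mat (W * transpose_mat Q) = Q * transpose_mat W"
      using W Q(1) by (simp add: transpose_mult_dim)
    also have "frob_norm (Q * transpose_mat W) = frob_norm W"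
      using frob_norm_orthonormal_mult[OF Q, of "transpose_mat W" s] W frob_norm_transpose[OF W] by simp
    finally show ?thesis .
  qed
  have inner: "frob_inner (transpose_mat Q * A i * Q) W = - frob_inner (A i) G" if i: "i < k" for i
  proof -
    note Ai = A_carrier[OF i]
    have "frob_inner (transpose_mat Q * A i * Q) W = frob_inner (transpose_mat Q * A i) (W * transpose_mat Q)"
      by (rule frob_inner_mult_right[of _ s n _ s]) (use Q Ai W in auto)
    also have "\<dots> = frob_inner (A i) (transpose_mat (transpose_mat Q) * (W * transpose_mat Q))"
      by (rule frob_inner_mult_left[of _ s n _ n]) (use Q Ai W in auto)
    also have "transpose_mat (transpose_mat Q) * (W * transpose_mat Q) = H"
      using Q(1) W by (simp add: H_def mult_assoc_dim del: assoc_mult_mat)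
    also have "frob_inner (A i) H = - frob_inner (A i) G"
    proof -
      have "frob_inner (A i) (U * transpose_mat U) = frob_inner (A i) Xs"
        using arg_cong[OF trans[OF U(2) Xs_feasible[symmetric]], of "\<lambda>v. v $ i"] i by (simp add: meas_op_def)
      then have "frob_inner (A i) (U * transpose_mat U - Xs) = 0"
        using frob_inner_diff_right[OF Ai, of "U * transpose_mat U" Xs] U Xs_carrier by simp
      then show ?thesis unfolding split using frob_inner_add_right[OF Ai H G] by simp
    qed
    finally show ?thesis .
  qed
  have "transpose_mat W = W"
  proof -
    have "transpose_mat W = transpose_mat (V * transpose_mat V) - mat_diag s d"
      unfolding W_def using V by (intro eq_matI) (auto simp: mat_diag_def)
    then show ?thesis using V by (simp add: W_def transpose_mult_dim)
  qed
  then have "W \<in> sym_mats s" using W by (simp add: sym_mats_def)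
  then have "gam * (frob_norm W)\<^sup>2 \<le> (\<Sum>i<k. (frob_inner (transpose_mat Q * A i * Q) W)\<^sup>2)"
    using nondegenerate by (simp add: dual_nondegenerate_def)
  also have "\<dots> = (\<Sum>i<k. (frob_inner (A i) G)\<^sup>2)" by (simp add: inner)
  also have "\<dots> \<le> (meas_bound k A * frob_norm G)\<^sup>2"
    by (rule sum_frob_inner_sq_le[of _ _ n]) (use A_carrier G in auto)
  finally have "(sqrt gam * frob_norm W)\<^sup>2 \<le> (meas_bound k A * frob_norm G)\<^sup>2"
    using gam_pos by (simp add: power_mult_distrib)
  then have "sqrt gam * frob_norm W \<le> meas_bound k A * frob_norm G"
    by (rule power2_le_imp_le) (simp add: meas_bound_nonneg frob_norm_nonneg)
  also have "\<dots> \<le> meas_bound k A * (2 * R * frob_norm (perp U))"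
    by (intro mult_left_mono Gle meas_bound_nonneg)
  finally show "sqrt gam * frob_norm (transpose_mat Q * U * transpose_mat (transpose_mat Q * U) - mat_diag s d)
      \<le> meas_bound k A * (2 * R * frob_norm (perp U))"
    by (simp add: W_def V_def)
  have "frob_norm (U * transpose_mat U - Xs) \<le> frob_norm W + frob_norm G"
    unfolding split using frob_norm_triangle[OF H G] Hn by simp
  then show "frob_norm (U * transpose_mat U - Xs)
      \<le> frob_norm (transpose_mat Q * U * transpose_mat (transpose_mat Q * U) - mat_diag s d)
        + 2 * R * frob_norm (perp U)"
    using Gle by (simp add: W_def V_def)
qed

text \<open>
  The two components of \<open>U - V * Om\<close> are \<open>perp U\<close> and the rotated difference inside the range; the latter
  is a Procrustes problem with Gram matrix error bounded by \<open>range_error\<close>.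
\<close>
lemma rotation_distance:
  assumes U: "U \<in> carrier_mat n r" "meas_op k A (U * transpose_mat U) = b"
    and R: "frob_norm U \<le> R" and m: "0 < m" "\<forall>i<s. m \<le> d i"
    and small: "meas_bound k A * (2 * R * frob_norm (perp U)) \<le> sqrt gam * (m / 2)"
    and V: "V \<in> carrier_mat n r" "V * transpose_mat V = Xs"
  obtains Om where "Om \<in> carrier_mat r r" "transpose_mat Om * Om = 1\<^sub>m r"
    "frob_norm (U - V * Om) \<le> (1 + 2 * R * meas_bound k A / (sqrt gam * sqrt m)) * frob_norm (perp U)"
proof -
  let ?F = "transpose_mat Q * U" and ?H = "transpose_mat Q * V"
  let ?err = "frob_norm (?F * transpose_mat ?F - mat_diag s d)"
  have F: "?F \<in> carrier_mat s r" and H: "?H \<in> carrier_mat s r" using Q U V by auto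
  have HH: "?H * transpose_mat ?H = mat_diag s d"
  proof -
    have "?H * transpose_mat ?H = transpose_mat Q * (V * transpose_mat V * Q)"
      using Q(1) V(1) by (simp add: transpose_mult_dim mult_assoc_dim del: assoc_mult_mat)
    also have "V * transpose_mat V * Q = Q * (mat_diag s d * (transpose_mat Q * Q))"
      unfolding V(2) Xs_eq using Q(1) by (simp add: mult_assoc_dim del: assoc_mult_mat)
    also have "transpose_mat Q * (Q * (mat_diag s d * (transpose_mat Q * Q))) = mat_diag s d * (transpose_mat Q * Q)"
      by (rule left_inverse_cancel[OF Q(2)]) (use Q in auto)
    finally show ?thesis unfolding Q(2) by simp
  qed
  have err: "sqrt gam * ?err \<le> meas_bound k A * (2 * R * frob_norm (perp U))"
    by (rule range_error(1)[OF U R])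
  then have "sqrt gam * ?err \<le> sqrt gam * (m / 2)" using small by linarith
  then have close: "?err \<le> m / 2" using gam_pos by simp
  obtain Om where Om: "Om \<in> carrier_mat r r" "transpose_mat Om * Om = 1\<^sub>m r"
    and le: "sqrt m * frob_norm (?F - ?H * Om) \<le> ?err"
    by (rule procrustes_perturbation[OF F H HH m close])
  have "U - V * Om = perp U + Q * (?F - ?H * Om)"
  proof -
    have "Q * (?F - ?H * Om) = Q * ?F - Q * (?H * Om)"
      by (rule mult_minus_distrib_mat[of _ n s _ r]) (use F H Om Q in auto)
    also have "Q * (?H * Om) = Q * ?H * Om"
      using Q(1) V(1) Om(1) by (simp add: mult_assoc_dim del: assoc_mult_mat)
    also have "Q * ?H = V" by (rule factor_eq[OF V])
    finally show ?thesis
      unfolding perp_def using Q(1) U(1) V(1) Om(1) by (intro eq_matI) (auto simp del: index_mult_mat(1))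
  qed
  then have "frob_norm (U - V * Om) \<le> frob_norm (perp U) + frob_norm (Q * (?F - ?H * Om))"
    using frob_norm_triangle[of "perp U" n r "Q * (?F - ?H * Om)"] U Q F H Om by simp
  also have "frob_norm (Q * (?F - ?H * Om)) = frob_norm (?F - ?H * Om)"
    by (rule frob_norm_orthonormal_mult[OF Q, of _ r]) (use F H Om in auto)
  also have "frob_norm (?F - ?H * Om) \<le> 2 * R * meas_bound k A / (sqrt gam * sqrt m) * frob_norm (perp U)"
  proof -
    have "sqrt gam * (sqrt m * frob_norm (?F - ?H * Om)) \<le> sqrt gam * ?err"
      using le gam_pos by (intro mult_left_mono) auto
    then have "frob_norm (?F - ?H * Om) * (sqrt gam * sqrt m) \<le> 2 * R * meas_bound k A * frob_norm (perp U)"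
      using err by (simp add: mult_ac)
    then have "frob_norm (?F - ?H * Om) \<le> 2 * R * meas_bound k A * frob_norm (perp U) / (sqrt gam * sqrt m)"
      using gam_pos m(1) by (simp add: pos_le_divide_eq)
    then show ?thesis by simp
  qed
  finally have "frob_norm (U - V * Om) \<le> (1 + 2 * R * meas_bound k A / (sqrt gam * sqrt m)) * frob_norm (perp U)"
    by (simp add: distrib_right)
  then show thesis using that Om by blast
qed

lemma objective_growth:
  assumes U: "U \<in> carrier_mat n r" "meas_op k A (U * transpose_mat U) = b"
  shows "lam * (frob_norm (perp U))\<^sup>2 \<le> frob_inner C (U * transpose_mat U) - frob_inner C Xs"
  using dual_slack_growth[OF U(1)] objective_gap[OF _ U(2)] U(1) by simp

lemma gram_error:
  assumes U: "U \<in> carrier_mat n r" "meas_op k A (U * transpose_mat U) = b" and R: "frob_norm U \<le> R"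
  shows "frob_norm (U * transpose_mat U - Xs) \<le> 2 * R * (meas_bound k A / sqrt gam + 1) * frob_norm (perp U)"
proof -
  let ?err = "frob_norm (transpose_mat Q * U * transpose_mat (transpose_mat Q * U) - mat_diag s d)"
  have "?err \<le> meas_bound k A * (2 * R * frob_norm (perp U)) / sqrt gam"
    using range_error(1)[OF U R] gam_pos by (simp add: pos_le_divide_eq mult.commute)
  then show ?thesis
    using range_error(2)[OF U R] by (simp add: algebra_simps)
qed

text \<open>
  A competitor has no component outside the range, hence no error at all. It need not be near \<open>Xs\<close>, since
  the estimates hold with its own norm as \<open>R\<close>.
\<close>
lemma optimal_unique:
  assumes X: "psd n X" "meas_op k A X = b" "frob_inner C X \<le> frob_inner C Xs"
  shows "X = Xs"
proof -
  obtain U where U: "U \<in> carrier_mat n n" and XU: "X = U * transpose_mat U" by (rule psd_factor[OF X(1)])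
  have feas: "meas_op k A (U * transpose_mat U) = b" using X(2) XU by simp
  have "lam * (frob_norm (perp U))\<^sup>2 \<le> 0"
    using objective_growth[OF U feas] X(3) unfolding XU by linarith
  then have "frob_norm (perp U) = 0" using lam_pos by (simp add: mult_le_0_iff)
  then have "frob_norm (X - Xs) \<le> 0"
    using gram_error[OF U feas order_refl] unfolding XU by simp
  then have "X - Xs = 0\<^sub>m n n"
    using frob_norm_nonneg[of "X - Xs"] Xs_carrier by (intro frob_norm_eq_0D) auto
  then have "(X - Xs) $$ (i, j) = 0" if "i < n" "j < n" for i j using that by simp
  then show ?thesis using Xs_carrier psdD(1)[OF X(1)] by (intro eq_matI) auto
qed

text \<open>
  Factor \<open>X = U U\<^sup>T\<close> with a square \<open>U\<close>, whose squared norm is the trace of \<open>X\<close>, so it is bounded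
  uniformly near \<open>Xs\<close>.
\<close>
lemma quadratic_growth:
  "\<exists>\<alpha>>0. \<forall>X. psd n X \<and> meas_op k A X = b \<and> frob_norm (X - Xs) \<le> 1 \<longrightarrow>
    frob_inner C Xs + \<alpha> / 2 * (frob_norm (X - Xs))\<^sup>2 \<le> frob_inner C X"
proof -
  define R where "R = sqrt (frob_norm (1\<^sub>m n) * (frob_norm Xs + 1))"
  define c where "c = 2 * R * (meas_bound k A / sqrt gam + 1)"
  have R0: "0 \<le> R" by (simp add: R_def frob_norm_nonneg)
  have c0: "0 \<le> c" using R0 gam_pos meas_bound_nonneg by (simp add: c_def)
  \<comment> \<open>Dividing by c + 1 instead of c avoids a zero denominator.\<close>
  have "frob_inner C Xs + 2 * lam / (c + 1)\<^sup>2 / 2 * (frob_norm (X - Xs))\<^sup>2 \<le> frob_inner C X"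
    if X: "psd n X" "meas_op k A X = b" "frob_norm (X - Xs) \<le> 1" for X
  proof -
    obtain U where U: "U \<in> carrier_mat n n" and XU: "X = U * transpose_mat U" by (rule psd_factor[OF X(1)])
    have feas: "meas_op k A (U * transpose_mat U) = b" using X(2) XU by simp
    have Xc: "X \<in> carrier_mat n n" by (rule psdD(1)[OF X(1)])
    have "(frob_norm U)\<^sup>2 \<le> frob_norm (1\<^sub>m n) * frob_norm X"
      using frob_norm_factor[OF U] frob_Cauchy_Schwarz[of "1\<^sub>m n" n n X] Xc unfolding XU[symmetric] by simp
    also have "\<dots> \<le> frob_norm (1\<^sub>m n) * (frob_norm Xs + 1)"
      using frob_norm_le_add_diff[OF Xc Xs_carrier] X(3) by (intro mult_left_mono frob_norm_nonneg) simp
    finally have UR: "frob_norm U \<le> R" unfolding R_def by (rule real_le_rsqrt)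
    have "frob_norm (X - Xs) \<le> c * frob_norm (perp U)"
      using gram_error[OF U feas UR] unfolding XU c_def .
    also have "\<dots> \<le> (c + 1) * frob_norm (perp U)"
      by (intro mult_right_mono frob_norm_nonneg) simp
    finally have "(frob_norm (X - Xs))\<^sup>2 \<le> ((c + 1) * frob_norm (perp U))\<^sup>2"
      by (intro power_mono frob_norm_nonneg)
    then have "lam / (c + 1)\<^sup>2 * (frob_norm (X - Xs))\<^sup>2 \<le> lam / (c + 1)\<^sup>2 * ((c + 1) * frob_norm (perp U))\<^sup>2"
      using lam_pos by (intro mult_left_mono) auto
    also have "\<dots> = lam * (frob_norm (perp U))\<^sup>2" using c0 by (simp add: power_mult_distrib)
    also have "\<dots> \<le> frob_inner C X - frob_inner C Xs"
      using objective_growth[OF U feas] unfolding XU .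
    finally show ?thesis by simp
  qed
  moreover have "0 < 2 * lam / (c + 1)\<^sup>2" using lam_pos c0 by simp
  ultimately show ?thesis by blast
qed

lemma factor_norm:
  assumes "V \<in> carrier_mat n r" "V * transpose_mat V = Xs"
  shows "frob_norm V = sqrt (frob_inner (1\<^sub>m n) Xs)"
  using frob_norm_factor[OF assms(1)] frob_norm_nonneg[of V] unfolding assms(2)
  by (metis real_sqrt_unique)

text \<open>
  The point \<open>U\<close> may be near any factor \<open>V\<close>, while the rotation starts from any factor \<open>W\<close>. With \<open>V = W\<close>
  this is growth near a given factor; with different ones it is growth in a tube around the whole set
  of factors.
\<close>
lemma factored_growth:
  assumes m: "0 < m" "\<forall>i<s. m \<le> d i"
  shows "\<exists>\<delta>>0. \<forall>r U V W. U \<in> carrier_mat n r \<and> meas_op k A (U * transpose_mat U) = b \<and>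
    V \<in> factor_set n r Xs \<and> W \<in> factor_set n r Xs \<and> frob_norm (U - V) < \<delta> \<longrightarrow>
    (\<exists>Om\<in>carrier_mat r r. transpose_mat Om * Om = 1\<^sub>m r \<and>
      growth_const n k A Xs gam lam m / 2 * (frob_norm (U - W * Om))\<^sup>2
        \<le> frob_inner C (U * transpose_mat U) - frob_inner C Xs)"
proof -
  define R where "R = sqrt (frob_inner (1\<^sub>m n) Xs) + 1"
  define K where "K = meas_bound k A"
  define \<kappa> where "\<kappa> = 1 + 2 * R * K / (sqrt gam * sqrt m)"
  \<comment> \<open>Distance 1 keeps the norm of U below R; the other bound keeps the Gram matrix error below m / 2.\<close>
  define \<delta> where "\<delta> = min 1 (sqrt gam * (m / 2) / (2 * R * K + 1))"
  have "0 \<le> frob_inner (1\<^sub>m n) Xs"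
  proof -
    obtain B where B: "B \<in> carrier_mat n n" "Xs = B * transpose_mat B" by (rule psd_factor[OF Xs_psd])
    then show ?thesis using frob_norm_factor[OF B(1)] by (metis zero_le_power2)
  qed
  then have R0: "0 \<le> R" by (simp add: R_def)
  have K0: "0 \<le> K" by (simp add: K_def meas_bound_nonneg)
  have RK: "0 \<le> 2 * R * K" using R0 K0 by simp
  have N: "0 < 2 * R * K + 1" using RK by linarith
  have \<kappa>: "1 \<le> \<kappa>" using RK gam_pos m(1) by (simp add: \<kappa>_def)
  have "0 < sqrt gam * (m / 2) / (2 * R * K + 1)"
    using gam_pos m(1) by (intro divide_pos_pos N mult_pos_pos) auto
  then have \<delta>: "0 < \<delta>" by (simp add: \<delta>_def)
  have "\<exists>Om\<in>carrier_mat r r. transpose_mat Om * Om = 1\<^sub>m r \<and>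
      growth_const n k A Xs gam lam m / 2 * (frob_norm (U - W * Om))\<^sup>2
        \<le> frob_inner C (U * transpose_mat U) - frob_inner C Xs"
    if U: "U \<in> carrier_mat n r" "meas_op k A (U * transpose_mat U) = b"
      and VW: "V \<in> factor_set n r Xs" "W \<in> factor_set n r Xs" and close: "frob_norm (U - V) < \<delta>"
    for r U V W
  proof -
    have V: "V \<in> carrier_mat n r" "V * transpose_mat V = Xs" and W: "W \<in> carrier_mat n r" "W * transpose_mat W = Xs"
      using VW by (auto simp: factor_set_def)
    have UR: "frob_norm U \<le> R"
      using frob_norm_le_add_diff[OF U(1) V(1)] close unfolding factor_norm[OF V] R_def \<delta>_def by simp
    have E: "frob_norm (perp U) \<le> \<delta>" using perp_le_dist[OF U(1) V] close by simp
    have "2 * R * K * frob_norm (perp U) \<le> (2 * R * K + 1) * \<delta>"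
      using RK E by (intro mult_mono) (auto simp: frob_norm_nonneg)
    also have "\<dots> \<le> (2 * R * K + 1) * (sqrt gam * (m / 2) / (2 * R * K + 1))"
      using RK unfolding \<delta>_def by (intro mult_left_mono) auto
    also have "\<dots> = sqrt gam * (m / 2)"
    proof -
      have "x * (z / x) = z" if "0 < x" for x z :: real using that by simp
      from this[OF N] show ?thesis .
    qed
    finally have small: "meas_bound k A * (2 * R * frob_norm (perp U)) \<le> sqrt gam * (m / 2)"
      by (simp add: K_def mult_ac)
    obtain Om where Om: "Om \<in> carrier_mat r r" "transpose_mat Om * Om = 1\<^sub>m r"
      and le: "frob_norm (U - W * Om) \<le> \<kappa> * frob_norm (perp U)"
      unfolding \<kappa>_def K_def by (rule rotation_distance[OF U UR m small W])
    have "lam / \<kappa>\<^sup>2 * (frob_norm (U - W * Om))\<^sup>2 \<le> lam / \<kappa>\<^sup>2 * (\<kappa> * frob_norm (perp U))\<^sup>2"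
      using le lam_pos by (intro mult_left_mono power_mono frob_norm_nonneg) auto
    also have "\<dots> = lam * (frob_norm (perp U))\<^sup>2" using \<kappa> by (simp add: power_mult_distrib)
    also have "\<dots> \<le> frob_inner C (U * transpose_mat U) - frob_inner C Xs"
      by (rule objective_growth[OF U])
    finally show ?thesis
      using Om by (auto simp: growth_const_def \<kappa>_def K_def R_def)
  qed
  then show ?thesis using \<delta> by blast
qed

end

section \<open>Subdifferentials of the penalty and distances to sets\<close>

lemma meas_adj_sym:
  assumes "\<And>i. i < k \<Longrightarrow> A i \<in> sym_mats n"
  shows "meas_adj n k A v \<in> sym_mats n"
proof -
  have "A i $$ (q, p) = A i $$ (p, q)" if "i < k" "p < n" "q < n" for i p q
    using sym_matsD[OF assms[OF that(1)]] that by (metis carrier_matD index_transpose_mat(1))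
  then show ?thesis
    by (auto simp: sym_mats_def meas_adj_def intro!: eq_matI sum.cong)
qed

lemma gram_sym:
  assumes "U \<in> carrier_mat n r"
  shows "U * transpose_mat U \<in> sym_mats n"
  using psd_gram[OF assms] by (simp add: psd_def)

lemma sym_mats_closed:
  assumes "X \<in> sym_mats n" "Y \<in> sym_mats n"
  shows "X + Y \<in> sym_mats n" "X - Y \<in> sym_mats n"
  using assms by (auto simp: sym_mats_def transpose_add transpose_minus)

lemma penalty_Lipschitz:
  assumes A: "\<And>i. i < k \<Longrightarrow> A i \<in> carrier_mat n n" and C: "C \<in> carrier_mat n n"
    and b: "b \<in> carrier_vec k" and mu: "0 \<le> mu"
    and X: "X \<in> carrier_mat n n" and Y: "Y \<in> carrier_mat n n"
  shows "penalty k C A b mu X \<le> penalty k C A b mu Y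
      + (frob_norm C + mu * meas_bound k A) * frob_norm (X - Y)"
proof -
  have "frob_inner C X - frob_inner C Y \<le> frob_norm C * frob_norm (X - Y)"
    using frob_Cauchy_Schwarz[of C n n "X - Y"] frob_inner_diff_right[OF C X Y] C X Y by simp
  moreover have "mu * norm2 (meas_op k A X - b) \<le> mu * (norm2 (meas_op k A Y - b) + meas_bound k A * frob_norm (X - Y))"
  proof (rule mult_left_mono[OF _ mu])
    have "meas_op k A X - b = (meas_op k A Y - b) + meas_op k A (X - Y)"
      using b meas_op_diff[of k A n X Y, OF A X Y]
      by (intro eq_vecI) auto
    then have "norm2 (meas_op k A X - b) \<le> norm2 (meas_op k A Y - b) + norm2 (meas_op k A (X - Y))"
      using norm2_triangle[of "meas_op k A Y - b" k "meas_op k A (X - Y)"] b by simp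
    also have "norm2 (meas_op k A (X - Y)) \<le> meas_bound k A * frob_norm (X - Y)"
      by (rule meas_op_norm_le[of _ _ n]) (use A X Y in auto)
    finally show "norm2 (meas_op k A X - b) \<le> norm2 (meas_op k A Y - b) + meas_bound k A * frob_norm (X - Y)"
      by simp
  qed
  ultimately show ?thesis by (simp add: penalty_def algebra_simps)
qed

text \<open>
  Test the subgradient inequality at \<open>X + G\<close>: a subgradient is no larger than a Lipschitz constant.
\<close>
lemma convex_subdiff_norm_le:
  assumes lip: "\<And>Y. Y \<in> carrier_mat n n \<Longrightarrow> h Y \<le> h X + L * frob_norm (Y - X)"
    and L: "0 \<le> L" and X: "X \<in> sym_mats n" and G: "G \<in> convex_subdiff n h X"
  shows "frob_norm G \<le> L"
proof -
  have Gs: "G \<in> sym_mats n" using G by (simp add: convex_subdiff_def)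
  note Xc = sym_matsD(1)[OF X] and Gc = sym_matsD(1)[OF Gs]
  have XG: "(X + G) - X = G" using Xc Gc by (intro eq_matI) auto
  have "h X + frob_inner G ((X + G) - X) \<le> h (X + G)"
    using G sym_mats_closed(1)[OF X Gs] by (auto simp: convex_subdiff_def)
  also have "\<dots> \<le> h X + L * frob_norm ((X + G) - X)" using Xc Gc by (intro lip) simp
  finally have "frob_norm G * frob_norm G \<le> L * frob_norm G"
    unfolding XG by (simp add: frob_norm_sq[symmetric] power2_eq_square)
  then show ?thesis
    using L frob_norm_nonneg[of G] by (cases "frob_norm G = 0") (auto simp: mult_le_cancel_right)
qed

text \<open>
  The distance to an empty set would be an unspecified number, so the error bounds need this.
\<close>
lemma convex_subdiff_penalty_nonempty:
  assumes A: "\<And>i. i < k \<Longrightarrow> A i \<in> sym_mats n" and C: "C \<in> sym_mats n"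
    and b: "b \<in> carrier_vec k" and mu: "0 \<le> mu" and X: "X \<in> sym_mats n"
  shows "convex_subdiff n (penalty k C A b mu) X \<noteq> {}"
proof -
  define w where "w = meas_op k A X - b"
  \<comment> \<open>A subgradient of the norm at w. At w = 0 the quotient is 0, which gives the subgradient 0.\<close>
  define g where "g = (1 / norm2 w) \<cdot>\<^sub>v w"
  define H where "H = meas_adj n k A (mu \<cdot>\<^sub>v g)"
  have w: "w \<in> carrier_vec k" using b by (simp add: w_def)
  have g: "g \<in> carrier_vec k" using w by (simp add: g_def)
  have Ac: "\<And>i. i < k \<Longrightarrow> A i \<in> carrier_mat n n" using A sym_matsD by blast
  note Cc = sym_matsD(1)[OF C] and Xc = sym_matsD(1)[OF X]
  have H: "H \<in> sym_mats n" unfolding H_def by (rule meas_adj_sym[OF A])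
  note Hc = sym_matsD(1)[OF H]
  have "penalty k C A b mu X + frob_inner (C + H) (Y - X) \<le> penalty k C A b mu Y"
    if Y: "Y \<in> sym_mats n" for Y
  proof -
    note Yc = sym_matsD(1)[OF Y]
    define v where "v = meas_op k A Y - b"
    have v: "v \<in> carrier_vec k" using b by (simp add: v_def)
    have YX: "Y - X \<in> carrier_mat n n" using Xc by simp
    have "meas_op k A (Y - X) = v - w"
      using b meas_op_diff[of k A n Y X, OF Ac Yc Xc] unfolding v_def w_def by (intro eq_vecI) auto
    then have "frob_inner H (Y - X) = mu * (g \<bullet> (v - w))"
      using frob_inner_meas_adj[of k A n "Y - X" "mu \<cdot>\<^sub>v g", OF Ac YX] g v w by (simp add: H_def)
    moreover have "frob_inner (C + H) (Y - X) = frob_inner C Y - frob_inner C X + frob_inner H (Y - X)"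
      unfolding frob_inner_add_left[OF Cc Hc] frob_inner_diff_right[OF Cc Yc Xc] by simp
    moreover have "norm2 w + g \<bullet> (v - w) \<le> norm2 v"
    proof (cases "norm2 w = 0")
      case True
      then have "g \<bullet> (v - w) = 0" using v w by (simp add: g_def)
      then show ?thesis using True norm2_nonneg[of v] by simp
    next
      case False
      then have w0: "0 < norm2 w" using norm2_nonneg[of w] by simp
      have "g \<bullet> (v - w) = (w \<bullet> v - (norm2 w)\<^sup>2) / norm2 w"
        using v w by (simp add: g_def scalar_prod_minus_distrib[of _ k] norm2_sq diff_divide_distrib)
      also have "\<dots> = w \<bullet> v / norm2 w - norm2 w"
        using w0 by (simp add: diff_divide_distrib power2_eq_square)
      also have "w \<bullet> v / norm2 w \<le> norm2 v"
        using norm2_Cauchy_Schwarz[OF w v] w0 by (simp add: pos_divide_le_eq mult.commute)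
      finally show ?thesis by simp
    qed
    then have "mu * (norm2 w + g \<bullet> (v - w)) \<le> mu * norm2 v" using mu by (rule mult_left_mono)
    ultimately show ?thesis by (simp add: penalty_def v_def[symmetric] w_def[symmetric] distrib_left)
  qed
  then have "C + H \<in> convex_subdiff n (penalty k C A b mu) X"
    using sym_mats_closed(1)[OF C H] by (simp add: convex_subdiff_def)
  then show ?thesis by blast
qed

text \<open>
  The matrix of this map is the Gram matrix of the \<open>A i\<close>, which is invertible if they are independent.
\<close>
lemma meas_op_meas_adj_onto:
  assumes A: "\<And>i. i < k \<Longrightarrow> A i \<in> carrier_mat n n"
    and indep: "\<And>g. g \<in> carrier_vec k \<Longrightarrow> meas_adj n k A g = 0\<^sub>m n n \<Longrightarrow> g = 0\<^sub>v k"
    and c: "c \<in> carrier_vec k"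
  obtains g where "g \<in> carrier_vec k" "meas_op k A (meas_adj n k A g) = c"
proof -
  define \<Gamma> where "\<Gamma> = mat k k (\<lambda>(i, j). frob_inner (A j) (A i))"
  have \<Gamma>: "\<Gamma> \<in> carrier_mat k k" by (simp add: \<Gamma>_def)
  have \<Gamma>g: "\<Gamma> *\<^sub>v g = meas_op k A (meas_adj n k A g)" if g: "g \<in> carrier_vec k" for g
  proof (rule eq_vecI)
    fix i assume "i < dim_vec (meas_op k A (meas_adj n k A g))"
    then have i: "i < k" by (simp add: meas_op_def)
    have "(meas_op k A (meas_adj n k A g)) $ i = frob_inner (meas_adj n k A g) (A i)"
      using i frob_inner_commute[OF A[OF i] meas_adj_carrier] by (simp add: meas_op_def)
    also have "\<dots> = g \<bullet> meas_op k A (A i)" by (rule frob_inner_meas_adj[OF A A[OF i]])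
    also have "\<dots> = (\<Gamma> *\<^sub>v g) $ i"
      using i g by (simp add: \<Gamma>_def meas_op_def scalar_prod_def mult.commute)
    finally show "(\<Gamma> *\<^sub>v g) $ i = (meas_op k A (meas_adj n k A g)) $ i" ..
  qed (simp add: \<Gamma>_def meas_op_def)
  have "det \<Gamma> \<noteq> 0"
  proof
    assume "det \<Gamma> = 0"
    then obtain g where g: "g \<in> carrier_vec k" "g \<noteq> 0\<^sub>v k" "\<Gamma> *\<^sub>v g = 0\<^sub>v k"
      using det_0_iff_vec_prod_zero_field[OF \<Gamma>] by blast
    have "frob_inner (meas_adj n k A g) (meas_adj n k A g) = g \<bullet> (\<Gamma> *\<^sub>v g)"
      unfolding \<Gamma>g[OF g(1)] by (rule frob_inner_meas_adj[OF A meas_adj_carrier])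
    then have "frob_norm (meas_adj n k A g) = 0"
      unfolding g(3) using g(1) by (simp add: frob_norm_def)
    then have "meas_adj n k A g = 0\<^sub>m n n" by (rule frob_norm_eq_0D[OF meas_adj_carrier])
    then show False using indep g by blast
  qed
  then obtain \<Gamma>i where \<Gamma>i: "\<Gamma>i \<in> carrier_mat k k" "\<Gamma> * \<Gamma>i = 1\<^sub>m k"
    by (rule invertible_mat_obtain_inverse[OF \<Gamma>])
  have "\<Gamma> *\<^sub>v (\<Gamma>i *\<^sub>v c) = c"
    using assoc_mult_mat_vec[OF \<Gamma> \<Gamma>i(1) c] \<Gamma>i(2) c by simp
  moreover have "\<Gamma>i *\<^sub>v c \<in> carrier_vec k" using \<Gamma>i(1) c by simp
  ultimately show thesis using that \<Gamma>g by metis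
qed

text \<open>
  Along symmetric \<open>H\<close> with zero measurements the penalty term is constant, so \<open>G - C\<close> is orthogonal to all of
  them and lies in the span of the \<open>A i\<close>. At an infeasible \<open>X\<close>, moving straight to feasibility removes
  the whole penalty, so \<open>v\<close> must be at least as long as the slope \<open>mu\<close>.
\<close>
lemma convex_subdiff_penalty_form:
  assumes A: "\<And>i. i < k \<Longrightarrow> A i \<in> sym_mats n" and C: "C \<in> sym_mats n"
    and b: "b \<in> carrier_vec k" and mu: "0 \<le> mu" and X: "X \<in> sym_mats n"
    and indep: "\<And>g. g \<in> carrier_vec k \<Longrightarrow> meas_adj n k A g = 0\<^sub>m n n \<Longrightarrow> g = 0\<^sub>v k"
    and G: "G \<in> convex_subdiff n (penalty k C A b mu) X"
  obtains v where "v \<in> carrier_vec k" "G = C + meas_adj n k A v"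
    "meas_op k A X \<noteq> b \<longrightarrow> mu \<le> norm2 v"
proof -
  have Ac: "\<And>i. i < k \<Longrightarrow> A i \<in> carrier_mat n n" using A sym_matsD by blast
  have Gs: "G \<in> sym_mats n" using G by (simp add: convex_subdiff_def)
  note Cc = sym_matsD(1)[OF C] and Xc = sym_matsD(1)[OF X] and Gc = sym_matsD(1)[OF Gs]
  have sub: "frob_inner (G - C) H \<le> mu * (norm2 (meas_op k A X - b + meas_op k A H) - norm2 (meas_op k A X - b))"
    if H: "H \<in> sym_mats n" for H
  proof -
    note Hc = sym_matsD(1)[OF H]
    have XH: "X + H - X = H" using Xc Hc by (intro eq_matI) auto
    have "penalty k C A b mu X + frob_inner G (X + H - X) \<le> penalty k C A b mu (X + H)"
      using G sym_mats_closed(1)[OF X H] by (auto simp: convex_subdiff_def)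
    moreover have "meas_op k A (X + H) - b = meas_op k A X - b + meas_op k A H"
      using b Ac Xc Hc by (intro eq_vecI) (auto simp: meas_op_def frob_inner_add_right[of _ n n])
    ultimately show ?thesis
      unfolding penalty_def XH frob_inner_add_right[OF Cc Xc Hc] frob_inner_diff_left[OF Gc Cc]
      by (simp add: right_diff_distrib)
  qed
  \<comment> \<open>The orthogonal projection of G - C to the span; the residual H then has zero measurements.\<close>
  obtain v where v: "v \<in> carrier_vec k" "meas_op k A (meas_adj n k A v) = meas_op k A (G - C)"
    by (rule meas_op_meas_adj_onto[OF Ac indep meas_op_carrier])
  define H where "H = G - C - meas_adj n k A v"
  have H: "H \<in> sym_mats n" unfolding H_def by (intro sym_mats_closed Gs C meas_adj_sym A)
  note Hc = sym_matsD(1)[OF H]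
  have GC: "G - C \<in> carrier_mat n n" using Cc by simp
  have AH: "meas_op k A H = 0\<^sub>v k"
    using meas_op_diff[of k A n "G - C" "meas_adj n k A v", OF Ac GC meas_adj_carrier]
    unfolding H_def v(2) by (intro eq_vecI) auto
  have "frob_inner H H = frob_inner (G - C) H - v \<bullet> meas_op k A H"
    using frob_inner_diff_left[OF GC meas_adj_carrier[of n k A v], of H] frob_inner_meas_adj[of k A n H v, OF Ac Hc]
    by (simp add: H_def)
  also have "\<dots> = frob_inner (G - C) H" unfolding AH using v(1) by simp
  also have "\<dots> \<le> 0" using sub[OF H] b meas_op_carrier[of k A X] unfolding AH by simp
  finally have "frob_norm H = 0" using frob_inner_self_nonneg[of H] by (simp add: frob_norm_def)
  then have H0: "H = 0\<^sub>m n n" by (rule frob_norm_eq_0D[OF Hc])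
  have "G = C + meas_adj n k A v"
  proof (rule eq_matI)
    fix i j assume "i < dim_row (C + meas_adj n k A v)" "j < dim_col (C + meas_adj n k A v)"
    then have ij: "i < n" "j < n" by (auto simp: meas_adj_def)
    have "H $$ (i, j) = 0" unfolding H0 using ij by simp
    then show "G $$ (i, j) = (C + meas_adj n k A v) $$ (i, j)"
      using ij Gc Cc by (simp add: H_def)
  qed (use Gc in \<open>auto simp: meas_adj_def\<close>)
  moreover have "mu \<le> norm2 v" if ne: "meas_op k A X \<noteq> b"
  proof -
    define w where "w = meas_op k A X - b"
    have w: "w \<in> carrier_vec k" using b by (simp add: w_def)
    have "w \<noteq> 0\<^sub>v k"
    proof
      assume w0: "w = 0\<^sub>v k"
      have "meas_op k A X = b"
      proof (rule eq_vecI)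
        fix i assume "i < dim_vec b"
        then have i: "i < k" using b by simp
        then have "w $ i = 0" by (simp add: w0)
        then show "meas_op k A X $ i = b $ i" using i b by (simp add: w_def)
      qed (use b in \<open>simp add: meas_op_def\<close>)
      then show False using ne by simp
    qed
    then have "w \<bullet> w \<noteq> 0" using scalar_prod_self_eq_0D[OF w] by blast
    then have w0: "0 < norm2 w" using norm2_sq[of w] norm2_nonneg[of w] by (cases "norm2 w = 0") auto
    have mw: "- w \<in> carrier_vec k" using w by simp
    \<comment> \<open>A direction that restores feasibility.\<close>
    obtain g where g: "g \<in> carrier_vec k" "meas_op k A (meas_adj n k A g) = - w"
      by (rule meas_op_meas_adj_onto[OF Ac indep mw])
    have "G - C = meas_adj n k A v"
      unfolding \<open>G = C + meas_adj n k A v\<close> using Cc by (intro eq_matI) auto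
    then have "frob_inner (G - C) (meas_adj n k A g) = v \<bullet> (- w)"
      using frob_inner_meas_adj[of k A n "meas_adj n k A g" v, OF Ac meas_adj_carrier] g(2) by simp
    moreover have "w + - w = 0\<^sub>v k" using w by (intro eq_vecI) auto
    ultimately have "v \<bullet> (- w) \<le> - (mu * norm2 w)"
      using sub[OF meas_adj_sym[of k A n g, OF A]] unfolding w_def[symmetric] g(2) by (simp add: norm2_def)
    then have "mu * norm2 w \<le> v \<bullet> w" using v(1) w by simp
    also have "\<dots> \<le> norm2 v * norm2 w" using norm2_Cauchy_Schwarz[OF v(1) w] by simp
    finally show ?thesis using w0 by simp
  qed
  ultimately show thesis using that v(1) by blast
qed

lemma frob_dist_le:
  assumes "V \<in> S"
  shows "frob_dist U S \<le> frob_norm (U - V)"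
  unfolding frob_dist_def
  by (rule cINF_lower[OF _ assms]) (auto intro!: bdd_belowI2[of _ 0] frob_norm_nonneg)

lemma frob_dist_nonneg:
  assumes "S \<noteq> {}"
  shows "0 \<le> frob_dist U S"
  unfolding frob_dist_def using assms by (rule cINF_greatest) (rule frob_norm_nonneg)

lemma frob_dist_less_obtain:
  assumes "S \<noteq> {}" "frob_dist U S < e"
  obtains V where "V \<in> S" "frob_norm (U - V) < e"
proof -
  have "\<exists>x\<in>(\<lambda>V. frob_norm (U - V)) ` S. x < e"
    using assms unfolding frob_dist_def by (intro cInf_lessD) auto
  then show thesis using that by blast
qed

text \<open>
  Inequalities for all elements of a set pass to the distance, also if the factor \<open>c\<close> vanishes.
\<close>
lemma le_mult_frob_dist:
  assumes "S \<noteq> {}" "0 \<le> c" "\<And>V. V \<in> S \<Longrightarrow> a \<le> c * frob_norm (U - V)"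
  shows "a \<le> c * frob_dist U S"
proof (cases "c = 0")
  case True
  then show ?thesis using assms by fastforce
next
  case False
  then have c: "0 < c" using assms(2) by simp
  have "a / c \<le> frob_dist U S"
    unfolding frob_dist_def using assms(1)
  proof (rule cINF_greatest)
    fix V assume "V \<in> S"
    then show "a / c \<le> frob_norm (U - V)" using assms(3)[of V] c by (simp add: pos_divide_le_eq mult.commute)
  qed
  then show ?thesis using c by (simp add: pos_divide_le_eq mult.commute)
qed

section \<open>Error bounds for the factored penalty\<close>

lemma meas_adj_diff:
  assumes "v \<in> carrier_vec k" "w \<in> carrier_vec k"
  shows "meas_adj n k A (v - w) = meas_adj n k A v - meas_adj n k A w"
  using assms by (intro eq_matI) (auto simp: meas_adj_def left_diff_distrib sum_subtractf)

text \<open>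
  Second-order expansion of the quadratic map \<open>U \<mapsto> \<langle>G, U U\<^sup>T\<rangle>\<close>, which is exact.
\<close>
lemma sym_gram_diff_inner:
  assumes G: "G \<in> sym_mats n" and U: "U \<in> carrier_mat n r" and V: "V \<in> carrier_mat n r"
  shows "frob_inner G (U * transpose_mat U) - frob_inner G (V * transpose_mat V)
    = 2 * frob_inner (G * U) (U - V) - frob_inner (G * (U - V)) (U - V)"
proof -
  note Gc = sym_matsD(1)[OF G]
  have GU: "G * U \<in> carrier_mat n r" and GV: "G * V \<in> carrier_mat n r" using Gc U V by auto
  have "frob_inner (G * V) U = frob_inner V (G * U)"
    using frob_inner_mult_left[OF Gc V U] sym_matsD(2)[OF G] by simp
  also have "\<dots> = frob_inner (G * U) V" by (rule frob_inner_commute[OF V GU])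
  finally have sym: "frob_inner (G * V) U = frob_inner (G * U) V" .
  have "G * (U - V) = G * U - G * V" by (rule mult_minus_distrib_mat[OF Gc U V])
  then have "frob_inner (G * (U - V)) (U - V) = frob_inner (G * U) (U - V) - frob_inner (G * V) (U - V)"
    using frob_inner_diff_left[OF GU GV] by simp
  moreover have "frob_inner (G * U) (U - V) = frob_inner (G * U) U - frob_inner (G * U) V"
    by (rule frob_inner_diff_right[OF GU U V])
  moreover have "frob_inner (G * V) (U - V) = frob_inner (G * V) U - frob_inner (G * V) V"
    by (rule frob_inner_diff_right[OF GV U V])
  ultimately show ?thesis
    unfolding frob_inner_gram[OF Gc U] frob_inner_gram[OF Gc V] using sym by simp
qed

lemma factor_set_rotate:
  assumes V: "V \<in> factor_set n r X" and Om: "Om \<in> carrier_mat r r" "transpose_mat Om * Om = 1\<^sub>m r"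
  shows "V * Om \<in> factor_set n r X"
proof -
  have Vc: "V \<in> carrier_mat n r" and VX: "V * transpose_mat V = X" using V by (auto simp: factor_set_def)
  have "V * Om * transpose_mat (V * Om) = V * (Om * (transpose_mat Om * transpose_mat V))"
    using Vc Om(1) by (simp add: transpose_mult_dim mult_assoc_dim del: assoc_mult_mat)
  also have "Om * (transpose_mat Om * transpose_mat V) = transpose_mat V"
    by (rule left_inverse_cancel[OF orthogonal_transpose[OF Om]]) (use Vc Om(1) in auto)
  finally show ?thesis using Vc Om(1) VX by (simp add: factor_set_def)
qed

context sdp_certificate
begin

text \<open>
  The case of a feasible \<open>U\<close>. Here \<open>D\<close> stands for the distance of \<open>U\<close> to the factors of \<open>Xs\<close>, and \<open>V\<close> is a
  factor that attains it up to the factor \<open>2\<close>. Put \<open>\<eta> = v - y\<close>, so that \<open>G = Z + H\<close> with \<open>H\<close> the adjoint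
  image of \<open>\<eta>\<close>. If \<open>\<parallel>G U\<parallel> < D\<close>, then \<open>H U = G U - Z (U - V)\<close> is of order \<open>D\<close>, hence so are \<open>\<eta>\<close> and
  \<open>H\<close>. For small \<open>D\<close> the term \<open>- \<langle>G (U - V), U - V\<rangle> \<le> - \<langle>H (U - V), U - V\<rangle>\<close> is at most half of
  the quadratic growth, and the other half is at most of order \<open>\<parallel>G U\<parallel> D\<close>.
\<close>
lemma gradient_error_bound:
  assumes U: "U \<in> carrier_mat n r" "meas_op k A (U * transpose_mat U) = b"
    and v: "v \<in> carrier_vec k"
    and reg: "\<And>g. g \<in> carrier_vec k \<Longrightarrow> \<gamma> * norm2 g \<le> frob_norm (meas_adj n k A g * U)" "0 < \<gamma>"
    and growth: "a / 2 * D\<^sup>2 \<le> frob_inner C (U * transpose_mat U) - frob_inner C Xs" "0 < a"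
    and V: "V \<in> carrier_mat n r" "V * transpose_mat V = Xs" "frob_norm (U - V) \<le> 2 * D"
    and D: "0 < D" "meas_bound k A * (4 * ((1 + 2 * frob_norm Z) * D)) \<le> \<gamma> * (a / 4)"
  shows "D \<le> (1 + 16 / a) * frob_norm ((C + meas_adj n k A v) * U)"
    and "frob_inner C (U * transpose_mat U) - frob_inner C Xs
      \<le> 4 * frob_norm ((C + meas_adj n k A v) * U) * D + frob_norm (C + meas_adj n k A v) * (4 * D\<^sup>2)"
proof -
  define G where "G = C + meas_adj n k A v"
  define \<eta> where "\<eta> = v - y"
  define E where "E = U - V"
  define H where "H = meas_adj n k A \<eta>"
  have E: "E \<in> carrier_mat n r" using V by (simp add: E_def)
  have Gs: "G \<in> sym_mats n" unfolding G_def by (intro sym_mats_closed C_sym meas_adj_sym A_sym)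
  note Gc = sym_matsD(1)[OF Gs]
  have Hc: "H \<in> carrier_mat n n" by (simp add: H_def)
  have \<eta>: "\<eta> \<in> carrier_vec k" using v y by (simp add: \<eta>_def)
  have G_eq: "G = Z + H"
    unfolding G_def Z_eq H_def \<eta>_def meas_adj_diff[OF v y] using C_carrier by (intro eq_matI) auto
  have E2: "frob_norm E \<le> 2 * D" using V(3) by (simp add: E_def)
  have X: "U * transpose_mat U \<in> carrier_mat n n" using U by simp
  have GX: "frob_inner G W = frob_inner C W + v \<bullet> meas_op k A W" if "W \<in> carrier_mat n n" for W
    unfolding G_def using frob_inner_add_left[OF C_carrier meas_adj_carrier]
      frob_inner_meas_adj[of k A n W v, OF A_carrier that] by simp
  have gap_eq: "frob_inner C (U * transpose_mat U) - frob_inner C Xs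
      = 2 * frob_inner (G * U) E - frob_inner (G * E) E"
    using sym_gram_diff_inner[OF Gs U(1) V(1)] GX[OF X] GX[OF Xs_carrier] U(2) Xs_feasible
    unfolding E_def V(2) by simp
  have GU: "G * U \<in> carrier_mat n r" and GE: "G * E \<in> carrier_mat n r" using Gc U E by auto
  have GUE: "frob_inner (G * U) E \<le> frob_norm (G * U) * (2 * D)"
  proof -
    have "frob_inner (G * U) E \<le> frob_norm (G * U) * frob_norm E"
      using frob_Cauchy_Schwarz[OF GU E] by simp
    also have "\<dots> \<le> frob_norm (G * U) * (2 * D)" by (intro mult_left_mono E2 frob_norm_nonneg)
    finally show ?thesis .
  qed
  have quad: "\<bar>frob_inner (M * E) E\<bar> \<le> frob_norm M * (4 * D\<^sup>2)" if M: "M \<in> carrier_mat n n" for M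
  proof -
    have "\<bar>frob_inner (M * E) E\<bar> \<le> frob_norm (M * E) * frob_norm E"
      by (rule frob_Cauchy_Schwarz[of _ n r]) (use M E in auto)
    also have "\<dots> \<le> (frob_norm M * frob_norm E) * frob_norm E"
      by (intro mult_right_mono frob_norm_mult[OF M E] frob_norm_nonneg)
    also have "\<dots> = frob_norm M * (frob_norm E)\<^sup>2" by (simp add: power2_eq_square)
    also have "\<dots> \<le> frob_norm M * (2 * D)\<^sup>2"
      by (intro mult_left_mono power_mono E2 frob_norm_nonneg)
    finally show ?thesis by (simp add: power_mult_distrib)
  qed
  show "frob_inner C (U * transpose_mat U) - frob_inner C Xs
      \<le> 4 * frob_norm ((C + meas_adj n k A v) * U) * D + frob_norm (C + meas_adj n k A v) * (4 * D\<^sup>2)"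
    using gap_eq GUE quad[OF Gc] unfolding G_def[symmetric] by linarith
  have "D \<le> (1 + 16 / a) * frob_norm (G * U)"
  proof (cases "D \<le> frob_norm (G * U)")
    case True
    have "1 * frob_norm (G * U) \<le> (1 + 16 / a) * frob_norm (G * U)"
      using growth(2) by (intro mult_right_mono frob_norm_nonneg) simp
    then show ?thesis using True by simp
  next
    case False
    have "Z * V = 0\<^sub>m n r"
      by (rule psd_quadratic_form_eq_0D[OF Z V(1)])
        (use frob_inner_gram[OF Z_carrier V(1)] V(2) complementary in simp)
    then have "Z * E = Z * U"
      unfolding E_def mult_minus_distrib_mat[OF Z_carrier U(1) V(1)]
      using Z_carrier U(1) by (intro eq_matI) auto
    moreover have "G * U = Z * U + H * U"
      unfolding G_eq by (rule add_mult_distrib_mat[OF Z_carrier Hc U(1)])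
    ultimately have "H * U = G * U - Z * E"
      using Z_carrier Hc U(1) by (intro eq_matI) (auto simp del: index_mult_mat(1))
    then have "frob_norm (H * U) \<le> frob_norm (G * U) + frob_norm (Z * E)"
      using frob_norm_diff_triangle[OF GU, of "Z * E"] Z_carrier E by simp
    also have "frob_norm (Z * E) \<le> frob_norm Z * (2 * D)"
      by (rule order_trans[OF frob_norm_mult[OF Z_carrier E]]) (intro mult_left_mono E2 frob_norm_nonneg)
    finally have "\<gamma> * norm2 \<eta> \<le> (1 + 2 * frob_norm Z) * D"
      using reg(1)[OF \<eta>] False unfolding H_def by (simp add: algebra_simps)
    then have "meas_bound k A * (4 * (\<gamma> * norm2 \<eta>)) \<le> meas_bound k A * (4 * ((1 + 2 * frob_norm Z) * D))"
      by (intro mult_left_mono meas_bound_nonneg) auto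
    also have "\<dots> \<le> \<gamma> * (a / 4)" by (rule D(2))
    finally have "\<gamma> * (4 * (meas_bound k A * norm2 \<eta>)) \<le> \<gamma> * (a / 4)" by (simp add: mult_ac)
    then have small: "4 * (meas_bound k A * norm2 \<eta>) \<le> a / 4" using reg(2) by simp
    have HK: "frob_norm H \<le> meas_bound k A * norm2 \<eta>"
      unfolding H_def by (rule meas_adj_norm_le[OF A_carrier \<eta>])
    have "frob_inner (G * E) E = frob_inner (Z * E) E + frob_inner (H * E) E"
      unfolding G_eq add_mult_distrib_mat[OF Z_carrier Hc E]
      by (rule frob_inner_add_left[of _ n r]) (use Z_carrier Hc E in auto)
    moreover have "0 \<le> frob_inner (Z * E) E" by (rule psd_quadratic_form_nonneg[OF Z E])
    moreover have "- (a / 4 * D\<^sup>2) \<le> frob_inner (H * E) E"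
    proof -
      have "frob_norm H * (4 * D\<^sup>2) \<le> (a / 16) * (4 * D\<^sup>2)"
        using small HK by (intro mult_right_mono) auto
      then show ?thesis using quad[OF Hc] by simp
    qed
    ultimately have "a / 2 * D\<^sup>2 \<le> 4 * frob_norm (G * U) * D + a / 4 * D\<^sup>2"
      using growth(1) gap_eq GUE by linarith
    then have "a / 4 * D\<^sup>2 \<le> 4 * frob_norm (G * U) * D" by linarith
    then have "(a / 4 * D) * D \<le> (4 * frob_norm (G * U)) * D" by (simp add: power2_eq_square mult.assoc)
    then have "a / 4 * D \<le> 4 * frob_norm (G * U)" using D(1) by (rule mult_right_le_imp_le)
    then have "D \<le> 16 / a * frob_norm (G * U)" using growth(2) by (simp add: field_simps)
    also have "\<dots> \<le> (1 + 16 / a) * frob_norm (G * U)"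
      by (intro mult_right_mono frob_norm_nonneg) simp
    finally show ?thesis .
  qed
  then show "D \<le> (1 + 16 / a) * frob_norm ((C + meas_adj n k A v) * U)" by (simp add: G_def)
qed

text \<open>
  The threshold for the penalty parameter is chosen such that \<open>\<parallel>G U\<parallel> \<ge> 1\<close> at every infeasible point of the
  tube. There the two bounds hold because the distance is small and the penalty is Lipschitz; at feasible
  points they come from \<open>gradient_error_bound\<close>.
\<close>
lemma penalty_error_bounds:
  assumes m: "0 < m" "\<forall>i<s. m \<le> d i"
    and Us: "Us \<in> factor_set n r Xs"
    and reg: "0 < \<gamma>" "0 < \<epsilon>" "\<And>U g. U \<in> carrier_mat n r \<Longrightarrow> frob_dist U (factor_set n r Xs) < \<epsilon> \<Longrightarrow>
      g \<in> carrier_vec k \<Longrightarrow> \<gamma> * norm2 g \<le> frob_norm (meas_adj n k A g * U)"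
  shows "\<forall>\<^sub>F mu in at_top. \<exists>l>0. \<exists>l'>0. \<exists>\<epsilon>>0. \<forall>U \<in> carrier_mat n r.
      frob_dist U (factor_set n r Xs) < \<epsilon> \<longrightarrow>
      factored_penalty k C A b mu U - frob_inner C Xs
        \<le> l * frob_dist (0\<^sub>m n r) (factored_subdiff n k C A b mu U) * frob_dist U (factor_set n r Xs) \<and>
      frob_dist U (factor_set n r Xs) \<le> l' * frob_dist (0\<^sub>m n r) (factored_subdiff n k C A b mu U)"
proof -
  let ?S = "factor_set n r Xs"
  define R where "R = sqrt (frob_inner (1\<^sub>m n) Xs) + 1"
  define a where "a = growth_const n k A Xs gam lam m"
  define mu0 where "mu0 = (frob_norm C * R + 1) / \<gamma>"
  have S: "?S \<noteq> {}" using Us by blast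
  have SD: "V \<in> carrier_mat n r" "V * transpose_mat V = Xs" if "V \<in> ?S" for V
    using that by (auto simp: factor_set_def)
  have VR: "frob_norm V = R - 1" if "V \<in> ?S" for V
    using factor_norm[OF SD[OF that]] by (simp add: R_def)
  have R: "1 \<le> R" using VR[OF Us] frob_norm_nonneg[of Us] by simp
  have b: "b \<in> carrier_vec k" unfolding Xs_feasible[symmetric] by (rule meas_op_carrier)
  have a: "0 < a" unfolding a_def by (rule growth_const_pos[OF Xs_psd gam_pos lam_pos m(1)])
  have indep: "g = 0\<^sub>v k" if g: "g \<in> carrier_vec k" "meas_adj n k A g = 0\<^sub>m n n" for g
  proof -
    have Us_c: "Us \<in> carrier_mat n r" using SD[OF Us] by simp
    have "frob_dist Us ?S \<le> frob_norm (Us - Us)" by (rule frob_dist_le[OF Us])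
    also have "Us - Us = 0\<^sub>m n r" using Us_c by (intro eq_matI) auto
    finally have "frob_dist Us ?S < \<epsilon>" using reg(2) by (simp add: frob_norm_def frob_inner_def)
    from reg(3)[OF Us_c this g(1)] have "\<gamma> * norm2 g \<le> 0"
      unfolding g(2) using Us_c by (simp add: frob_norm_def frob_inner_def)
    then have "norm2 g = 0" using reg(1) norm2_nonneg[of g] by (simp add: mult_le_0_iff)
    then show ?thesis using scalar_prod_self_eq_0D[OF g(1)] norm2_sq[of g] by simp
  qed
  obtain \<delta> where \<delta>: "0 < \<delta>" and growth: "\<And>U V W. U \<in> carrier_mat n r \<Longrightarrow>
    meas_op k A (U * transpose_mat U) = b \<Longrightarrow> V \<in> ?S \<Longrightarrow> W \<in> ?S \<Longrightarrow> frob_norm (U - V) < \<delta> \<Longrightarrow>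
    \<exists>Om\<in>carrier_mat r r. transpose_mat Om * Om = 1\<^sub>m r \<and>
      a / 2 * (frob_norm (U - W * Om))\<^sup>2 \<le> frob_inner C (U * transpose_mat U) - frob_inner C Xs"
    using factored_growth[OF m] unfolding a_def by blast
  \<comment> \<open>The radius is at most 1, keeps the constraint qualification and growth available, and makes the smallness condition of the gradient error bound hold; N + 1 is positive even if N vanishes.\<close>
  define N where "N = meas_bound k A * (4 * (1 + 2 * frob_norm Z))"
  have N0: "0 \<le> N" by (simp add: N_def meas_bound_nonneg frob_norm_nonneg)
  define \<epsilon>' where "\<epsilon>' = Min {1, \<epsilon>, \<delta>, \<gamma> * (a / 4) / (N + 1)}"
  have \<epsilon>': "0 < \<epsilon>'" "\<epsilon>' \<le> 1" "\<epsilon>' \<le> \<epsilon>" "\<epsilon>' \<le> \<delta>" "\<epsilon>' \<le> \<gamma> * (a / 4) / (N + 1)"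
    using reg(1,2) \<delta> a N0 by (auto simp: \<epsilon>'_def)
  have main: "\<exists>l>0. \<exists>l'>0. \<exists>\<epsilon>>0. \<forall>U \<in> carrier_mat n r.
      frob_dist U ?S < \<epsilon> \<longrightarrow>
      factored_penalty k C A b mu U - frob_inner C Xs
        \<le> l * frob_dist (0\<^sub>m n r) (factored_subdiff n k C A b mu U) * frob_dist U ?S \<and>
      frob_dist U ?S \<le> l' * frob_dist (0\<^sub>m n r) (factored_subdiff n k C A b mu U)"
    if mu: "mu0 \<le> mu" for mu
  proof -
    define L where "L = frob_norm C + mu * meas_bound k A"
    define l' where "l' = 1 + 8 / a"
    define l where "l = 2 * R * L + 2 + 4 * L * l'"
    have "0 \<le> mu0" unfolding mu0_def using reg(1) R frob_norm_nonneg[of C] by simp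
    then have mu_nonneg: "0 \<le> mu" using mu by simp
    have L: "0 \<le> L" by (simp add: L_def mu_nonneg meas_bound_nonneg frob_norm_nonneg)
    have l': "1 \<le> l'" using a by (simp add: l'_def)
    have RL: "0 \<le> 2 * R * L" using R L by simp
    have Ll: "0 \<le> 4 * L * l'" using L l' by simp
    have l: "2 * R * L \<le> l" "2 + 4 * L * l' \<le> l" "0 < l" using RL Ll unfolding l_def by linarith+
    have bounds: "factored_penalty k C A b mu U - frob_inner C Xs
        \<le> l * frob_dist (0\<^sub>m n r) (factored_subdiff n k C A b mu U) * frob_dist U ?S \<and>
      frob_dist U ?S \<le> l' * frob_dist (0\<^sub>m n r) (factored_subdiff n k C A b mu U)"
      if U: "U \<in> carrier_mat n r" and near: "frob_dist U ?S < \<epsilon>'" for U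
    proof -
      define D where "D = frob_dist U ?S"
      define X where "X = U * transpose_mat U"
      let ?h = "penalty k C A b mu" and ?T = "factored_subdiff n k C A b mu U"
      have D0: "0 \<le> D" and D1: "D < \<epsilon>'" using near frob_dist_nonneg[OF S] by (auto simp: D_def)
      have X_sym: "X \<in> sym_mats n" unfolding X_def by (rule gram_sym[OF U])
      note Xc = sym_matsD(1)[OF X_sym]
      obtain V1 where V1: "V1 \<in> ?S" "frob_norm (U - V1) < \<epsilon>'"
        by (rule frob_dist_less_obtain[OF S near])
      have UR: "frob_norm U \<le> R"
        using frob_norm_le_add_diff[OF U SD(1)[OF V1(1)]] VR[OF V1(1)] V1(2) \<epsilon>'(2) by simp
      have hXs: "?h Xs = frob_inner C Xs"
        using b by (simp add: penalty_def Xs_feasible norm2_def)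
      have gap_le: "?h X - frob_inner C Xs \<le> 2 * R * L * D"
        unfolding D_def
      proof (rule le_mult_frob_dist[OF S RL])
        fix V assume V: "V \<in> ?S"
        have "?h X \<le> ?h Xs + L * frob_norm (X - Xs)"
          unfolding L_def by (rule penalty_Lipschitz[OF A_carrier C_carrier b mu_nonneg Xc Xs_carrier])
        also have "L * frob_norm (X - Xs) \<le> L * (2 * R * frob_norm (U - V))"
          unfolding X_def SD(2)[OF V, symmetric]
          by (intro mult_left_mono[OF _ L] frob_norm_gram_diff_le[OF U SD(1)[OF V] UR]) (use VR[OF V] in simp)
        finally show "?h X - frob_inner C Xs \<le> 2 * R * L * frob_norm (U - V)"
          unfolding hXs by (simp add: mult_ac)
      qed
      have regU: "\<gamma> * norm2 g \<le> frob_norm (meas_adj n k A g * U)" if "g \<in> carrier_vec k" for g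
        using reg(3)[OF U _ that] near \<epsilon>'(3) by simp
      have key: "?h X - frob_inner C Xs \<le> l * (2 * frob_norm (G * U)) * D \<and>
          D \<le> l' * (2 * frob_norm (G * U))"
        if G: "G \<in> convex_subdiff n ?h X" for G
      proof -
        have GL: "frob_norm G \<le> L"
          by (rule convex_subdiff_norm_le[OF _ L X_sym G])
            (unfold L_def, rule penalty_Lipschitz[OF A_carrier C_carrier b mu_nonneg _ Xc])
        obtain v where v: "v \<in> carrier_vec k" "G = C + meas_adj n k A v"
          and big: "meas_op k A X \<noteq> b \<longrightarrow> mu \<le> norm2 v"
          by (rule convex_subdiff_penalty_form[OF A_sym C_sym b mu_nonneg X_sym indep G])
        show ?thesis
        proof (cases "meas_op k A X = b")
          case False
          have "frob_norm C * R + 1 \<le> \<gamma> * mu"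
            using mu reg(1) by (simp add: mu0_def pos_divide_le_eq mult.commute)
          also have "\<dots> \<le> \<gamma> * norm2 v" using big False reg(1) by simp
          also have "\<dots> \<le> frob_norm (meas_adj n k A v * U)" by (rule regU[OF v(1)])
          also have "meas_adj n k A v * U = G * U - C * U"
            unfolding v(2) add_mult_distrib_mat[OF C_carrier meas_adj_carrier U]
            using C_carrier U by (intro eq_matI) (auto simp del: index_mult_mat(1))
          also have "frob_norm (G * U - C * U) \<le> frob_norm (G * U) + frob_norm (C * U)"
            by (rule frob_norm_diff_triangle[of _ n r]) (use v(2) C_carrier U in auto)
          also have "frob_norm (C * U) \<le> frob_norm C * R"
            by (rule order_trans[OF frob_norm_mult[OF C_carrier U]]) (intro mult_left_mono UR frob_norm_nonneg)
          finally have GU: "1 \<le> frob_norm (G * U)" by simp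
          have "2 * R * L * D \<le> l * D" using l(1) D0 by (rule mult_right_mono)
          also have "\<dots> \<le> l * (2 * frob_norm (G * U)) * D"
            using l(3) D0 GU by (intro mult_right_mono) auto
          finally have "?h X - frob_inner C Xs \<le> l * (2 * frob_norm (G * U)) * D" using gap_le by simp
          moreover have "D \<le> l' * (2 * frob_norm (G * U))"
          proof -
            have "1 * 1 \<le> l' * (2 * frob_norm (G * U))" using l' GU by (intro mult_mono) auto
            then show ?thesis using D1 \<epsilon>'(2) by simp
          qed
          ultimately show ?thesis ..
        next
          case True
          have hX: "?h X = frob_inner C X" using b True by (simp add: penalty_def norm2_def)
          show ?thesis
          proof (cases "D = 0")
            case True
            then show ?thesis using gap_le l' frob_norm_nonneg[of "G * U"] by simp
          next
            case False
            then have Dpos: "0 < D" using D0 by simp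
            \<comment> \<open>Whether the distance is attained does not matter: twice the distance suffices.\<close>
            obtain V where V: "V \<in> ?S" "frob_norm (U - V) < 2 * D"
              by (rule frob_dist_less_obtain[OF S, of U "2 * D"]) (use Dpos in \<open>auto simp: D_def\<close>)
            have feas: "meas_op k A (U * transpose_mat U) = b" using True by (simp add: X_def)
            obtain Om where Om: "Om \<in> carrier_mat r r" "transpose_mat Om * Om = 1\<^sub>m r"
              and gr: "a / 2 * (frob_norm (U - V * Om))\<^sup>2 \<le> frob_inner C (U * transpose_mat U) - frob_inner C Xs"
              using growth[OF U feas V1(1) V(1)] V1(2) \<epsilon>'(4) by auto
            have VOm: "V * Om \<in> ?S" by (rule factor_set_rotate[OF V(1) Om])
            \<comment> \<open>Growth is measured to one rotated factor, which is itself a factor, hence at least as far away as the set.\<close>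
            have "D \<le> frob_norm (U - V * Om)" unfolding D_def by (rule frob_dist_le[OF VOm])
            then have "a / 2 * D\<^sup>2 \<le> a / 2 * (frob_norm (U - V * Om))\<^sup>2"
              using a D0 by (intro mult_left_mono power_mono) auto
            then have gr': "a / 2 * D\<^sup>2 \<le> frob_inner C (U * transpose_mat U) - frob_inner C Xs"
              using gr by simp
            have small: "meas_bound k A * (4 * ((1 + 2 * frob_norm Z) * D)) \<le> \<gamma> * (a / 4)"
            proof -
              have "N * D \<le> (N + 1) * \<epsilon>'" using N0 D1 D0 by (intro mult_mono) auto
              also have "(N + 1) * \<epsilon>' \<le> \<gamma> * (a / 4)"
                using iffD1[OF pos_le_divide_eq[of "N + 1"] \<epsilon>'(5)] N0 by (simp add: mult.commute)
              finally show ?thesis by (simp add: N_def mult_ac)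
            qed
            note eb = gradient_error_bound[OF U feas v(1) regU reg(1) gr' a SD[OF V(1)] less_imp_le[OF V(2)] Dpos small]
            have 1: "D \<le> l' * (2 * frob_norm (G * U))"
            proof -
              have "D \<le> (1 + 16 / a) * frob_norm (G * U)" using eb(1) by (simp add: v(2))
              also have "\<dots> \<le> (2 * l') * frob_norm (G * U)"
                by (intro mult_right_mono frob_norm_nonneg) (simp add: l'_def)
              finally show ?thesis by (simp add: mult_ac)
            qed
            have "?h X - frob_inner C Xs \<le> 4 * frob_norm (G * U) * D + frob_norm G * (4 * D\<^sup>2)"
              using eb(2) unfolding hX v(2)[symmetric] X_def[symmetric] .
            also have "frob_norm G * (4 * D\<^sup>2) \<le> L * (4 * D\<^sup>2)" using GL by (intro mult_right_mono) auto
            also have "L * (4 * D\<^sup>2) = (4 * L * D) * D" by (simp add: power2_eq_square)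
            also have "\<dots> \<le> (4 * L * D) * (l' * (2 * frob_norm (G * U)))"
              using 1 L D0 by (intro mult_left_mono) auto
            finally have "?h X - frob_inner C Xs \<le> (2 + 4 * L * l') * ((2 * frob_norm (G * U)) * D)"
              by (simp add: algebra_simps)
            also have "\<dots> \<le> l * ((2 * frob_norm (G * U)) * D)"
              using l(2) D0 frob_norm_nonneg[of "G * U"] by (intro mult_right_mono) auto
            finally show ?thesis using 1 by (simp add: mult_ac)
          qed
        qed
      qed
      have T: "?T \<noteq> {}"
      proof -
        obtain G where "G \<in> convex_subdiff n ?h X"
          using convex_subdiff_penalty_nonempty[of k A n C b mu X, OF A_sym C_sym b mu_nonneg X_sym] by auto
        then have "2 \<cdot>\<^sub>m (G * U) \<in> ?T"
          unfolding factored_subdiff_def X_def[symmetric] by (intro CollectI exI conjI) (rule refl)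
        then show ?thesis by (intro notI) simp
      qed
      have T_key: "?h X - frob_inner C Xs \<le> l * D * frob_norm (0\<^sub>m n r - W) \<and> D \<le> l' * frob_norm (0\<^sub>m n r - W)"
        if W: "W \<in> ?T" for W
      proof -
        obtain G where G: "G \<in> convex_subdiff n ?h X" and WG: "W = 2 \<cdot>\<^sub>m (G * U)"
          using W unfolding factored_subdiff_def X_def[symmetric] mem_Collect_eq
          by (elim exE conjE) (rule that)
        have Gc: "G \<in> carrier_mat n n" using G sym_matsD(1) by (auto simp: convex_subdiff_def)
        have "0\<^sub>m n r - W = (- 2) \<cdot>\<^sub>m (G * U)"
          unfolding WG using Gc U by (intro eq_matI) (auto simp del: index_mult_mat(1))
        then have "frob_norm (0\<^sub>m n r - W) = 2 * frob_norm (G * U)" by (simp add: frob_norm_smult)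
        then show ?thesis
          using key[OF G] by (simp only: mult.assoc mult.commute[of D])
      qed
      have "?h X - frob_inner C Xs \<le> l * D * frob_dist (0\<^sub>m n r) ?T"
      proof (rule le_mult_frob_dist[OF T])
        show "0 \<le> l * D" using l(3) D0 by simp
      qed (rule conjunct1[OF T_key])
      then have "?h X - frob_inner C Xs \<le> l * frob_dist (0\<^sub>m n r) ?T * D"
        by (simp only: mult.assoc mult.commute[of D])
      moreover have "D \<le> l' * frob_dist (0\<^sub>m n r) ?T"
      proof (rule le_mult_frob_dist[OF T])
        show "0 \<le> l'" using l' by simp
      qed (rule conjunct2[OF T_key])
      ultimately show ?thesis
        unfolding factored_penalty_def X_def[symmetric] D_def[symmetric] by (rule conjI)
    qed
    have "0 < l'" using l' by simp
    show ?thesis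
      by (intro exI[of _ l] exI[of _ l'] exI[of _ \<epsilon>'] conjI[OF l(3)] conjI[OF \<open>0 < l'\<close>]
          conjI[OF \<epsilon>'(1)] ballI impI bounds)
  qed
  show ?thesis
    unfolding eventually_at_top_linorder by (rule exI[of _ mu0], rule allI, rule impI, rule main)
qed

end

section \<open>Constraint qualification and the main result\<close>

lemma norm2_vectorize:
  assumes W: "W \<in> carrier_mat n r"
  shows "norm2 (vectorize W) = frob_norm W"
proof -
  let ?f = "\<lambda>p. (W $$ (p mod n, p div n))\<^sup>2"
  have "vectorize W \<bullet> vectorize W = (\<Sum>p<r * n. ?f p)"
    using W by (simp add: vectorize_def scalar_prod_def atLeast0LessThan power2_eq_square mult.commute)
  also have "\<dots> = (\<Sum>l<r. sum ?f {l * n..<l * n + n})" by (rule sum.nat_group[symmetric])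
  also have "\<dots> = (\<Sum>l<r. \<Sum>i<n. (W $$ (i, l))\<^sup>2)"
  proof (rule sum.cong[OF refl])
    fix l
    have "sum ?f {l * n..<l * n + n} = (\<Sum>i = 0..<n. ?f (i + l * n))"
      using sum.shift_bounds_nat_ivl[of ?f 0 "l * n" n] by (simp add: add.commute)
    also have "\<dots> = (\<Sum>i<n. (W $$ (i, l))\<^sup>2)" by (intro sum.cong) auto
    finally show "sum ?f {l * n..<l * n + n} = (\<Sum>i<n. (W $$ (i, l))\<^sup>2)" .
  qed
  also have "\<dots> = (frob_norm W)\<^sup>2" unfolding frob_norm_sq_sum[OF W] by (rule sum.swap)
  finally show ?thesis by (simp add: norm2_def frob_norm_nonneg)
qed

lemma vectorize_index:
  assumes "W \<in> carrier_mat n r" "p < n * r"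
  shows "vectorize W $ p = W $$ (p mod n, p div n)"
  using assms by (auto simp: vectorize_def)

lemma vectorize_carrier:
  assumes "W \<in> carrier_mat n r"
  shows "vectorize W \<in> carrier_vec (n * r)"
  using assms by (auto simp: vectorize_def)

lemma constraint_jac_mult_vec:
  assumes A: "\<And>i. i < k \<Longrightarrow> A i \<in> carrier_mat n n" and U: "U \<in> carrier_mat n r" and g: "g \<in> carrier_vec k"
  shows "constraint_jac n r k A U *\<^sub>v g = vectorize (meas_adj n k A g * U)"
proof (rule eq_vecI)
  fix p assume "p < dim_vec (vectorize (meas_adj n k A g * U))"
  then have p: "p < n * r" using U by (simp add: vectorize_def)
  then have n: "0 < n" by (cases n) auto
  have ab: "p mod n < n" "p div n < r" using p n by (auto simp: less_mult_imp_div_less mult.commute)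
  have AU: "A i * U \<in> carrier_mat n r" if "i < k" for i using A[OF that] U by simp
  have "(constraint_jac n r k A U *\<^sub>v g) $ p = (\<Sum>i<k. (A i * U) $$ (p mod n, p div n) * g $ i)"
  proof -
    have "(constraint_jac n r k A U *\<^sub>v g) $ p = (\<Sum>i<k. constraint_jac n r k A U $$ (p, i) * g $ i)"
      using p g by (simp add: constraint_jac_def scalar_prod_def atLeast0LessThan)
    also have "\<dots> = (\<Sum>i<k. (A i * U) $$ (p mod n, p div n) * g $ i)"
    proof (rule sum.cong[OF refl])
      fix i assume "i \<in> {..<k}"
      then have i: "i < k" by simp
      have "constraint_jac n r k A U $$ (p, i) = vectorize (A i * U) $ p"
        using p i by (simp add: constraint_jac_def mat_of_cols_index)
      also have "\<dots> = (A i * U) $$ (p mod n, p div n)"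
        by (rule vectorize_index[OF AU[OF i] p])
      finally show "constraint_jac n r k A U $$ (p, i) * g $ i = (A i * U) $$ (p mod n, p div n) * g $ i"
        by simp
    qed
    finally show ?thesis .
  qed
  also have "\<dots> = (\<Sum>i<k. \<Sum>q<n. A i $$ (p mod n, q) * U $$ (q, p div n) * g $ i)"
    using A U ab by (intro sum.cong refl) (simp add: mat_mult_entry[of _ n n U r] sum_distrib_right del: index_mult_mat(1))
  also have "\<dots> = (\<Sum>q<n. \<Sum>i<k. A i $$ (p mod n, q) * U $$ (q, p div n) * g $ i)" by (rule sum.swap)
  also have "\<dots> = (\<Sum>q<n. meas_adj n k A g $$ (p mod n, q) * U $$ (q, p div n))"
    using ab by (intro sum.cong refl) (simp add: meas_adj_def sum_distrib_right sum_distrib_left mult_ac)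
  also have "\<dots> = (meas_adj n k A g * U) $$ (p mod n, p div n)"
    by (rule mat_mult_entry[OF meas_adj_carrier U ab, symmetric])
  also have "\<dots> = vectorize (meas_adj n k A g * U) $ p"
    by (rule vectorize_index[OF mult_carrier_mat[OF meas_adj_carrier U] p, symmetric])
  finally show "(constraint_jac n r k A U *\<^sub>v g) $ p = vectorize (meas_adj n k A g * U) $ p" .
qed (use U in \<open>simp add: constraint_jac_def vectorize_def\<close>)

text \<open>
  The Jacobian maps \<open>g\<close> to the vectorization of \<open>(\<Sum>g\<^sub>i A\<^sub>i) U\<close>. Without constraints both sides are \<open>0\<close>.
\<close>
lemma constraint_jac_lower_bound:
  assumes A: "\<And>i. i < k \<Longrightarrow> A i \<in> carrier_mat n n" and U: "U \<in> carrier_mat n r" and g: "g \<in> carrier_vec k"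
    and \<gamma>: "0 \<le> \<gamma>" "0 < k \<longrightarrow> \<gamma> \<le> kth_largest_sv k (constraint_jac n r k A U)"
  shows "\<gamma> * norm2 g \<le> frob_norm (meas_adj n k A g * U)"
proof (cases "0 < k")
  case True
  have M: "constraint_jac n r k A U \<in> carrier_mat (n * r) k" by (simp add: constraint_jac_def carrier_matI)
  have W: "meas_adj n k A g * U \<in> carrier_mat n r" by (rule mult_carrier_mat[OF meas_adj_carrier U])
  note v = vectorize_carrier[OF W]
  have Mg: "constraint_jac n r k A U *\<^sub>v g = vectorize (meas_adj n k A g * U)"
    by (rule constraint_jac_mult_vec[OF A U g])
  have G: "mat_of_cols k [g] \<in> carrier_mat k 1" by (simp add: carrier_matI)
  have "\<gamma> * frob_norm (mat_of_cols k [g]) \<le> frob_norm (constraint_jac n r k A U * mat_of_cols k [g])"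
    by (rule kth_largest_sv_lower_bound[OF M True _ \<gamma>(1) G]) (use \<gamma>(2) True in simp)
  then show ?thesis
    unfolding mult_mat_of_cols_single[OF M g] Mg
      frob_norm_mat_of_cols_single[OF g] frob_norm_mat_of_cols_single[OF v] norm2_vectorize[OF W] .
next
  case False
  then have "norm2 g = 0" using g by (simp add: norm2_def scalar_prod_def)
  then show ?thesis by (simp add: frob_norm_nonneg)
qed

lemma eigen_decompD:
  assumes "eigen_decomp n s X Q D"
  shows "Q \<in> carrier_mat n s" "transpose_mat Q * Q = 1\<^sub>m s"
    "X = Q * mat_diag s (\<lambda>i. D $$ (i, i)) * transpose_mat Q" "\<And>i. i < s \<Longrightarrow> 0 < D $$ (i, i)"
proof -
  have pd: "pos_def s D" and diag: "diagonal_mat D" and X: "X = Q * D * transpose_mat Q"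
    using assms by (auto simp: eigen_decomp_def)
  show Q: "Q \<in> carrier_mat n s" and "transpose_mat Q * Q = 1\<^sub>m s" using assms by (auto simp: eigen_decomp_def)
  have D: "D \<in> carrier_mat s s" using pd sym_matsD(1) by (auto simp: pos_def_def)
  have "D = mat_diag s (\<lambda>i. D $$ (i, i))"
    using D diag by (intro eq_matI) (auto simp: mat_diag_def diagonal_mat_def)
  then show "X = Q * mat_diag s (\<lambda>i. D $$ (i, i)) * transpose_mat Q" using X by simp
  fix i assume i: "i < s"
  have "0 < unit_vec s i \<bullet> (D *\<^sub>v unit_vec s i)"
    using pd i unfolding pos_def_def by (metis unit_vec_carrier unit_vec_nonzero)
  then show "0 < D $$ (i, i)" using D i by simp
qed

text \<open>
  The bound must not depend on the chosen decomposition. This holds because every entry of \<open>D\<close> is one of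
  the finitely many positive roots of the characteristic polynomial.
\<close>
lemma eigen_decomp_eigenvalues_bounded_below:
  "\<exists>m>0. \<forall>Q D. eigen_decomp n s X Q D \<longrightarrow> (\<forall>i<s. m \<le> D $$ (i, i))"
proof (cases "X \<in> carrier_mat n n")
  case False
  have "\<not> eigen_decomp n s X Q D" for Q D
  proof
    assume "eigen_decomp n s X Q D"
    from eigen_decompD[OF this] have "X \<in> carrier_mat n n" by auto
    then show False using False by simp
  qed
  then show ?thesis by (intro exI[of _ 1]) simp
next
  case True
  let ?P = "{x. poly (char_poly X) x = 0 \<and> 0 < x}"
  have "char_poly X \<noteq> 0" using degree_monic_char_poly[OF True] by auto
  then have fin: "finite ?P" using poly_roots_finite[of "char_poly X"] by (auto intro: finite_subset[rotated])
  \<comment> \<open>The element 1 covers the case that there is no positive root.\<close>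
  define m where "m = Min (insert 1 ?P)"
  have "0 < m" using fin by (simp add: m_def)
  moreover have "m \<le> D $$ (i, i)" if E: "eigen_decomp n s X Q D" and i: "i < s" for Q D i
  proof -
    note Q = eigen_decompD[OF E]
    have XQ: "X * Q = Q * mat_diag s (\<lambda>i. D $$ (i, i))"
    proof -
      have "X * Q = Q * (mat_diag s (\<lambda>i. D $$ (i, i)) * (transpose_mat Q * Q))"
        unfolding Q(3) using Q(1) by (simp add: mult_assoc_dim del: assoc_mult_mat)
      then show ?thesis unfolding Q(2) using Q(1) by simp
    qed
    have "X *\<^sub>v col Q i = col (X * Q) i" by (rule col_mult2[symmetric, OF True Q(1) i])
    also have "\<dots> = D $$ (i, i) \<cdot>\<^sub>v col Q i"
      unfolding XQ mat_diag_mult_right[OF Q(1)] using Q(1) i by (intro eq_vecI) auto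
    finally have ev: "X *\<^sub>v col Q i = D $$ (i, i) \<cdot>\<^sub>v col Q i" .
    have "col Q i \<bullet> col Q i = 1" using Q(2) i unfolding orthonormal_cols_iff[OF Q(1)] by simp
    then have "col Q i \<noteq> 0\<^sub>v n" by auto
    then have "eigenvalue X (D $$ (i, i))"
      unfolding eigenvalue_def eigenvector_def using ev Q(1) i True by (intro exI[of _ "col Q i"]) auto
    then have "D $$ (i, i) \<in> ?P" using eigenvalue_root_char_poly[OF True] Q(4)[OF i] by simp
    then show ?thesis unfolding m_def using fin by (intro Min_le) auto
  qed
  ultimately show ?thesis by blast
qed

lemma procrustes_dist_le:
  assumes "Om \<in> carrier_mat r r" "transpose_mat Om * Om = 1\<^sub>m r"
  shows "procrustes_dist r U V \<le> frob_norm (U - V * Om)"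
  unfolding procrustes_dist_def
  by (rule cINF_lower) (use assms in \<open>auto intro!: bdd_belowI2[of _ 0] frob_norm_nonneg\<close>)

lemma procrustes_dist_nonneg: "0 \<le> procrustes_dist r U V"
proof -
  have "1\<^sub>m r \<in> {Om \<in> carrier_mat r r. transpose_mat Om * Om = (1\<^sub>m r :: real mat)}" by simp
  then show ?thesis unfolding procrustes_dist_def by (intro cINF_greatest frob_norm_nonneg) blast
qed

theorem theorem4:
  fixes n k s :: nat and A :: "nat \<Rightarrow> real mat" and Xs :: "real mat" and lamZ gamQ :: real
  assumes A_sym: "\<And>i. i < k \<Longrightarrow> A i \<in> sym_mats n"
    and rank_Xs: "vec_space.rank n Xs = s"
    and lamZ_pos: "0 < lamZ" and gamQ_pos: "0 < gamQ"
  shows "\<exists>\<alpha>>0. \<forall>C b Q1 Sx r Us.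
    C \<in> sym_mats n \<and> b \<in> carrier_vec k \<and> sdp_solution n k C A b Xs \<and>
    eigen_decomp n s Xs Q1 Sx \<and>
    s \<le> r \<and> Us \<in> carrier_mat n r \<and> Us * transpose_mat Us = Xs \<and>
    constraint_qualification n r k A b Xs \<and>
    strict_complementarity n k s C A Xs lamZ \<and>
    dual_nondegenerate k s A Q1 gamQ
    \<longrightarrow>
    (\<exists>!X. sdp_solution n k C A b X) \<and>
    ((\<exists>\<delta>>0. \<forall>U \<in> carrier_mat n r.
        frob_norm (U - Us) < \<delta> \<and> meas_op k A (U * transpose_mat U) = b \<longrightarrow>
        frob_inner C (U * transpose_mat U) - frob_inner C (Us * transpose_mat Us)
          \<ge> \<alpha> / 2 * (procrustes_dist r U Us)\<^sup>2) \<and>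
     rank_quadratic_growth n k r A b (frob_inner C) Xs) \<and>
    (\<forall>\<^sub>F lam in at_top. \<exists>l>0. \<exists>l'>0. \<exists>\<epsilon>>0. \<forall>U \<in> carrier_mat n r.
        frob_dist U (factor_set n r Xs) < \<epsilon> \<longrightarrow>
        factored_penalty k C A b lam U - frob_inner C Xs
          \<le> l * frob_dist (0\<^sub>m n r) (factored_subdiff n k C A b lam U)
              * frob_dist U (factor_set n r Xs) \<and>
        frob_dist U (factor_set n r Xs)
          \<le> l' * frob_dist (0\<^sub>m n r) (factored_subdiff n k C A b lam U))"
proof (cases "psd n Xs")
  case False
  then show ?thesis
    \<comment> \<open>There is no solution in this case, so any constant will do.\<close>
    by (intro exI[of _ 1]) (simp add: sdp_solution_def sdp_feasible_def)
next
  case psd: True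
  obtain m where m: "0 < m" "\<And>Q D. eigen_decomp n s Xs Q D \<Longrightarrow> \<forall>i<s. m \<le> D $$ (i, i)"
    using eigen_decomp_eigenvalues_bounded_below[of n s Xs] by auto
  \<comment> \<open>The constant is fixed before the objective, the right-hand side, the decomposition and r are known.\<close>
  define \<alpha> where "\<alpha> = growth_const n k A Xs gamQ lamZ m"
  have \<alpha>: "0 < \<alpha>" unfolding \<alpha>_def by (rule growth_const_pos[OF psd gamQ_pos lamZ_pos m(1)])
  show ?thesis
  proof (rule exI[of _ \<alpha>], rule conjI[OF \<alpha>], intro allI impI, elim conjE)
    fix C b Q1 Sx r Us
    assume C: "C \<in> sym_mats n" and sol: "sdp_solution n k C A b Xs"
      and eig: "eigen_decomp n s Xs Q1 Sx"
      and Us: "Us \<in> carrier_mat n r" "Us * transpose_mat Us = Xs"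
      and cq: "constraint_qualification n r k A b Xs"
      and sc: "strict_complementarity n k s C A Xs lamZ"
      and nondeg: "dual_nondegenerate k s A Q1 gamQ"
    define d where "d i = Sx $$ (i, i)" for i
    note Q = eigen_decompD[OF eig, folded d_def]
    have md: "\<forall>i<s. m \<le> d i" using m(2)[OF eig] by (simp add: d_def)
    have feas: "meas_op k A Xs = b" using sol by (simp add: sdp_solution_def sdp_feasible_def)
    obtain y Z where dual: "dual_optimal n k C A Xs y Z" and gap: "s < n \<longrightarrow> lamZ \<le> kth_smallest_sv (s + 1) Z"
      using sc unfolding strict_complementarity_def by (elim exE conjE) (rule that)
    interpret sdp_certificate n k s A C Xs Q1 Z b y d gamQ lamZ
      using dual unfolding dual_optimal_def
      by unfold_locales (use A_sym C Q psd feas gap nondeg gamQ_pos lamZ_pos in auto)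
    have Us_S: "Us \<in> factor_set n r Xs" using Us by (simp add: factor_set_def)
    have unique: "\<exists>!X. sdp_solution n k C A b X"
    proof (rule ex1I[where a = Xs])
      show "sdp_solution n k C A b Xs" by (rule sol)
      fix X assume "sdp_solution n k C A b X"
      then show "X = Xs"
        using sol unfolding sdp_solution_def sdp_feasible_def by (intro optimal_unique) auto
    qed
    have growth: "\<exists>\<delta>>0. \<forall>U \<in> carrier_mat n r.
        frob_norm (U - Us) < \<delta> \<and> meas_op k A (U * transpose_mat U) = b \<longrightarrow>
        frob_inner C (U * transpose_mat U) - frob_inner C (Us * transpose_mat Us)
          \<ge> \<alpha> / 2 * (procrustes_dist r U Us)\<^sup>2"
    proof -
      obtain \<delta> where \<delta>: "0 < \<delta>" and grow: "\<And>U. U \<in> carrier_mat n r \<Longrightarrow>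
        meas_op k A (U * transpose_mat U) = b \<Longrightarrow> frob_norm (U - Us) < \<delta> \<Longrightarrow>
        \<exists>Om\<in>carrier_mat r r. transpose_mat Om * Om = 1\<^sub>m r \<and>
          \<alpha> / 2 * (frob_norm (U - Us * Om))\<^sup>2 \<le> frob_inner C (U * transpose_mat U) - frob_inner C Xs"
        using factored_growth[OF m(1) md] Us_S unfolding \<alpha>_def by blast
      have "\<alpha> / 2 * (procrustes_dist r U Us)\<^sup>2
          \<le> frob_inner C (U * transpose_mat U) - frob_inner C (Us * transpose_mat Us)"
        if U: "U \<in> carrier_mat n r" "frob_norm (U - Us) < \<delta>" "meas_op k A (U * transpose_mat U) = b" for U
      proof -
        obtain Om where Om: "Om \<in> carrier_mat r r" "transpose_mat Om * Om = 1\<^sub>m r"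
          and le: "\<alpha> / 2 * (frob_norm (U - Us * Om))\<^sup>2 \<le> frob_inner C (U * transpose_mat U) - frob_inner C Xs"
          using grow[OF U(1,3,2)] by (elim bexE conjE) (rule that)
        have "\<alpha> / 2 * (procrustes_dist r U Us)\<^sup>2 \<le> \<alpha> / 2 * (frob_norm (U - Us * Om))\<^sup>2"
          using \<alpha> by (intro mult_left_mono power_mono procrustes_dist_le[OF Om] procrustes_dist_nonneg) auto
        then show ?thesis using le unfolding Us(2) by linarith
      qed
      then show ?thesis using \<delta> by (intro exI[of _ \<delta>]) auto
    qed
    have rank_growth: "rank_quadratic_growth n k r A b (frob_inner C) Xs"
    proof -
      obtain a where "0 < a" "\<And>X. psd n X \<Longrightarrow> meas_op k A X = b \<Longrightarrow> frob_norm (X - Xs) \<le> 1 \<Longrightarrow>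
          frob_inner C Xs + a / 2 * (frob_norm (X - Xs))\<^sup>2 \<le> frob_inner C X"
        using quadratic_growth by blast
      then show ?thesis
        unfolding rank_quadratic_growth_def by (intro exI[of _ a] conjI exI[of _ 1]) auto
    qed
    obtain \<gamma> \<epsilon> where \<gamma>: "0 < \<gamma>" and \<epsilon>: "0 < \<epsilon>"
      and jac: "\<forall>U \<in> carrier_mat n r. frob_dist U (factor_set n r Xs) < \<epsilon> \<longrightarrow>
        (0 < k \<longrightarrow> \<gamma> \<le> kth_largest_sv k (constraint_jac n r k A U))"
      using cq unfolding constraint_qualification_def by (elim exE conjE) (rule that)
    have reg: "\<gamma> * norm2 g \<le> frob_norm (meas_adj n k A g * U)"
      if "U \<in> carrier_mat n r" "frob_dist U (factor_set n r Xs) < \<epsilon>" "g \<in> carrier_vec k" for U g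
      using jac that \<gamma> by (intro constraint_jac_lower_bound A_carrier) auto
    note error_bounds = penalty_error_bounds[OF m(1) md Us_S \<gamma> \<epsilon> reg]
    show "(\<exists>!X. sdp_solution n k C A b X) \<and>
      ((\<exists>\<delta>>0. \<forall>U \<in> carrier_mat n r.
        frob_norm (U - Us) < \<delta> \<and> meas_op k A (U * transpose_mat U) = b \<longrightarrow>
        frob_inner C (U * transpose_mat U) - frob_inner C (Us * transpose_mat Us)
          \<ge> \<alpha> / 2 * (procrustes_dist r U Us)\<^sup>2) \<and>
       rank_quadratic_growth n k r A b (frob_inner C) Xs) \<and>
      (\<forall>\<^sub>F lam in at_top. \<exists>l>0. \<exists>l'>0. \<exists>\<epsilon>>0. \<forall>U \<in> carrier_mat n r.
        frob_dist U (factor_set n r Xs) < \<epsilon> \<longrightarrow>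
        factored_penalty k C A b lam U - frob_inner C Xs
          \<le> l * frob_dist (0\<^sub>m n r) (factored_subdiff n k C A b lam U)
              * frob_dist U (factor_set n r Xs) \<and>
        frob_dist U (factor_set n r Xs)
          \<le> l' * frob_dist (0\<^sub>m n r) (factored_subdiff n k C A b lam U))"
      by (intro conjI unique growth rank_growth error_bounds)
  qed
qed

end
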